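(* Let $(\Omega,\sigma,X,\mathcal L)$ be a strongly measurable, forward-integrable random linear dynamical system on a separable Banach space $X$ with $\sigma$ an ergodic invertible measure preserving map of a Lebesgue probability space. Then, almost everywhere, $$\lim_{n\to\infty}\mu_n=\nu=\kappa=\lim_{n\to\infty}\tfrac1n\log\Vert\mathcal L^{(n)}_\omega\Vert_c .$$
   Context: Banach spaces are real; $\mathcal B(X)$ is the space of bounded linear operators on $X$. The cocycle $\mathcal L:\Omega\to\mathcal B(X)$ is strongly measurable if $\omega\mapsto\mathcal L_\omega x$ is measurable for each $x\in X$, and forward-integrable if $\log^+\Vert\mathcal L\Vert\in L^1(\Omega)$. Put $\mathcal L^{(0)}_\omega=\mathrm{id}_X$, $\mathcal L^{(n)}_\omega=\mathcal L_{\sigma^{n-1}\omega}\circ\mathcal L^{(n-1)}_\omega$. $\mathcal G_kX$ is the set of $k$-dimensional subspaces of $X$. For $T\in\mathcal B(X)$ let $g_T(V)=\inf\{\Vert Tx\Vert:x\in V,\Vert x\Vert=1\}$ and $\rho_k(T)=\sup_{V\in\mathcal G_kX}g_T(V)$ (with $\sup\emptyset=0$). With $\log0=-\infty$, $\mu_k=\lim_{n\to\infty}\tfrac1n\log\rho_k(\mathcal L^{(n)}_\omega)\in[-\infty,\infty)$, which exists and is constant almost everywhere, and $\nu=\lim_{k\to\infty}\mu_k$. $\Vert T\Vert_c$ is the compactness seminorm (ball measure of noncompactness): the infimum of $r>0$ such that the image under $T$ of the open unit ball of $X$ is covered by finitely many balls of radius $r$. The index of compactness is $\kappa=\lim_{n\to\infty}\tfrac1n\log\Vert\mathcal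 L^{(n)}_\omega\Vert_c$, whose limit exists and is constant almost everywhere by Kingman's theorem. *)

theory Defs
  imports "HOL-Probability.Probability"
begin

section \<open>The base dynamics\<close>

text \<open>
  A Lebesgue probability space: complete and isomorphic mod 0 to an interval with Lebesgue measure
  together with countably many atoms. Here \<open>N\<close> and \<open>Z\<close> are the discarded null sets, \<open>A\<close> is the set
  of atoms, and \<open>\<phi>\<close> is the isomorphism on the remaining part; its length \<open>a\<close> may be \<open>0\<close>.
\<close>

definition lebesgue_probability_space :: "'w measure \<Rightarrow> bool" where
  "lebesgue_probability_space M \<longleftrightarrow>
     prob_space M \<and> complete_measure M \<and>
     (\<exists>N A R Z a \<phi>.
        N \<in> null_sets M \<and>
        countable A \<and> A \<subseteq> space M \<and> (\<forall>x\<in>A. {x} \<in> sets M \<and> emeasure M {x} > 0) \<and>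
        R = space M - N - A \<and>
        0 \<le> a \<and> Z \<in> null_sets lebesgue \<and>
        bij_betw \<phi> R ({0..a::real} - Z) \<and>
        \<phi> \<in> restrict_space M R \<rightarrow>\<^sub>M lebesgue_on ({0..a} - Z) \<and>
        the_inv_into R \<phi> \<in> lebesgue_on ({0..a} - Z) \<rightarrow>\<^sub>M restrict_space M R \<and>
        distr (restrict_space M R) (lebesgue_on ({0..a} - Z)) \<phi> = lebesgue_on ({0..a} - Z))"

definition invertible_measure_preserving :: "'w measure \<Rightarrow> ('w \<Rightarrow> 'w) \<Rightarrow> bool" where
  "invertible_measure_preserving M \<sigma> \<longleftrightarrow>
     bij_betw \<sigma> (space M) (space M) \<and>
     \<sigma> \<in> M \<rightarrow>\<^sub>M M \<and> the_inv_into (space M) \<sigma> \<in> M \<rightarrow>\<^sub>M M \<and>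
     distr M M \<sigma> = M"

definition ergodic :: "'w measure \<Rightarrow> ('w \<Rightarrow> 'w) \<Rightarrow> bool" where
  "ergodic M \<sigma> \<longleftrightarrow>
     (\<forall>A\<in>sets M. \<sigma> -` A \<inter> space M = A \<longrightarrow> measure M A = 0 \<or> measure M A = 1)"

section \<open>Cocycles of bounded operators\<close>

definition strongly_measurable ::
    "'w measure \<Rightarrow> ('w \<Rightarrow> 'a::real_normed_vector \<Rightarrow>\<^sub>L 'a) \<Rightarrow> bool" where
  "strongly_measurable M L \<longleftrightarrow> (\<forall>x. (\<lambda>\<omega>. blinfun_apply (L \<omega>) x) \<in> borel_measurable M)"

text \<open>Since \<open>ln 0 = 0\<close> in HOL, \<open>max 0 (ln t)\<close> is \<open>log\<^sup>+ t\<close> also at \<open>t = 0\<close>.\<close>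

definition forward_integrable ::
    "'w measure \<Rightarrow> ('w \<Rightarrow> 'a::real_normed_vector \<Rightarrow>\<^sub>L 'a) \<Rightarrow> bool" where
  "forward_integrable M L \<longleftrightarrow> integrable M (\<lambda>\<omega>. max 0 (ln (norm (L \<omega>))))"

primrec cocycle ::
    "('w \<Rightarrow> 'w) \<Rightarrow> ('w \<Rightarrow> 'a::real_normed_vector \<Rightarrow>\<^sub>L 'a) \<Rightarrow> nat \<Rightarrow> 'w \<Rightarrow> 'a \<Rightarrow>\<^sub>L 'a" where
  "cocycle \<sigma> L 0 \<omega> = id_blinfun"
| "cocycle \<sigma> L (Suc n) \<omega> = L ((\<sigma> ^^ n) \<omega>) o\<^sub>L cocycle \<sigma> L n \<omega>"

section \<open>Characteristic numbers of an operator\<close>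

text \<open>Subspaces are given by finite bases because HOL's \<open>dim\<close> is \<open>0\<close> on infinite-dimensional ones.\<close>

definition k_subspaces :: "nat \<Rightarrow> 'a::real_vector set set" where
  "k_subspaces k = {V. \<exists>B. finite B \<and> independent B \<and> card B = k \<and> V = span B}"

definition lower_bound_on :: "('a::real_normed_vector \<Rightarrow>\<^sub>L 'a) \<Rightarrow> 'a set \<Rightarrow> real" where
  "lower_bound_on T V = (INF x\<in>{x\<in>V. norm x = 1}. norm (blinfun_apply T x))"

definition rho :: "nat \<Rightarrow> ('a::real_normed_vector \<Rightarrow>\<^sub>L 'a) \<Rightarrow> real" where
  "rho k T =
     (if (k_subspaces k :: 'a set set) = {} then 0
      else (SUP V\<in>k_subspaces k. lower_bound_on T V))"

definition compactness_seminorm :: "('a::real_normed_vector \<Rightarrow>\<^sub>L 'a) \<Rightarrow> real" where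
  "compactness_seminorm T =
     Inf {r. r > 0 \<and> (\<exists>C. finite C \<and> blinfun_apply T ` ball 0 1 \<subseteq> (\<Union>c\<in>C. ball c r))}"

section \<open>Exponents\<close>

definition elog :: "real \<Rightarrow> ereal" where
  "elog t = (if t \<le> 0 then -\<infinity> else ereal (ln t))"

text \<open>The constant almost-everywhere value of a pointwise limit (unique on a probability space).\<close>

definition ae_lim :: "'w measure \<Rightarrow> (nat \<Rightarrow> 'w \<Rightarrow> ereal) \<Rightarrow> ereal" where
  "ae_lim M f = (THE c. AE \<omega> in M. (\<lambda>n. f n \<omega>) \<longlonglongrightarrow> c)"

text \<open>The exponents are meaningful for \<open>k \<ge> 1\<close>.\<close>

definition mu ::
    "'w measure \<Rightarrow> ('w \<Rightarrow> 'w) \<Rightarrow> ('w \<Rightarrow> 'a::real_normed_vector \<Rightarrow>\<^sub>L 'a) \<Rightarrow> nat \<Rightarrow> ereal" where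
  "mu M \<sigma> L k = ae_lim M (\<lambda>n \<omega>. ereal (1 / real n) * elog (rho k (cocycle \<sigma> L n \<omega>)))"

definition nu ::
    "'w measure \<Rightarrow> ('w \<Rightarrow> 'w) \<Rightarrow> ('w \<Rightarrow> 'a::real_normed_vector \<Rightarrow>\<^sub>L 'a) \<Rightarrow> ereal" where
  "nu M \<sigma> L = lim (mu M \<sigma> L)"

definition kappa ::
    "'w measure \<Rightarrow> ('w \<Rightarrow> 'w) \<Rightarrow> ('w \<Rightarrow> 'a::real_normed_vector \<Rightarrow>\<^sub>L 'a) \<Rightarrow> ereal" where
  "kappa M \<sigma> L =
     ae_lim M (\<lambda>n \<omega>. ereal (1 / real n) * elog (compactness_seminorm (cocycle \<sigma> L n \<omega>)))"

end

theory Submission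
  imports Defs
begin

text \<open>
  Everything is deduced from two families of nonnegative functions \<open>q\<close> of an operator that
  satisfy \<open>q (S T) \<le> q S * q T\<close> and are bounded by a power of the norm:

  \<^item> the norm \<open>wedge_norm k\<close> of the \<open>k\<close>-th exterior power, in the form of a supremum of alternating
  \<open>k\<close>-forms of norm at most \<open>1\<close>;
  \<^item> for \<open>s \<ge> 0\<close> the gauge \<open>entropy_gauge s\<close>, the infimum of \<open>r * K powr s\<close> over all coverings of the
  image of the unit ball by \<open>K\<close> balls of radius \<open>r\<close>. For \<open>s = 0\<close> the number of balls does not count, and
  the gauge is the compactness seminorm.

  Each of them is measurable along a strongly measurable family of operators, and therefore has an
  almost everywhere constant exponential growth rate along the cocycle
  (\<open>subcocycle_rate_converges\<close>, a form of Kingman's theorem that allows the rate \<open>-\<infinity>\<close>).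

  The exponents \<open>\<mu>\<^sub>k\<close> exist because \<open>rho k\<close> agrees with the quotient \<open>wedge_norm k / wedge_norm (k - 1)\<close>
  up to factors that depend on \<open>k\<close> only (\<open>wedge_norm_Suc_le\<close>, \<open>rho_wedge_norm_le\<close>). Such factors do not
  change an exponential rate, since \<open>k\<close> is fixed while \<open>n\<close> tends to infinity.

  For \<open>\<kappa> \<le> \<mu>\<^sub>k\<close>, an operator that is far from compact expands, by a factor of the size of its compactness
  seminorm, some direction on which finitely many prescribed functionals are tiny. Adding such
  directions one at a time makes exterior powers grow, so that the compactness seminorm is at most
  \<open>2 * k^2 * rho k\<close> (\<open>entropy_gauge_0_le_rho\<close>).

  For \<open>\<nu> \<le> \<kappa>\<close>, a grid of points in a \<open>k\<close>-dimensional space on which the operator expands is mapped to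
  a separated set; counting it against a covering gives \<open>rho k \<le> 8 * k^2 * entropy_gauge (1 / k)\<close>
  (\<open>rho_le_entropy_gauge\<close>). For a single operator \<open>entropy_gauge (1 / k)\<close> tends to the compactness seminorm
  as \<open>k\<close> grows. So for \<open>b > \<kappa>\<close> the set of points at which no time \<open>n \<le> k\<close> brings
  \<open>entropy_gauge (1 / k)\<close> of the \<open>n\<close>-th iterate below \<open>exp (n * b)\<close> shrinks to a null set. An orbit can be
  cut greedily into good stretches and single bad steps, and the bad steps contribute to the growth
  rate at most an integral over this shrinking set (\<open>subcocycle_shrinking_bad_set\<close>). Hence
  \<open>\<mu>\<^sub>k\<close> is at most any prescribed number above \<open>\<kappa>\<close> once \<open>k\<close> is large.
\<close>

section \<open>Norming functionals\<close>

definition sublinear :: "('a::real_vector \<Rightarrow> real) \<Rightarrow> bool" where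
  "sublinear p \<longleftrightarrow> (\<forall>x y. p (x + y) \<le> p x + p y) \<and> (\<forall>t>0. \<forall>x. p (t *\<^sub>R x) \<le> t * p x)"

lemma sublinear_zero:
  assumes "sublinear p"
  shows "p 0 = 0"
proof -
  have "p (0 + 0) \<le> p 0 + p 0" using assms unfolding sublinear_def by blast
  moreover have "p ((1/2) *\<^sub>R 0) \<le> (1/2) * p 0"
    using assms unfolding sublinear_def by (metis half_gt_zero_iff zero_less_one)
  ultimately show ?thesis by simp
qed

lemma sublinear_minus:
  assumes "sublinear p"
  shows "- p (- x) \<le> p x"
proof -
  have "p (x + - x) \<le> p x + p (- x)" using assms unfolding sublinear_def by blast
  then show ?thesis using sublinear_zero[OF assms] by simp
qed

text \<open>
  A sublinear functional that is minimal below another one must satisfy \<open>q (- a) \<le> - q a\<close> for every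
  \<open>a\<close>, which makes it odd and hence linear. This lemma provides the competitor: the infimum over \<open>t\<close>
  stays sublinear and becomes odd along the direction \<open>a\<close>.
\<close>

lemma sublinear_improve:
  fixes p :: "'a::real_vector \<Rightarrow> real"
  assumes p: "sublinear p"
  obtains q where "sublinear q" "\<And>x. q x \<le> p x" "q (- a) \<le> - p a"
proof
  define q where "q x = (INF t\<in>{0..}. p (x + t *\<^sub>R a) - t * p a)" for x
  have add: "p (x + y) \<le> p x + p y" for x y using p by (simp add: sublinear_def)
  have mul: "p (t *\<^sub>R x) \<le> t * p x" if "t > 0" for t x using p that by (simp add: sublinear_def)
  have mul': "p (t *\<^sub>R x) = t * p x" if "t \<ge> 0" for t x
  proof (cases "t = 0")
    case False
    then have "p ((1/t) *\<^sub>R (t *\<^sub>R x)) \<le> (1/t) * p (t *\<^sub>R x)" using that by (intro mul) auto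
    then have "t * p x \<le> p (t *\<^sub>R x)" using False that by (simp add: field_simps)
    then show ?thesis using mul[of t x] False that by auto
  qed (simp add: sublinear_zero[OF p])
  have low: "- p (- x) \<le> p (x + t *\<^sub>R a) - t * p a" if "t \<ge> 0" for x t
    using add[of "x + t *\<^sub>R a" "- x"] mul'[OF that, of a] by simp
  have bdd: "bdd_below ((\<lambda>t. p (x + t *\<^sub>R a) - t * p a) ` {0..})" for x
    using low[of _ x] by (intro bdd_belowI2[of _ "- p (- x)"]) auto
  have le: "q x \<le> p (x + t *\<^sub>R a) - t * p a" if "t \<ge> 0" for x t
    unfolding q_def using that by (intro cINF_lower bdd) auto
  have ge: "c \<le> q x" if "\<And>t. t \<ge> 0 \<Longrightarrow> c \<le> p (x + t *\<^sub>R a) - t * p a" for c x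
    unfolding q_def using that by (intro cINF_greatest) auto
  show "q x \<le> p x" for x using le[of 0 x] by simp
  show "q (- a) \<le> - p a" using le[of 1 "- a"] sublinear_zero[OF p] by simp
  show "sublinear q" unfolding sublinear_def
  proof (intro conjI allI impI)
    fix x y
    have "q (x + y) - q y \<le> q x"
    proof (rule ge)
      fix t :: real assume t: "t \<ge> 0"
      have "q (x + y) - (p (x + t *\<^sub>R a) - t * p a) \<le> q y"
      proof (rule ge)
        fix s :: real assume s: "s \<ge> 0"
        have "q (x + y) \<le> p ((x + t *\<^sub>R a) + (y + s *\<^sub>R a)) - (t + s) * p a"
          using le[of "t + s" "x + y"] t s by (simp add: algebra_simps)
        also have "\<dots> \<le> p (x + t *\<^sub>R a) + p (y + s *\<^sub>R a) - (t + s) * p a" using add by simp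
        finally show "q (x + y) - (p (x + t *\<^sub>R a) - t * p a) \<le> p (y + s *\<^sub>R a) - s * p a"
          by (simp add: algebra_simps)
      qed
      then show "q (x + y) - q y \<le> p (x + t *\<^sub>R a) - t * p a" by simp
    qed
    then show "q (x + y) \<le> q x + q y" by simp
  next
    fix t :: real and x assume t: "t > 0"
    have "q (t *\<^sub>R x) / t \<le> q x"
    proof (rule ge)
      fix s :: real assume s: "s \<ge> 0"
      have "q (t *\<^sub>R x) \<le> p (t *\<^sub>R (x + s *\<^sub>R a)) - (t * s) * p a"
        using le[of "t * s" "t *\<^sub>R x"] t s by (simp add: algebra_simps)
      also have "\<dots> = t * (p (x + s *\<^sub>R a) - s * p a)"
        using t by (subst mul') (simp_all add: right_diff_distrib)
      finally show "q (t *\<^sub>R x) / t \<le> p (x + s *\<^sub>R a) - s * p a"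
        using t by (simp add: field_simps)
    qed
    then show "q (t *\<^sub>R x) \<le> t * q x" using t by (simp add: field_simps)
  qed
qed

text \<open>
  The Hahn-Banach theorem: by Zorn's lemma there is a minimal sublinear functional below \<open>q\<close>, and
  minimality makes it linear.
\<close>

lemma linear_below_sublinear:
  fixes q :: "'a::real_vector \<Rightarrow> real"
  assumes q: "sublinear q"
  obtains \<theta> where "linear \<theta>" "\<And>x. \<theta> x \<le> q x"
proof -
  define A where "A = {p. sublinear p \<and> (\<forall>x. p x \<le> q x)}"
  define P where "P = (\<lambda>f g :: 'a \<Rightarrow> real. \<forall>x. g x \<le> f x)"
  have "\<exists>m\<in>A. \<forall>a\<in>A. P m a \<longrightarrow> a = m"
  proof (rule predicate_Zorn)
    show "partial_order_on A (relation_of P A)"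
      by (rule partial_order_on_relation_ofI) (auto simp: P_def fun_eq_iff intro: order_trans order_antisym)
  next
    fix C assume C: "C \<in> Chains (relation_of P A)"
    then have CA: "C \<subseteq> A" by (auto simp: Chains_def relation_of_def)
    have tot: "P f g \<or> P g f" if "f \<in> C" "g \<in> C" for f g
      using C that by (auto simp: Chains_def relation_of_def)
    show "\<exists>u\<in>A. \<forall>a\<in>C. P a u"
    proof (cases "C = {}")
      case True
      have "q \<in> A" using q by (simp add: A_def)
      with True show ?thesis by auto
    next
      case False
      define u where "u x = (INF p\<in>C. p x)" for x
      have "- q (- x) \<le> p x" if "p \<in> C" for p x
      proof -
        have "- p (- x) \<le> p x" "p (- x) \<le> q (- x)"
          using that CA sublinear_minus[of p x] by (auto simp: A_def)
        then show ?thesis by linarith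
      qed
      then have bdd: "bdd_below ((\<lambda>p. p x) ` C)" for x by (intro bdd_belowI2) auto
      have le: "u x \<le> p x" if "p \<in> C" for p x
        unfolding u_def by (intro cINF_lower bdd that)
      have ge: "c \<le> u x" if "\<And>p. p \<in> C \<Longrightarrow> c \<le> p x" for c x
        unfolding u_def using that False by (intro cINF_greatest) auto
      have "u (x + y) \<le> u x + u y" for x y
      proof -
        have "u (x + y) - u y \<le> u x"
        proof (rule ge)
          fix p assume p: "p \<in> C"
          have "u (x + y) - p x \<le> u y"
          proof (rule ge)
            fix p' assume p': "p' \<in> C"
            obtain r where r: "r \<in> C" "r x \<le> p x" "r y \<le> p' y"
              using tot[OF p p'] p p' unfolding P_def by auto
            have "u (x + y) \<le> r (x + y)" using le r by auto
            also have "\<dots> \<le> r x + r y" using r CA by (auto simp: A_def sublinear_def)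
            finally show "u (x + y) - p x \<le> p' y" using r by simp
          qed
          then show "u (x + y) - u y \<le> p x" by simp
        qed
        then show ?thesis by simp
      qed
      moreover have "u (t *\<^sub>R x) \<le> t * u x" if t: "t > 0" for t x
      proof -
        have "u (t *\<^sub>R x) / t \<le> u x"
        proof (rule ge)
          fix p assume p: "p \<in> C"
          have "u (t *\<^sub>R x) \<le> p (t *\<^sub>R x)" using le p by auto
          also have "\<dots> \<le> t * p x" using p CA t by (auto simp: A_def sublinear_def)
          finally show "u (t *\<^sub>R x) / t \<le> p x" using t by (simp add: field_simps)
        qed
        then show ?thesis using t by (simp add: field_simps)
      qed
      moreover obtain p0 where "p0 \<in> C" using False by auto
      then have "u x \<le> q x" for x using le[of p0 x] CA by (auto simp: A_def intro: order_trans)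
      ultimately have "u \<in> A" by (auto simp: A_def sublinear_def)
      then show ?thesis using le by (auto simp: P_def)
    qed
  qed
  then obtain p where p: "p \<in> A" and min: "\<And>p'. p' \<in> A \<Longrightarrow> P p p' \<Longrightarrow> p' = p" by blast
  have sub: "sublinear p" and pq: "\<And>x. p x \<le> q x" using p by (auto simp: A_def)
  have add: "p (x + y) \<le> p x + p y" for x y using sub by (simp add: sublinear_def)
  have odd: "p (- a) = - p a" for a
  proof -
    obtain r where r: "sublinear r" "\<And>x. r x \<le> p x" "r (- a) \<le> - p a"
      using sublinear_improve[OF sub] by metis
    have "r = p" using r pq by (intro min) (auto simp: A_def P_def intro: order_trans)
    then show ?thesis using r(3) sublinear_minus[OF sub, of a] by simp
  qed
  have addeq: "p (x + y) = p x + p y" for x y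
    using add[of x y] add[of "- x" "- y"] odd[of "x + y"] odd[of x] odd[of y] by simp
  have pos: "p (t *\<^sub>R x) = t * p x" if "t > 0" for t x
  proof -
    have "p (t *\<^sub>R x) \<le> t * p x" "p (t *\<^sub>R (- x)) \<le> t * p (- x)"
      using sub that by (auto simp: sublinear_def simp del: scaleR_minus_right)
    then show ?thesis using odd[of "t *\<^sub>R x"] odd[of x] by simp
  qed
  have "p (t *\<^sub>R x) = t * p x" for t x
  proof -
    consider "t > 0" | "t = 0" | "- t > 0" by linarith
    then show ?thesis
    proof cases
      case 3
      then show ?thesis using pos[OF 3, of x] odd[of "t *\<^sub>R x"] by simp
    qed (auto simp: pos sublinear_zero[OF sub])
  qed
  then have "linear p" using addeq by (intro linearI) auto
  then show thesis using pq that by blast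
qed

text \<open>
  Improving the norm along \<open>v\<close> before passing to a linear minorant forces the value \<open>norm v\<close> at \<open>v\<close>.
\<close>

lemma norming_functional:
  fixes v :: "'a::real_normed_vector"
  obtains \<theta> :: "'a \<Rightarrow> real" where "linear \<theta>" "\<And>x. \<bar>\<theta> x\<bar> \<le> norm x" "\<theta> v = norm v"
proof -
  have "sublinear (norm :: 'a \<Rightarrow> real)" by (auto simp: sublinear_def norm_triangle_ineq)
  then obtain q :: "'a \<Rightarrow> real" where q: "sublinear q" "\<And>x. q x \<le> norm x" "q (- v) \<le> - norm v"
    using sublinear_improve by metis
  obtain \<theta> where \<theta>: "linear \<theta>" "\<And>x. \<theta> x \<le> q x" using linear_below_sublinear[OF q(1)] by metis
  have neg: "\<theta> (- x) = - \<theta> x" for x using \<theta>(1) by (simp add: linear_neg)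
  have le: "\<theta> x \<le> norm x" for x using \<theta>(2) q(2) order_trans by blast
  have "\<bar>\<theta> x\<bar> \<le> norm x" for x using le[of x] le[of "- x"] neg[of x] by simp
  moreover have "\<theta> v = norm v" using \<theta>(2)[of "- v"] q(3) neg[of v] le[of v] by simp
  ultimately show thesis using that \<theta>(1) by blast
qed

section \<open>Alternating forms and the norm of an exterior power\<close>

text \<open>
  Multilinear alternating forms in the first \<open>k\<close> entries of a sequence, of norm at most \<open>1\<close>.
  Sequences instead of \<open>k\<close>-tuples let one type serve all \<open>k\<close>; the first clause makes the entries from
  \<open>k\<close> on irrelevant.
\<close>

definition alt_form :: "nat \<Rightarrow> ((nat \<Rightarrow> 'a::real_normed_vector) \<Rightarrow> real) \<Rightarrow> bool" where
  "alt_form k w \<longleftrightarrow>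
     (\<forall>x y. (\<forall>j<k. x j = y j) \<longrightarrow> w x = w y) \<and>
     (\<forall>x. \<forall>j<k. linear (\<lambda>y. w (x(j := y)))) \<and>
     (\<forall>x. \<forall>i<k. \<forall>j<k. i \<noteq> j \<longrightarrow> x i = x j \<longrightarrow> w x = 0) \<and>
     (\<forall>x. \<bar>w x\<bar> \<le> (\<Prod>j<k. norm (x j)))"

lemma alt_form_local: "alt_form k w \<Longrightarrow> (\<And>j. j < k \<Longrightarrow> x j = y j) \<Longrightarrow> w x = w y"
  by (auto simp: alt_form_def)

lemma alt_form_linear: "alt_form k w \<Longrightarrow> j < k \<Longrightarrow> linear (\<lambda>y. w (x(j := y)))"
  by (auto simp: alt_form_def)

lemma alt_form_repeat: "alt_form k w \<Longrightarrow> i < k \<Longrightarrow> j < k \<Longrightarrow> i \<noteq> j \<Longrightarrow> x i = x j \<Longrightarrow> w x = 0"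
  by (auto simp: alt_form_def)

lemma alt_form_bound: "alt_form k w \<Longrightarrow> \<bar>w x\<bar> \<le> (\<Prod>j<k. norm (x j))"
  by (auto simp: alt_form_def)

text \<open>
  Polarisation: expand the value at the repeated entry \<open>a + b\<close>.
\<close>

lemma alt_form_swap:
  assumes w: "alt_form k w" and ij: "i < k" "j < k" "i \<noteq> j"
  shows "w (x(i := b, j := a)) = - w (x(i := a, j := b))"
proof -
  define f where "f u v = w (x(i := u, j := v))" for u v
  have l2: "linear (\<lambda>v. f u v)" for u
    unfolding f_def using alt_form_linear[OF w ij(2)] by simp
  have l1: "linear (\<lambda>u. f u v)" for v
    unfolding f_def using alt_form_linear[OF w ij(1), of "x(j := v)"] ij(3)
    by (simp add: fun_upd_twist)
  have z: "f u u = 0" for u unfolding f_def using ij by (intro alt_form_repeat[OF w ij]) auto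
  have "0 = f (a + b) (a + b)" using z by simp
  also have "\<dots> = f a a + f a b + (f b a + f b b)"
    by (simp add: linear_add[OF l1] linear_add[OF l2])
  finally show ?thesis using z by (simp add: f_def)
qed

lemma alt_form_scale:
  assumes w: "alt_form k w"
  shows "w (\<lambda>i. c i *\<^sub>R x i) = (\<Prod>i<k. c i) * w x"
proof -
  have "w (\<lambda>i. if i < m then c i *\<^sub>R x i else x i) = (\<Prod>i<m. c i) * w x" if "m \<le> k" for m
    using that
  proof (induction m)
    case (Suc m)
    let ?y = "\<lambda>i. if i < m then c i *\<^sub>R x i else x i"
    have "w (\<lambda>i. if i < Suc m then c i *\<^sub>R x i else x i) = w (?y(m := c m *\<^sub>R x m))"
      by (rule arg_cong[of _ _ w]) (auto simp: fun_eq_iff less_Suc_eq)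
    also have "\<dots> = c m * w (?y(m := x m))"
      using linear_scale[OF alt_form_linear[OF w, of m ?y], of "c m" "x m"] Suc.prems by simp
    also have "?y(m := x m) = ?y" by (auto simp: fun_eq_iff)
    finally show ?case using Suc by simp
  qed simp
  from this[of k] have "w (\<lambda>i. if i < k then c i *\<^sub>R x i else x i) = (\<Prod>i<k. c i) * w x" by simp
  moreover have "w (\<lambda>i. if i < k then c i *\<^sub>R x i else x i) = w (\<lambda>i. c i *\<^sub>R x i)"
    by (rule alt_form_local[OF w]) auto
  ultimately show ?thesis by simp
qed

text \<open>
  The norm of the \<open>k\<close>-th exterior power of \<open>T\<close> when exterior powers carry the projective norm, that is,
  the norm dual to alternating forms.
\<close>

definition wedge_norm :: "nat \<Rightarrow> ('a::real_normed_vector \<Rightarrow>\<^sub>L 'b::real_normed_vector) \<Rightarrow> real" where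
  "wedge_norm k T =
     Sup {\<bar>w (\<lambda>i. T (x i))\<bar> | w x. alt_form k w \<and> (\<forall>j<k. norm (x j) \<le> 1)}"

lemma wedge_norm_elem_le:
  assumes "alt_form k w" "\<forall>j<k. norm (x j) \<le> 1"
  shows "\<bar>w (\<lambda>i. blinfun_apply T (x i))\<bar> \<le> norm T ^ k"
proof -
  have "\<bar>w (\<lambda>i. blinfun_apply T (x i))\<bar> \<le> (\<Prod>j<k. norm (T (x j)))"
    using alt_form_bound[OF assms(1)] .
  also have "\<dots> \<le> (\<Prod>j<k. norm T)"
  proof (rule prod_mono)
    fix j assume "j \<in> {..<k}"
    then show "0 \<le> norm (T (x j)) \<and> norm (T (x j)) \<le> norm T"
      using norm_blinfun[of T "x j"] assms(2)
      by (metis lessThan_iff mult.right_neutral mult_left_mono norm_ge_zero order_trans)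
  qed
  finally show ?thesis by simp
qed

lemma alt_form_zero: "alt_form k (\<lambda>_. 0)"
  by (simp add: alt_form_def linear_iff prod_nonneg)

lemma wedge_norm_bdd:
  "bdd_above {\<bar>w (\<lambda>i. blinfun_apply T (x i))\<bar> | w x. alt_form k w \<and> (\<forall>j<k. norm (x j) \<le> 1)}"
proof (rule bdd_aboveI[of _ "norm T ^ k"])
  fix r assume "r \<in> {\<bar>w (\<lambda>i. T (x i))\<bar> | w x. alt_form k w \<and> (\<forall>j<k. norm (x j) \<le> 1)}"
  then obtain w x where "r = \<bar>w (\<lambda>i. T (x i))\<bar>" "alt_form k w" "\<forall>j<k. norm (x j) \<le> 1" by auto
  then show "r \<le> norm T ^ k" using wedge_norm_elem_le[of k w x T] by simp
qed

lemma wedge_norm_upper: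
  assumes "alt_form k w" "\<And>j. j < k \<Longrightarrow> norm (x j) \<le> 1"
  shows "\<bar>w (\<lambda>i. blinfun_apply T (x i))\<bar> \<le> wedge_norm k T"
  unfolding wedge_norm_def
  by (intro cSup_upper wedge_norm_bdd CollectI exI[of _ w] exI[of _ x]) (simp add: assms)

lemma wedge_norm_least:
  fixes T :: "'a::real_normed_vector \<Rightarrow>\<^sub>L 'b::real_normed_vector"
  assumes "\<And>w x. alt_form k w \<Longrightarrow> (\<And>j. j < k \<Longrightarrow> norm (x j) \<le> 1) \<Longrightarrow> \<bar>w (\<lambda>i. T (x i))\<bar> \<le> c"
  shows "wedge_norm k T \<le> c"
  unfolding wedge_norm_def
proof (rule cSup_least)
  have "\<bar>(\<lambda>_. 0) (\<lambda>i. T ((\<lambda>_. 0) i))\<bar>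
      \<in> {\<bar>w (\<lambda>i. T (x i))\<bar> | w x. alt_form k w \<and> (\<forall>j<k. norm (x j) \<le> 1)}"
    by (intro CollectI exI[of _ "\<lambda>_. 0"]) (simp add: alt_form_zero)
  then show "{\<bar>w (\<lambda>i. T (x i))\<bar> | w x. alt_form k w \<and> (\<forall>j<k. norm (x j) \<le> 1)} \<noteq> {}" by blast
next
  fix r assume "r \<in> {\<bar>w (\<lambda>i. T (x i))\<bar> | w x. alt_form k w \<and> (\<forall>j<k. norm (x j) \<le> 1)}"
  then obtain w x where "r = \<bar>w (\<lambda>i. T (x i))\<bar>" "alt_form k w" "\<forall>j<k. norm (x j) \<le> 1" by auto
  then show "r \<le> c" using assms[of w x] by simp
qed

lemma wedge_norm_less:
  fixes T :: "'a::real_normed_vector \<Rightarrow>\<^sub>L 'b::real_normed_vector"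
  assumes "c < wedge_norm k T"
  obtains w x where "alt_form k w" "\<And>j. j < k \<Longrightarrow> norm (x j) \<le> 1" "c < \<bar>w (\<lambda>i. T (x i))\<bar>"
proof -
  have "\<exists>w x. alt_form k w \<and> (\<forall>j<k. norm (x j) \<le> 1) \<and> c < \<bar>w (\<lambda>i. T (x i))\<bar>"
  proof (rule ccontr)
    assume no: "\<nexists>w x. alt_form k w \<and> (\<forall>j<k. norm (x j) \<le> 1) \<and> c < \<bar>w (\<lambda>i. T (x i))\<bar>"
    have "wedge_norm k T \<le> c"
    proof (rule wedge_norm_least)
      fix w :: "(nat \<Rightarrow> 'b) \<Rightarrow> real" and x :: "nat \<Rightarrow> 'a"
      assume "alt_form k w" "\<And>j. j < k \<Longrightarrow> norm (x j) \<le> 1"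
      then have "\<not> c < \<bar>w (\<lambda>i. T (x i))\<bar>" using no by auto
      then show "\<bar>w (\<lambda>i. T (x i))\<bar> \<le> c" by simp
    qed
    then show False using assms by simp
  qed
  then show thesis using that by auto
qed

lemma wedge_norm_nonneg: "0 \<le> wedge_norm k T"
  using wedge_norm_upper[OF alt_form_zero, of k "\<lambda>_. 0" T] by simp

lemma wedge_norm_le_power: "wedge_norm k T \<le> norm T ^ k"
  by (rule wedge_norm_least) (simp add: wedge_norm_elem_le)

lemma wedge_norm_0: "wedge_norm 0 T = 1"
proof -
  have "alt_form 0 (\<lambda>_. 1)" by (auto simp: alt_form_def)
  from wedge_norm_upper[OF this, where T = T] wedge_norm_le_power[of 0 T] show ?thesis by simp
qed

lemma wedge_norm_homogeneous:
  assumes w: "alt_form k w"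
  shows "\<bar>w (\<lambda>i. blinfun_apply T (x i))\<bar> \<le> wedge_norm k T * (\<Prod>j<k. norm (x j))"
proof -
  define u where "u i = x i /\<^sub>R norm (x i)" for i
  have x: "x i = norm (x i) *\<^sub>R u i" for i by (cases "x i = 0") (auto simp: u_def)
  have u: "norm (u i) \<le> 1" for i by (cases "x i = 0") (auto simp: u_def)
  have "T (x i) = norm (x i) *\<^sub>R T (u i)" for i
    using arg_cong[OF x, of "blinfun_apply T"] by (simp add: blinfun.scaleR_right)
  then have "w (\<lambda>i. T (x i)) = w (\<lambda>i. norm (x i) *\<^sub>R T (u i))" by presburger
  also have "\<dots> = (\<Prod>j<k. norm (x j)) * w (\<lambda>i. T (u i))" by (rule alt_form_scale[OF w])
  finally have "\<bar>w (\<lambda>i. T (x i))\<bar> = (\<Prod>j<k. norm (x j)) * \<bar>w (\<lambda>i. T (u i))\<bar>"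
    by (simp add: abs_mult prod_nonneg)
  also have "\<dots> \<le> (\<Prod>j<k. norm (x j)) * wedge_norm k T"
    by (intro mult_left_mono wedge_norm_upper[OF w] prod_nonneg u) auto
  finally show ?thesis by (simp add: mult.commute)
qed

text \<open>
  Exterior powers are functorial: pulling a form back along \<open>S\<close> and dividing by \<open>wedge_norm k S\<close> gives
  a form of norm at most \<open>1\<close> again.
\<close>

lemma wedge_norm_compose:
  fixes S :: "'b::real_normed_vector \<Rightarrow>\<^sub>L 'c::real_normed_vector"
    and T :: "'a::real_normed_vector \<Rightarrow>\<^sub>L 'b"
  shows "wedge_norm k (S o\<^sub>L T) \<le> wedge_norm k S * wedge_norm k T"
proof (rule wedge_norm_least)
  fix w :: "(nat \<Rightarrow> 'c) \<Rightarrow> real" and x :: "nat \<Rightarrow> 'a"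
  assume w: "alt_form k w" and x: "\<And>j. j < k \<Longrightarrow> norm (x j) \<le> 1"
  define D where "D = wedge_norm k S"
  define w' where "w' y = w (\<lambda>i. S (y i)) / D" for y
  have hom: "\<bar>w (\<lambda>i. S (y i))\<bar> \<le> D * (\<Prod>j<k. norm (y j))" for y
    unfolding D_def by (rule wedge_norm_homogeneous[OF w])
  show "\<bar>w (\<lambda>i. (S o\<^sub>L T) (x i))\<bar> \<le> wedge_norm k S * wedge_norm k T"
  proof (cases "D = 0")
    case True
    then show ?thesis using hom[of "\<lambda>i. T (x i)"] by (simp add: D_def)
  next
    case False
    then have D: "D > 0" using wedge_norm_nonneg[of k S] by (simp add: D_def)
    have "linear (\<lambda>y. w' (z(j := y)))" if "j < k" for z j
    proof -
      have upd: "(\<lambda>i. S ((z(j := y)) i)) = (\<lambda>i. S (z i))(j := S y)" for y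
        by (simp add: fun_eq_iff)
      have "(\<lambda>y. w' (z(j := y))) = (\<lambda>y. (1/D) * w ((\<lambda>i. S (z i))(j := y))) \<circ> S"
        unfolding w'_def upd by (simp add: fun_eq_iff)
      moreover have "linear (\<lambda>y. (1/D) * w ((\<lambda>i. S (z i))(j := y)))"
        using linear_compose_scale_right[OF alt_form_linear[OF w that, of "\<lambda>i. S (z i)"], of "1/D"]
        by simp
      ultimately show ?thesis
        using linear_compose[OF bounded_linear.linear[OF blinfun.bounded_linear_right, of S]] by simp
    qed
    moreover have "w' y = 0" if "i < k" "j < k" "i \<noteq> j" "y i = y j" for y i j
      using alt_form_repeat[OF w that(1-3)] that(4) by (simp add: w'_def)
    moreover have "w' y = w' z" if "\<forall>j<k. y j = z j" for y z
      using alt_form_local[OF w, of "\<lambda>i. S (y i)" "\<lambda>i. S (z i)"] that by (simp add: w'_def)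
    moreover have "\<bar>w' y\<bar> \<le> (\<Prod>j<k. norm (y j))" for y
      using hom[of y] D by (simp add: w'_def field_simps)
    ultimately have "alt_form k w'" by (auto simp: alt_form_def)
    from wedge_norm_upper[OF this x, where T = T] D show ?thesis
      by (simp add: w'_def D_def field_simps)
  qed
qed

lemma linear_mult_const: "linear (f :: 'a::real_vector \<Rightarrow> real) \<Longrightarrow> linear (\<lambda>x. f x * c)"
  by (simp add: linear_iff algebra_simps)

lemma linear_const_mult: "linear (f :: 'a::real_vector \<Rightarrow> real) \<Longrightarrow> linear (\<lambda>x. c * f x)"
  by (simp add: linear_iff algebra_simps)

text \<open>
  Freezing the last entry at \<open>z\<close> leaves a form of one degree less, of norm at most \<open>norm z\<close>.
\<close>

lemma alt_form_fix_last:
  fixes T :: "'a::real_normed_vector \<Rightarrow>\<^sub>L 'b::real_normed_vector"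
  assumes w: "alt_form (Suc m) w" and x: "\<And>j. j < m \<Longrightarrow> norm (x j) \<le> 1"
  shows "\<bar>w ((\<lambda>i. T (x i))(m := z))\<bar> \<le> wedge_norm m T * norm z"
proof (cases "z = 0")
  case True
  then show ?thesis using linear_0[OF alt_form_linear[OF w, of m "\<lambda>i. T (x i)"]] by simp
next
  case False
  define w' where "w' y = w (y(m := z)) / norm z" for y
  have "alt_form m w'"
    unfolding alt_form_def
  proof (intro conjI allI impI)
    fix x y :: "nat \<Rightarrow> 'b" assume "\<forall>j<m. x j = y j"
    then have "w (x(m := z)) = w (y(m := z))"
      by (intro alt_form_local[OF w]) (auto simp: less_Suc_eq)
    then show "w' x = w' y" by (simp add: w'_def)
  next
    fix x j assume j: "j < m"
    have "linear (\<lambda>y. w ((x(m := z))(j := y)) * (1 / norm z))"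
      using j by (intro linear_mult_const alt_form_linear[OF w]) simp
    moreover have "(\<lambda>y. w' (x(j := y))) = (\<lambda>y. w ((x(m := z))(j := y)) * (1 / norm z))"
      using j by (simp add: w'_def fun_eq_iff fun_upd_twist)
    ultimately show "linear (\<lambda>y. w' (x(j := y)))" by simp
  next
    fix x :: "nat \<Rightarrow> 'b" and i j assume "i < m" "j < m" "i \<noteq> j" "x i = x j"
    then show "w' x = 0" using alt_form_repeat[OF w, of i j "x(m := z)"] by (simp add: w'_def)
  next
    fix x
    have "\<bar>w (x(m := z))\<bar> \<le> (\<Prod>j<m. norm (x j)) * norm z"
      using alt_form_bound[OF w, of "x(m := z)"] by simp
    then show "\<bar>w' x\<bar> \<le> (\<Prod>j<m. norm (x j))" using False by (simp add: w'_def field_simps)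
  qed
  from wedge_norm_upper[OF this x, where T = T] show ?thesis using False by (simp add: w'_def field_simps)
qed

text \<open>
  By antisymmetry the replaced entry can be moved to the last place.
\<close>

lemma alt_form_replace:
  fixes T :: "'a::real_normed_vector \<Rightarrow>\<^sub>L 'b::real_normed_vector"
  assumes w: "alt_form (Suc m) w" and x: "\<And>j. j \<le> m \<Longrightarrow> norm (x j) \<le> 1" and j: "j \<le> m"
  shows "\<bar>w ((\<lambda>i. T (x i))(j := z))\<bar> \<le> wedge_norm m T * norm z"
proof (cases "j = m")
  case True
  then show ?thesis using alt_form_fix_last[OF w, of x T z] x by simp
next
  case False
  let ?X = "\<lambda>i. T (x i)"
  have "?X(j := z) = ?X(j := z, m := T (x m))" using False by (auto simp: fun_eq_iff)
  then have "w (?X(j := z)) = - w (?X(j := T (x m), m := z))"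
    using alt_form_swap[OF w, of j m ?X z "T (x m)"] False j by simp
  also have "?X(j := T (x m), m := z) = (\<lambda>i. T ((x(j := x m)) i))(m := z)"
    by (auto simp: fun_eq_iff)
  finally have "\<bar>w (?X(j := z))\<bar> = \<bar>w ((\<lambda>i. T ((x(j := x m)) i))(m := z))\<bar>"
    by (metis abs_minus_cancel)
  also have "\<dots> \<le> wedge_norm m T * norm z"
    by (rule alt_form_fix_last[OF w]) (simp add: x)
  finally show ?thesis .
qed

text \<open>
  Cramer's rule: up to the common factor \<open>w (\<lambda>i. T (x i))\<close> the coefficient \<open>a j\<close> is the value of
  the form after the \<open>j\<close>-th entry is replaced by the image of the linear combination.
\<close>

lemma alt_form_coordinate:
  fixes T :: "'a::real_normed_vector \<Rightarrow>\<^sub>L 'b::real_normed_vector"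
  assumes w: "alt_form k w" and j: "j < k"
  shows "w ((\<lambda>i. T (x i))(j := T (\<Sum>i<k. a i *\<^sub>R x i))) = a j * w (\<lambda>i. T (x i))"
proof -
  let ?X = "\<lambda>i. T (x i)"
  let ?f = "\<lambda>y. w (?X(j := y))"
  have lin: "linear ?f" using alt_form_linear[OF w j] .
  have "?f (T (\<Sum>i<k. a i *\<^sub>R x i)) = (\<Sum>i<k. a i * ?f (T (x i)))"
    by (simp add: blinfun.sum_right blinfun.scaleR_right linear_sum[OF lin] linear_scale[OF lin])
  also have "\<dots> = (\<Sum>i<k. if i = j then a j * w ?X else 0)"
  proof (rule sum.cong[OF refl])
    fix i assume "i \<in> {..<k}"
    then show "a i * ?f (T (x i)) = (if i = j then a j * w ?X else 0)"
      using alt_form_repeat[OF w, of i j "?X(j := T (x i))"] j by (auto simp: fun_upd_idem)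
  qed
  also have "\<dots> = a j * w ?X" using j by simp
  finally show ?thesis .
qed

section \<open>Bernstein numbers\<close>

lemma lower_bound_on_le:
  assumes "v \<in> V" "norm v = 1"
  shows "lower_bound_on T V \<le> norm (blinfun_apply T v)"
  unfolding lower_bound_on_def by (rule cINF_lower) (use assms in \<open>auto intro!: bdd_belowI2[of _ 0]\<close>)

lemma k_subspaces_unit:
  assumes "V \<in> k_subspaces k" "k > 0"
  obtains v where "v \<in> V" "norm v = 1"
proof -
  obtain B where B: "finite B" "independent B" "card B = k" "V = span B"
    using assms by (auto simp: k_subspaces_def)
  then obtain b where b: "b \<in> B" using assms(2) by fastforce
  then have "b \<noteq> 0" using B(2) dependent_zero by blast
  then have "norm ((1 / norm b) *\<^sub>R b) = 1" by simp
  moreover have "(1 / norm b) *\<^sub>R b \<in> V" using B b by (simp add: span_base span_scale)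
  ultimately show thesis using that by blast
qed

lemma lower_bound_on_greatest:
  assumes "V \<in> k_subspaces k" "k > 0" "\<And>v. v \<in> V \<Longrightarrow> norm v = 1 \<Longrightarrow> c \<le> norm (blinfun_apply T v)"
  shows "c \<le> lower_bound_on T V"
  unfolding lower_bound_on_def
  by (rule cINF_greatest) (use assms k_subspaces_unit[OF assms(1,2)] in auto)

lemma lower_bound_on_le_norm:
  assumes "V \<in> k_subspaces k" "k > 0"
  shows "lower_bound_on T V \<le> norm T"
proof -
  obtain v where v: "v \<in> V" "norm v = 1" using k_subspaces_unit[OF assms] .
  show ?thesis using lower_bound_on_le[OF v, of T] norm_blinfun[of T v] v(2) by simp
qed

lemma rho_upper:
  fixes T :: "'a::real_normed_vector \<Rightarrow>\<^sub>L 'a"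
  assumes "V \<in> k_subspaces k" "k > 0"
  shows "lower_bound_on T V \<le> rho k T"
proof -
  have "bdd_above (lower_bound_on T ` k_subspaces k)"
    using lower_bound_on_le_norm[OF _ assms(2)] by (intro bdd_aboveI2)
  then have "lower_bound_on T V \<le> (SUP V\<in>k_subspaces k. lower_bound_on T V)"
    by (intro cSUP_upper assms)
  then show ?thesis using assms by (auto simp: rho_def)
qed

lemma rho_nonneg:
  fixes T :: "'a::real_normed_vector \<Rightarrow>\<^sub>L 'a"
  assumes "k > 0"
  shows "0 \<le> rho k T"
proof (cases "(k_subspaces k :: 'a set set) = {}")
  case False
  then obtain V :: "'a set" where V: "V \<in> k_subspaces k" by blast
  have "0 \<le> lower_bound_on T V" by (rule lower_bound_on_greatest[OF V assms]) simp
  then show ?thesis using rho_upper[OF V assms, of T] by simp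
qed (simp add: rho_def)

lemma rho_least:
  fixes T :: "'a::real_normed_vector \<Rightarrow>\<^sub>L 'a"
  assumes "0 \<le> c" "\<And>V. V \<in> k_subspaces k \<Longrightarrow> lower_bound_on T V \<le> c"
  shows "rho k T \<le> c"
  using assms by (auto simp: rho_def intro!: cSUP_least)

lemma rho_Suc_le:
  fixes T :: "'a::real_normed_vector \<Rightarrow>\<^sub>L 'a"
  assumes "k > 0"
  shows "rho (Suc k) T \<le> rho k T"
proof (rule rho_least[OF rho_nonneg[OF assms]])
  fix V :: "'a set" assume V: "V \<in> k_subspaces (Suc k)"
  then obtain B where B: "finite B" "independent B" "card B = Suc k" "V = span B"
    by (auto simp: k_subspaces_def)
  then obtain b where b: "b \<in> B" by fastforce
  have "independent (B - {b})" using B(2) by (rule independent_mono) auto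
  then have W: "span (B - {b}) \<in> k_subspaces k"
    using B b by (auto simp: k_subspaces_def intro!: exI[of _ "B - {b}"])
  have "lower_bound_on T V \<le> lower_bound_on T (span (B - {b}))"
  proof (rule lower_bound_on_greatest[OF W assms])
    fix v assume "v \<in> span (B - {b})" "norm v = 1"
    then show "lower_bound_on T V \<le> norm (T v)"
      using span_mono[of "B - {b}" B] B by (intro lower_bound_on_le) auto
  qed
  also have "\<dots> \<le> rho k T" using W assms by (rule rho_upper)
  finally show "lower_bound_on T V \<le> rho k T" .
qed

text \<open>
  Take vectors \<open>x\<^sub>i\<close> and a form \<open>w\<close> that almost realise \<open>wedge_norm (Suc m) T\<close>. Cramer's rule bounds every
  coordinate of a vector \<open>v\<close> in the span of the \<open>x\<^sub>i\<close> by \<open>norm (T v)\<close> times the quotient of the two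
  exterior norms, so \<open>T\<close> is bounded below on this span.
\<close>

lemma wedge_norm_Suc_le:
  fixes T :: "'a::real_normed_vector \<Rightarrow>\<^sub>L 'a"
  shows "wedge_norm (Suc m) T \<le> real (Suc m) * rho (Suc m) T * wedge_norm m T"
proof (rule wedge_norm_least)
  fix w :: "(nat \<Rightarrow> 'a) \<Rightarrow> real" and x :: "nat \<Rightarrow> 'a"
  assume w: "alt_form (Suc m) w" and x: "\<And>j. j < Suc m \<Longrightarrow> norm (x j) \<le> 1"
  define c where "c = w (\<lambda>i. T (x i))"
  define D where "D = wedge_norm m T"
  have x': "norm (x j) \<le> 1" if "j \<le> m" for j using x that by simp
  show "\<bar>w (\<lambda>i. T (x i))\<bar> \<le> real (Suc m) * rho (Suc m) T * wedge_norm m T"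
  proof (cases "c = 0")
    case True
    then show ?thesis using rho_nonneg[of "Suc m" T] wedge_norm_nonneg[of m T] by (simp add: c_def)
  next
    case False
    have "\<bar>w ((\<lambda>i. T (x i))(m := T (x m)))\<bar> \<le> D * norm (T (x m))"
      unfolding D_def by (rule alt_form_replace[OF w x']) auto
    then have "\<bar>c\<bar> \<le> D * norm (T (x m))" by (simp add: c_def fun_upd_idem)
    then have D: "D > 0"
      using False wedge_norm_nonneg[of m T] by (cases "D = 0") (auto simp: D_def)
    have coord: "\<bar>a j\<bar> * \<bar>c\<bar> \<le> D * norm (T (\<Sum>i<Suc m. a i *\<^sub>R x i))" if "j < Suc m" for a j
    proof -
      have "\<bar>w ((\<lambda>i. T (x i))(j := T (\<Sum>i<Suc m. a i *\<^sub>R x i)))\<bar>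
          \<le> D * norm (T (\<Sum>i<Suc m. a i *\<^sub>R x i))"
        unfolding D_def using that by (intro alt_form_replace[OF w x']) auto
      then show ?thesis unfolding alt_form_coordinate[OF w that] c_def abs_mult .
    qed
    have inj: "inj_on x {..<Suc m}"
    proof (rule inj_onI, rule ccontr)
      fix i j assume "i \<in> {..<Suc m}" "j \<in> {..<Suc m}" "x i = x j" "i \<noteq> j"
      then have "c = 0" unfolding c_def by (intro alt_form_repeat[OF w, of i j]) auto
      with False show False by simp
    qed
    define B where "B = x ` {..<Suc m}"
    have Bsum: "(\<Sum>v\<in>B. u v *\<^sub>R v) = (\<Sum>i<Suc m. u (x i) *\<^sub>R x i)" for u
      unfolding B_def using inj by (simp add: sum.reindex del: sum.lessThan_Suc)
    have fin: "finite B" by (simp add: B_def)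
    have "independent B"
    proof (rule independent_if_scalars_zero[OF fin])
      fix u v assume 0: "(\<Sum>v\<in>B. u v *\<^sub>R v) = 0" and "v \<in> B"
      then obtain j where j: "j < Suc m" "v = x j" by (auto simp: B_def)
      have "\<bar>u (x j)\<bar> * \<bar>c\<bar> \<le> D * norm (T (\<Sum>i<Suc m. u (x i) *\<^sub>R x i))"
        using coord[OF j(1), of "\<lambda>i. u (x i)"] .
      then have "\<bar>u (x j)\<bar> * \<bar>c\<bar> \<le> 0" using 0 Bsum[of u] by simp
      then show "u v = 0" using False j by (simp add: mult_le_0_iff)
    qed
    moreover have "card B = Suc m" unfolding B_def using inj by (simp add: card_image)
    ultimately have V: "span B \<in> k_subspaces (Suc m)" using fin by (auto simp: k_subspaces_def)
    have "\<bar>c\<bar> / (real (Suc m) * D) \<le> lower_bound_on T (span B)"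
    proof (rule lower_bound_on_greatest[OF V])
      fix v assume v: "v \<in> span B" "norm v = 1"
      obtain u where "v = (\<Sum>b\<in>B. u b *\<^sub>R b)" using v(1) span_finite[OF fin] by auto
      then have vu: "v = (\<Sum>i<Suc m. u (x i) *\<^sub>R x i)" using Bsum by simp
      have "\<bar>c\<bar> = \<bar>c\<bar> * norm (\<Sum>i<Suc m. u (x i) *\<^sub>R x i)" using v(2) vu by simp
      also have "\<dots> \<le> \<bar>c\<bar> * (\<Sum>i<Suc m. norm (u (x i) *\<^sub>R x i))"
        by (intro mult_left_mono norm_sum) auto
      also have "\<dots> \<le> \<bar>c\<bar> * (\<Sum>i<Suc m. \<bar>u (x i)\<bar>)"
        by (intro mult_left_mono sum_mono) (use x in \<open>auto intro: mult_left_le\<close>)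
      also have "\<dots> = (\<Sum>i<Suc m. \<bar>u (x i)\<bar> * \<bar>c\<bar>)" by (simp add: sum_distrib_left mult.commute del: sum.lessThan_Suc)
      also have "\<dots> \<le> (\<Sum>i<Suc m. D * norm (T v))"
        by (intro sum_mono) (use coord[of _ "\<lambda>i. u (x i)"] vu in auto)
      finally have "\<bar>c\<bar> \<le> real (Suc m) * D * norm (T v)" by simp
      then show "\<bar>c\<bar> / (real (Suc m) * D) \<le> norm (T v)"
        using D by (subst pos_divide_le_eq) (simp, simp only: mult_ac)
    qed simp
    also have "\<dots> \<le> rho (Suc m) T" by (rule rho_upper[OF V]) simp
    finally have "\<bar>c\<bar> \<le> rho (Suc m) T * (real (Suc m) * D)" using D by (simp add: divide_le_eq)
    then show ?thesis by (simp add: c_def D_def mult_ac)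
  qed
qed

section \<open>Exterior multiplication by a functional\<close>

text \<open>
  The exterior product of \<open>w\<close> and \<open>\<theta>\<close>, written with replaced entries instead of a sum of signed
  permutations: moving the last entry into place \<open>j\<close> is a transposition, which accounts for the minus
  sign.
\<close>

definition wedge :: "nat \<Rightarrow> ((nat \<Rightarrow> 'a) \<Rightarrow> real) \<Rightarrow> ('a \<Rightarrow> real) \<Rightarrow> (nat \<Rightarrow> 'a) \<Rightarrow> real" where
  "wedge m w \<theta> x = w x * \<theta> (x m) - (\<Sum>j<m. w (x(j := x m)) * \<theta> (x j))"

text \<open>
  When two of the first \<open>m\<close> entries coincide, all summands vanish except the two that replace one of
  them, and these cancel by antisymmetry. When the last entry repeats entry \<open>p\<close>, only the leading term
  and the summand \<open>p\<close> survive, and they are equal.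
\<close>

lemma alt_form_wedge:
  fixes \<theta> :: "'a::real_normed_vector \<Rightarrow> real"
  assumes w: "alt_form m w" and \<theta>: "linear \<theta>" and \<theta>1: "\<And>x. \<bar>\<theta> x\<bar> \<le> norm x"
  shows "alt_form (Suc m) (\<lambda>x. wedge m w \<theta> x / real (Suc m))"
  unfolding alt_form_def
proof (intro conjI allI impI)
  fix x y :: "nat \<Rightarrow> 'a" assume eq: "\<forall>j<Suc m. x j = y j"
  have "w x = w y" using eq by (intro alt_form_local[OF w]) auto
  moreover have "w (x(j := x m)) = w (y(j := y m))" for j
    using eq by (intro alt_form_local[OF w]) auto
  ultimately show "wedge m w \<theta> x / real (Suc m) = wedge m w \<theta> y / real (Suc m)"
    using eq by (simp add: wedge_def)
next
  fix x :: "nat \<Rightarrow> 'a" and p assume p: "p < Suc m"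
  have lw: "linear (\<lambda>y. w (z(p := y)))" if "p < m" for z using alt_form_linear[OF w that] .
  have "linear (\<lambda>y. wedge m w \<theta> (x(p := y)))"
  proof (cases "p = m")
    case True
    have 1: "w (x(m := y)) = w x" for y by (rule alt_form_local[OF w]) auto
    have 2: "w (x(m := y, j := y)) = w (x(j := y))" if "j < m" for j y
      by (rule alt_form_local[OF w]) auto
    have "linear (\<lambda>y. w x * \<theta> y - (\<Sum>j<m. w (x(j := y)) * \<theta> (x j)))"
      by (intro linear_compose_sub linear_compose_sum ballI)
         (use linear_const_mult[OF \<theta>] linear_mult_const[OF alt_form_linear[OF w, of _ x]] in auto)
    then show ?thesis using True by (simp add: wedge_def 1 2)
  next
    case False
    then have p: "p < m" using p by simp
    have "linear (\<lambda>y. w (x(p := y, j := x m)) * \<theta> ((x(p := y)) j))" if "j < m" for j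
    proof (cases "j = p")
      case True
      then show ?thesis using linear_const_mult[OF \<theta>, of "w (x(p := x m))"] by simp
    next
      case False
      then show ?thesis
        using linear_mult_const[OF lw[OF p], of "x(j := x m)" "\<theta> (x j)"]
        by (simp add: fun_upd_twist)
    qed
    moreover have "linear (\<lambda>y. w (x(p := y)) * \<theta> (x m))"
      using linear_mult_const[OF lw[OF p], of x "\<theta> (x m)"] by simp
    ultimately have "linear (\<lambda>y. w (x(p := y)) * \<theta> (x m) -
        (\<Sum>j<m. w (x(p := y, j := x m)) * \<theta> ((x(p := y)) j)))"
      by (intro linear_compose_sub linear_compose_sum ballI) auto
    then show ?thesis using p by (simp add: wedge_def)
  qed
  from linear_mult_const[OF this, of "1 / real (Suc m)"]
  show "linear (\<lambda>y. wedge m w \<theta> (x(p := y)) / real (Suc m))" by simp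
next
  have main: "wedge m w \<theta> x = 0" if pq: "p < q" "q < Suc m" "x p = x q" for x p q
  proof (cases "q = m")
    case True
    have "w (x(j := x m)) * \<theta> (x j) = (if j = p then w x * \<theta> (x m) else 0)" if "j < m" for j
    proof (cases "j = p")
      case True
      then show ?thesis using pq \<open>q = m\<close> by (simp add: fun_upd_idem)
    next
      case False
      then have "w (x(j := x m)) = 0"
        using that pq \<open>q = m\<close> by (intro alt_form_repeat[OF w, of j p]) auto
      then show ?thesis using False by simp
    qed
    then have "(\<Sum>j<m. w (x(j := x m)) * \<theta> (x j)) = (\<Sum>j<m. if j = p then w x * \<theta> (x m) else 0)"
      by (intro sum.cong) auto
    then show ?thesis using pq True by (simp add: wedge_def)
  next
    case False
    then have q: "q < m" using pq by simp
    have "w x = 0" using pq q by (intro alt_form_repeat[OF w, of p q]) auto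
    moreover have z: "w (x(j := x m)) = 0" if "j < m" "j \<noteq> p" "j \<noteq> q" for j
      using pq q that by (intro alt_form_repeat[OF w, of p q]) auto
    have "(\<Sum>j<m. w (x(j := x m)) * \<theta> (x j)) = (\<Sum>j\<in>{p, q}. w (x(j := x m)) * \<theta> (x j))"
      using pq q z by (intro sum.mono_neutral_right) auto
    moreover have "w (x(p := x m)) = - w (x(q := x m))"
    proof -
      have "w (x(p := x m)) = w (x(p := x m, q := x p))" using pq by (simp add: fun_upd_idem)
      also have "\<dots> = - w (x(p := x p, q := x m))"
        using pq q by (intro alt_form_swap[OF w]) auto
      finally show ?thesis by simp
    qed
    ultimately show ?thesis using pq by (simp add: wedge_def)
  qed
  fix x :: "nat \<Rightarrow> 'a" and i j assume "i < Suc m" "j < Suc m" "i \<noteq> j" "x i = x j"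
  then have "wedge m w \<theta> x = 0" using main[of i j x] main[of j i x] by (cases "i < j") auto
  then show "wedge m w \<theta> x / real (Suc m) = 0" by simp
next
  fix x :: "nat \<Rightarrow> 'a"
  define P where "P = (\<Prod>j<Suc m. norm (x j))"
  have "\<bar>w x * \<theta> (x m)\<bar> \<le> P"
    unfolding P_def abs_mult prod.lessThan_Suc
    by (intro mult_mono alt_form_bound[OF w] \<theta>1) (auto intro: prod_nonneg)
  moreover have "\<bar>w (x(j := x m)) * \<theta> (x j)\<bar> \<le> P" if j: "j < m" for j
  proof -
    have "\<bar>w (x(j := x m)) * \<theta> (x j)\<bar> \<le> (\<Prod>i<m. norm ((x(j := x m)) i)) * norm (x j)"
      unfolding abs_mult by (intro mult_mono alt_form_bound[OF w] \<theta>1) (auto intro: prod_nonneg)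
    also have "(\<Prod>i<m. norm ((x(j := x m)) i)) = norm (x m) * (\<Prod>i\<in>{..<m} - {j}. norm (x i))"
      using j by (subst prod.remove[of _ j]) (auto intro!: prod.cong)
    also have "\<dots> * norm (x j) = P"
      using j prod.remove[of "{..<m}" j "\<lambda>i. norm (x i)"] by (simp add: P_def)
    finally show ?thesis .
  qed
  then have "\<bar>\<Sum>j<m. w (x(j := x m)) * \<theta> (x j)\<bar> \<le> (\<Sum>j<m. P)"
    by (intro order_trans[OF sum_abs] sum_mono) auto
  ultimately have "\<bar>wedge m w \<theta> x\<bar> \<le> real (Suc m) * P"
    by (simp add: wedge_def algebra_simps)
  then show "\<bar>wedge m w \<theta> x / real (Suc m)\<bar> \<le> (\<Prod>j<Suc m. norm (x j))"
    unfolding P_def[symmetric] by (simp add: field_simps)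
qed

text \<open>
  Evaluate the product of \<open>w\<close> with a norming functional of \<open>T y\<close>. The leading term is
  \<open>w (T x) * norm (T y)\<close>; the bound \<open>d\<close> makes the remaining terms an error.
\<close>

lemma wedge_norm_Suc_ge:
  fixes T :: "'a::real_normed_vector \<Rightarrow>\<^sub>L 'b::real_normed_vector"
  assumes w: "alt_form m w" and x: "\<And>j. j < m \<Longrightarrow> norm (x j) \<le> 1" and y: "norm y \<le> 1"
    and d: "\<And>j. j < m \<Longrightarrow> \<bar>w ((\<lambda>i. T (x i))(j := T y))\<bar> \<le> d" and d0: "d \<ge> 0"
  shows "\<bar>w (\<lambda>i. T (x i))\<bar> * norm (T y) \<le> real (Suc m) * wedge_norm (Suc m) T + real m * norm T * d"
proof -
  obtain \<theta> :: "'b \<Rightarrow> real" where \<theta>: "linear \<theta>" "\<And>x. \<bar>\<theta> x\<bar> \<le> norm x" "\<theta> (T y) = norm (T y)"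
    by (rule norming_functional[of "T y"]) blast
  let ?X = "\<lambda>i. T ((x(m := y)) i)"
  have "\<bar>wedge m w \<theta> ?X / real (Suc m)\<bar> \<le> wedge_norm (Suc m) T"
    by (rule wedge_norm_upper[OF alt_form_wedge[OF w \<theta>(1,2)]]) (use x y in \<open>auto simp: less_Suc_eq\<close>)
  then have W: "\<bar>wedge m w \<theta> ?X\<bar> \<le> real (Suc m) * wedge_norm (Suc m) T"
    by (simp add: field_simps)
  have eq: "w ?X = w (\<lambda>i. T (x i))" by (rule alt_form_local[OF w]) auto
  have "\<bar>\<Sum>j<m. w (?X(j := ?X m)) * \<theta> (?X j)\<bar> \<le> (\<Sum>j<m. d * norm T)"
  proof (intro order_trans[OF sum_abs] sum_mono)
    fix j assume "j \<in> {..<m}"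
    then have j: "j < m" by simp
    have "w (?X(j := ?X m)) = w ((\<lambda>i. T (x i))(j := T y))" by (rule alt_form_local[OF w]) auto
    then have "\<bar>w (?X(j := ?X m))\<bar> \<le> d" using d[OF j] by simp
    moreover have "\<bar>\<theta> (?X j)\<bar> \<le> norm T"
    proof -
      have "\<bar>\<theta> (?X j)\<bar> \<le> norm (T (x j))" using \<theta>(2)[of "?X j"] j by simp
      also have "\<dots> \<le> norm T * norm (x j)" by (rule norm_blinfun)
      also have "\<dots> \<le> norm T" using x[OF j] by (simp add: mult_left_le)
      finally show ?thesis .
    qed
    ultimately show "\<bar>w (?X(j := ?X m)) * \<theta> (?X j)\<bar> \<le> d * norm T"
      unfolding abs_mult using d0 by (intro mult_mono) auto
  qed
  moreover have "w ?X * \<theta> (?X m) = w (\<lambda>i. T (x i)) * norm (T y)" using eq \<theta>(3) by simp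
  ultimately have "\<bar>w (\<lambda>i. T (x i)) * norm (T y)\<bar> \<le> \<bar>wedge m w \<theta> ?X\<bar> + real m * norm T * d"
    unfolding wedge_def by (simp add: mult_ac)
  then show ?thesis using W by (simp add: abs_mult)
qed

text \<open>
  If the functionals separated points of the span, they would embed the span of \<open>Suc m\<close> independent
  vectors into the span of \<open>m\<close> of them.
\<close>

lemma common_kernel_vector:
  fixes B :: "'a::real_vector set" and \<phi> :: "nat \<Rightarrow> 'a \<Rightarrow> real"
  assumes B: "finite B" "independent B" "card B = Suc m"
    and lin: "\<And>j. j < m \<Longrightarrow> linear (\<phi> j)"
  obtains v where "v \<in> span B" "v \<noteq> 0" "\<And>j. j < m \<Longrightarrow> \<phi> j v = 0"
proof -
  obtain b where b: "b \<in> B" using B(3) by fastforce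
  define E where "E = B - {b}"
  have E: "finite E" "card E = m" "independent E"
    using B b independent_mono[of B E] by (auto simp: E_def)
  obtain e where e: "bij_betw e {..<m} E" using ex_bij_betw_nat_finite[OF E(1)] E(2)
    by (metis atLeast0LessThan)
  \<comment> \<open>The values of the functionals, encoded as coordinates with respect to \<open>m\<close> of the given vectors.\<close>
  define f where "f y = (\<Sum>j<m. \<phi> j y *\<^sub>R e j)" for y
  have "linear f"
    unfolding f_def using lin
    by (intro linearI)
       (simp_all add: linear_add linear_scale scaleR_left_distrib sum.distrib scaleR_sum_right)
  have zero: "\<phi> j y = 0" if "f y = 0" "j < m" for y j
  proof -
    define u where "u v = \<phi> (inv_into {..<m} e v) y" for v
    have u: "u (e i) = \<phi> i y" if "i < m" for i
      using that e by (simp add: u_def bij_betw_def inv_into_f_f)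
    have "(\<Sum>v\<in>E. u v *\<^sub>R v) = (\<Sum>i<m. u (e i) *\<^sub>R e i)"
      using sum.reindex_bij_betw[OF e, of "\<lambda>v. u v *\<^sub>R v"] by simp
    also have "\<dots> = f y" by (simp add: f_def u)
    finally have "(\<Sum>v\<in>E. u v *\<^sub>R v) = 0" using that by simp
    moreover have "e j \<in> E" using e that(2) by (auto simp: bij_betw_def)
    ultimately have "u (e j) = 0" using E(1,3) by (auto simp: dependent_finite)
    then show ?thesis using u that by simp
  qed
  have "\<not> inj_on f (span B)"
  proof
    assume inj: "inj_on f (span B)"
    have "independent (f ` B)"
      using linear_independent_injective_image[OF \<open>linear f\<close> B(2) inj] .
    moreover have "f y \<in> span E" for y
      unfolding f_def using e by (intro span_sum span_scale span_base) (auto simp: bij_betw_def)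
    then have "f ` B \<subseteq> span E" by blast
    ultimately have "card (f ` B) \<le> card E"
      using independent_span_bound[OF E(1)] by blast
    moreover have "card (f ` B) = card B"
      using inj_on_subset[OF inj span_superset] by (rule card_image)
    ultimately show False using B(3) E(2) by simp
  qed
  then obtain x y where xy: "x \<in> span B" "y \<in> span B" "f x = f y" "x \<noteq> y"
    by (auto simp: inj_on_def)
  have "f (x - y) = 0" using xy(3) linear_diff[OF \<open>linear f\<close>] by simp
  then show thesis using that[of "x - y"] xy zero by (auto simp: span_diff)
qed

text \<open>
  A space of dimension \<open>Suc m\<close> contains a unit vector at which the \<open>m\<close> error terms of
  \<open>wedge_norm_Suc_ge\<close> vanish exactly, and \<open>T\<close> expands it by at least the lower bound of \<open>T\<close> on that
  space.
\<close>

lemma rho_wedge_norm_le: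
  fixes T :: "'a::real_normed_vector \<Rightarrow>\<^sub>L 'a"
  shows "rho (Suc m) T * wedge_norm m T \<le> real (Suc m) * wedge_norm (Suc m) T"
proof -
  define D where "D = real (Suc m) * wedge_norm (Suc m) T"
  have D0: "D \<ge> 0" by (simp add: D_def wedge_norm_nonneg)
  have key: "wedge_norm m T * g \<le> D" if V: "V \<in> k_subspaces (Suc m)" and g: "g = lower_bound_on T V" "g > 0" for V g
  proof -
    obtain B where B: "finite B" "independent B" "card B = Suc m" "V = span B"
      using V by (auto simp: k_subspaces_def)
    have "wedge_norm m T \<le> D / g"
    proof (rule wedge_norm_least)
      fix w :: "(nat \<Rightarrow> 'a) \<Rightarrow> real" and x :: "nat \<Rightarrow> 'a"
      assume w: "alt_form m w" and x: "\<And>j. j < m \<Longrightarrow> norm (x j) \<le> 1"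
      have lin: "linear (\<lambda>y. w ((\<lambda>i. T (x i))(j := T y)))" if "j < m" for j
        using linear_compose[OF bounded_linear.linear[OF blinfun.bounded_linear_right, of T]
            alt_form_linear[OF w that]] by (simp add: o_def)
      obtain v where v: "v \<in> span B" "v \<noteq> 0"
          "\<And>j. j < m \<Longrightarrow> w ((\<lambda>i. T (x i))(j := T v)) = 0"
        using common_kernel_vector[OF B(1-3), of "\<lambda>j y. w ((\<lambda>i. T (x i))(j := T y))"] lin by blast
      define u where "u = (1 / norm v) *\<^sub>R v"
      have u: "u \<in> V" "norm u = 1" using v B(4) by (auto simp: u_def span_scale)
      have "\<bar>w (\<lambda>i. T (x i))\<bar> * norm (T u) \<le> real (Suc m) * wedge_norm (Suc m) T + real m * norm T * 0"
      proof (rule wedge_norm_Suc_ge[OF w x])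
        fix j assume j: "j < m"
        then show "\<bar>w ((\<lambda>i. T (x i))(j := T u))\<bar> \<le> 0"
          using linear_scale[OF lin[OF j], of "1 / norm v" v] v(3)[OF j] by (simp add: u_def)
      qed (use u in auto)
      moreover have "\<bar>w (\<lambda>i. T (x i))\<bar> * g \<le> \<bar>w (\<lambda>i. T (x i))\<bar> * norm (T u)"
        using lower_bound_on_le[OF u, of T] g by (intro mult_left_mono) auto
      ultimately show "\<bar>w (\<lambda>i. T (x i))\<bar> \<le> D / g" using g by (simp add: D_def field_simps)
    qed
    then show ?thesis using g by (simp add: field_simps)
  qed
  show ?thesis
  proof (cases "wedge_norm m T = 0")
    case False
    then have pos: "wedge_norm m T > 0" using wedge_norm_nonneg[of m T] by simp
    have "rho (Suc m) T \<le> D / wedge_norm m T"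
    proof (rule rho_least)
      fix V :: "'a set" assume V: "V \<in> k_subspaces (Suc m)"
      show "lower_bound_on T V \<le> D / wedge_norm m T"
      proof (cases "lower_bound_on T V > 0")
        case True
        then show ?thesis using key[OF V refl] pos by (simp add: field_simps)
      next
        case False
        then show ?thesis using D0 pos by (meson divide_nonneg_pos not_less order_trans)
      qed
    qed (use D0 pos in simp)
    then show ?thesis using pos by (simp add: D_def field_simps)
  qed (use D0 in \<open>simp add: D_def\<close>)
qed

lemma wedge_norm_pos:
  fixes T :: "'a::real_normed_vector \<Rightarrow>\<^sub>L 'a"
  assumes "k > 0 \<Longrightarrow> rho k T > 0"
  shows "wedge_norm k T > 0"
  using assms
proof (induction k)
  case (Suc m)
  have "rho m T > 0" if "m > 0" using rho_Suc_le[OF that, of T] Suc.prems by simp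
  then have "0 < rho (Suc m) T * wedge_norm m T" using Suc by simp
  also have "\<dots> \<le> real (Suc m) * wedge_norm (Suc m) T" by (rule rho_wedge_norm_le)
  finally show ?case by (simp add: zero_less_mult_iff)
qed (simp add: wedge_norm_0)

section \<open>Covering numbers\<close>

definition ball_covered :: "('a::real_normed_vector \<Rightarrow>\<^sub>L 'b::real_normed_vector) \<Rightarrow> nat \<Rightarrow> real \<Rightarrow> bool" where
  "ball_covered T K r \<longleftrightarrow> (\<exists>C. finite C \<and> card C \<le> K \<and> blinfun_apply T ` cball 0 1 \<subseteq> (\<Union>c\<in>C. cball c r))"

text \<open>
  The radius of a covering, corrected by a power of the number of balls: both factors are multiplied
  when coverings are composed, which makes the gauge submultiplicative. The case \<open>s = 1 / k\<close> is the
  one in which halving the radius and taking \<open>2 ^ k\<close> times as many balls, as a covering of a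
  \<open>k\<close>-dimensional set requires, changes nothing.
\<close>

definition entropy_gauge :: "real \<Rightarrow> ('a::real_normed_vector \<Rightarrow>\<^sub>L 'b::real_normed_vector) \<Rightarrow> real" where
  "entropy_gauge s T = Inf {r * real K powr s | r K. 0 < r \<and> 0 < K \<and> ball_covered T K r}"

lemma ball_covered_norm:
  assumes "norm T \<le> r"
  shows "ball_covered T 1 r"
proof -
  have "norm (blinfun_apply T x) \<le> r" if "norm x \<le> 1" for x
  proof -
    have "norm (T x) \<le> norm T * norm x" by (rule norm_blinfun)
    also have "\<dots> \<le> norm T" using that by (simp add: mult_left_le)
    finally show ?thesis using assms by simp
  qed
  then show ?thesis unfolding ball_covered_def by (intro exI[of _ "{0}"]) auto
qed

text \<open>
  A ball \<open>cball c' r'\<close> is the translate by \<open>c'\<close> of \<open>r'\<close> times the unit ball, so \<open>S\<close> maps it into \<open>K\<close>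
  balls of radius \<open>r * r'\<close>.
\<close>

lemma ball_covered_compose:
  fixes S :: "'b::real_normed_vector \<Rightarrow>\<^sub>L 'c::real_normed_vector"
    and T :: "'a::real_normed_vector \<Rightarrow>\<^sub>L 'b"
  assumes S: "ball_covered S K r" and T: "ball_covered T K' r'" and r': "r' > 0"
  shows "ball_covered (S o\<^sub>L T) (K * K') (r * r')"
proof -
  obtain C where C: "finite C" "card C \<le> K" "\<And>x. norm x \<le> 1 \<Longrightarrow> \<exists>c\<in>C. norm (S x - c) \<le> r"
    using S by (force simp: ball_covered_def dist_norm norm_minus_commute)
  obtain C' where C': "finite C'" "card C' \<le> K'" "\<And>x. norm x \<le> 1 \<Longrightarrow> \<exists>c\<in>C'. norm (T x - c) \<le> r'"
    using T by (force simp: ball_covered_def dist_norm norm_minus_commute)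
  define E where "E = (\<lambda>(c, c'). S c' + r' *\<^sub>R c) ` (C \<times> C')"
  have "card E \<le> card (C \<times> C')" unfolding E_def using C C' by (intro card_image_le) auto
  also have "\<dots> \<le> K * K'" using C C' by (simp add: mult_le_mono)
  finally have cardE: "card E \<le> K * K'" .
  have "\<exists>e\<in>E. norm ((S o\<^sub>L T) x - e) \<le> r * r'" if x: "norm x \<le> 1" for x
  proof -
    obtain c' where c': "c' \<in> C'" "norm (T x - c') \<le> r'" using C'(3)[OF x] by blast
    define y where "y = (1 / r') *\<^sub>R (T x - c')"
    have "norm y \<le> 1" using c' r' by (simp add: y_def)
    then obtain c where c: "c \<in> C" "norm (S y - c) \<le> r" using C(3) by blast
    have "T x = c' + r' *\<^sub>R y" using r' by (simp add: y_def)
    then have "(S o\<^sub>L T) x - (S c' + r' *\<^sub>R c) = r' *\<^sub>R (S y - c)"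
      by (simp add: blinfun.add_right blinfun.scaleR_right algebra_simps)
    then have "norm ((S o\<^sub>L T) x - (S c' + r' *\<^sub>R c)) = r' * norm (S y - c)" using r' by simp
    also have "\<dots> \<le> r * r'" using c r' by (simp add: mult.commute)
    finally show ?thesis using c c' by (intro bexI[of _ "S c' + r' *\<^sub>R c"]) (auto simp: E_def)
  qed
  then have "(S o\<^sub>L T) ` cball 0 1 \<subseteq> (\<Union>c\<in>E. cball c (r * r'))"
    by (force simp: dist_norm norm_minus_commute)
  moreover have "finite E" using C C' by (simp add: E_def)
  ultimately show ?thesis unfolding ball_covered_def using cardE by blast
qed

lemma entropy_gauge_bdd: "bdd_below {r * real K powr s | r K. 0 < r \<and> 0 < K \<and> ball_covered T K r}"
  by (rule bdd_belowI[of _ 0]) auto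

lemma entropy_gauge_lower:
  assumes "0 < r" "0 < K" "ball_covered T K r"
  shows "entropy_gauge s T \<le> r * real K powr s"
  unfolding entropy_gauge_def by (rule cInf_lower[OF _ entropy_gauge_bdd]) (use assms in blast)

lemma entropy_gauge_greatest:
  assumes "\<And>r K. 0 < r \<Longrightarrow> 0 < K \<Longrightarrow> ball_covered T K r \<Longrightarrow> c \<le> r * real K powr s"
  shows "c \<le> entropy_gauge s T"
proof -
  have "ball_covered T 1 (norm T + 1)" by (rule ball_covered_norm) simp
  then have "(norm T + 1) * real 1 powr s \<in> {r * real K powr s | r K. 0 < r \<and> 0 < K \<and> ball_covered T K r}"
    by (intro CollectI exI[of _ "norm T + 1"] exI[of _ "1::nat"]) (simp add: add_nonneg_pos)
  then have "{r * real K powr s | r K. 0 < r \<and> 0 < K \<and> ball_covered T K r} \<noteq> {}" by blast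
  then show ?thesis unfolding entropy_gauge_def using assms by (intro cInf_greatest) auto
qed

lemma entropy_gauge_nonneg: "0 \<le> entropy_gauge s T"
  by (rule entropy_gauge_greatest) simp

lemma entropy_gauge_less_iff:
  "entropy_gauge s T < t \<longleftrightarrow> (\<exists>r K. 0 < r \<and> 0 < K \<and> ball_covered T K r \<and> r * real K powr s < t)"
  using entropy_gauge_greatest[of T t s] entropy_gauge_lower[of _ _ T s] by (meson le_less_trans not_le)

lemma entropy_gauge_le_norm: "entropy_gauge s T \<le> norm T"
proof (rule field_le_epsilon)
  fix e :: real assume "e > 0"
  then have "0 < norm T + e" by (simp add: add_nonneg_pos)
  with \<open>e > 0\<close> show "entropy_gauge s T \<le> norm T + e"
    using entropy_gauge_lower[of "norm T + e" 1 T s] ball_covered_norm[of T "norm T + e"] by simp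
qed

lemma entropy_gauge_compose: "entropy_gauge s (S o\<^sub>L T) \<le> entropy_gauge s S * entropy_gauge s T"
proof -
  have 1: "entropy_gauge s (S o\<^sub>L T) \<le> (r * real K powr s) * (r' * real K' powr s)"
    if "0 < r" "0 < K" "ball_covered S K r" "0 < r'" "0 < K'" "ball_covered T K' r'" for r K r' K'
    using entropy_gauge_lower[of "r * r'" "K * K'" "S o\<^sub>L T" s] ball_covered_compose[OF that(3,6,4)] that
    by (simp add: powr_mult mult_ac)
  have 2: "entropy_gauge s (S o\<^sub>L T) \<le> entropy_gauge s S * b"
    if "b = r' * real K' powr s" "0 < r'" "0 < K'" "ball_covered T K' r'" for b r' K'
  proof -
    have b: "b > 0" using that by simp
    have "entropy_gauge s (S o\<^sub>L T) / b \<le> entropy_gauge s S"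
      by (rule entropy_gauge_greatest) (use 1 that b in \<open>simp add: field_simps\<close>)
    then show ?thesis using b by (simp add: field_simps)
  qed
  show ?thesis
  proof (cases "entropy_gauge s S = 0")
    case True
    have "entropy_gauge s (S o\<^sub>L T) \<le> entropy_gauge s S * ((norm T + 1) * real 1 powr s)"
      using ball_covered_norm[of T "norm T + 1"] by (intro 2[OF refl]) (auto simp: add_nonneg_pos)
    then show ?thesis using True by simp
  next
    case False
    then have pos: "entropy_gauge s S > 0" using entropy_gauge_nonneg[of s S] by simp
    have "entropy_gauge s (S o\<^sub>L T) / entropy_gauge s S \<le> entropy_gauge s T"
      by (rule entropy_gauge_greatest) (use 2[OF refl] pos in \<open>simp add: field_simps\<close>)
    then show ?thesis using pos by (simp add: field_simps)
  qed
qed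

text \<open>
  Open balls and closed balls give the same infimum: the closed unit ball is the closure of the open
  one, and finite unions of closed balls are closed.
\<close>

lemma compactness_seminorm_eq_entropy_gauge: "compactness_seminorm T = entropy_gauge 0 T"
proof -
  define A where "A = {r. r > 0 \<and> (\<exists>C. finite C \<and> blinfun_apply T ` ball 0 1 \<subseteq> (\<Union>c\<in>C. ball c r))}"
  have 1: "entropy_gauge 0 T \<le> r" if r: "r \<in> A" for r
  proof -
    obtain C where C: "finite C" "T ` ball 0 1 \<subseteq> (\<Union>c\<in>C. ball c r)" "r > 0" using r by (auto simp: A_def)
    have "T ` cball 0 1 = T ` closure (ball 0 1)" by simp
    also have "\<dots> \<subseteq> (\<Union>c\<in>C. cball c r)"
    proof (rule image_closure_subset)
      show "continuous_on (closure (ball 0 1)) T"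
        by (intro linear_continuous_on blinfun.bounded_linear_right)
      show "closed (\<Union>c\<in>C. cball c r)" using C by auto
      show "T ` ball 0 1 \<subseteq> (\<Union>c\<in>C. cball c r)" using C(2) by (force simp: less_imp_le)
    qed
    finally have "ball_covered T (Suc (card C)) r" using C(1) by (auto simp: ball_covered_def)
    then show ?thesis using entropy_gauge_lower[of r "Suc (card C)" T 0] C(3) by simp
  qed
  have 2: "r' \<in> A" if r: "0 < r" "ball_covered T K r" "r < r'" for r r' K
  proof -
    obtain C where C: "finite C" "T ` cball 0 1 \<subseteq> (\<Union>c\<in>C. cball c r)"
      using r(2) unfolding ball_covered_def by blast
    have "T ` ball 0 1 \<subseteq> T ` cball 0 1" by (intro image_mono) auto
    also note C(2)
    also have "(\<Union>c\<in>C. cball c r) \<subseteq> (\<Union>c\<in>C. ball c r')" using r(3) by force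
    finally show ?thesis using C(1) r by (auto simp: A_def)
  qed
  have ne: "A \<noteq> {}" using 2[of "norm T + 1" 1 "norm T + 2"] ball_covered_norm[of T "norm T + 1"]
    by (auto simp: add_nonneg_pos)
  have bdd: "bdd_below A" by (rule bdd_belowI[of _ 0]) (auto simp: A_def)
  have "entropy_gauge 0 T \<le> Inf A" by (rule cInf_greatest[OF ne 1])
  moreover have "Inf A \<le> entropy_gauge 0 T"
  proof (rule entropy_gauge_greatest)
    fix r K assume r: "0 < r" "0 < K" "ball_covered T K r"
    have "Inf A \<le> r"
      by (rule field_le_epsilon, rule cInf_lower[OF 2 bdd]) (use r in auto)
    then show "Inf A \<le> r * real K powr 0" using r by simp
  qed
  ultimately show ?thesis by (simp add: compactness_seminorm_def A_def)
qed

text \<open>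
  A fixed covering by \<open>K\<close> balls is good for all large \<open>k\<close> because \<open>K powr (1 / k)\<close> tends to \<open>1\<close>.
\<close>

lemma entropy_gauge_inverse_nat_less:
  assumes "entropy_gauge 0 T < t"
  obtains N where "\<And>k. k \<ge> N \<Longrightarrow> entropy_gauge (1 / real k) T < t"
proof -
  obtain r K where rK: "0 < r" "0 < K" "ball_covered T K r" "r * real K powr 0 < t"
    using assms by (auto simp: entropy_gauge_less_iff)
  have "((\<lambda>k. real K powr (1 / real k)) \<longlongrightarrow> real K powr 0) sequentially"
    using rK(2) by (intro tendsto_powr lim_1_over_n tendsto_const) auto
  then have "((\<lambda>k. r * real K powr (1 / real k)) \<longlongrightarrow> r * real K powr 0) sequentially"
    by (rule tendsto_mult_left)
  then have "eventually (\<lambda>k. r * real K powr (1 / real k) < t) sequentially"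
    using rK(4) by (rule order_tendstoD(2))
  then obtain N where N: "\<And>k. k \<ge> N \<Longrightarrow> r * real K powr (1 / real k) < t"
    by (auto simp: eventually_sequentially)
  show thesis
    by (rule that[of N]) (use N rK in \<open>auto simp: entropy_gauge_less_iff\<close>)
qed

section \<open>Bernstein numbers, covering numbers and noncompactness\<close>

text \<open>
  A packing bound. Take \<open>x\<^sub>i\<close> and \<open>w\<close> that realise the exterior norm up to a factor \<open>2\<close>. The \<open>M ^ k\<close>
  combinations of the \<open>x\<^sub>i\<close> with coefficients in \<open>{0..<M}\<close>, scaled into the unit ball, have images whose
  distances are controlled from below by Cramer's rule. If \<open>M ^ k\<close> exceeds the number of balls, two of
  the images share a ball, so the radius cannot be small.
\<close>

lemma rho_le_entropy_gauge:
  fixes T :: "'a::real_normed_vector \<Rightarrow>\<^sub>L 'a"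
  assumes k: "k > 0"
  shows "rho k T \<le> 8 * real k ^ 2 * entropy_gauge (1 / real k) T"
proof (cases "rho k T > 0")
  case False
  then show ?thesis using entropy_gauge_nonneg[of "1 / real k" T] by (smt (verit) mult_nonneg_nonneg zero_le_power2)
next
  case True
  obtain m where km: "k = Suc m" using k gr0_implies_Suc by blast
  define D where "D = wedge_norm m T"
  have "rho m T > 0" if "m > 0" using rho_Suc_le[OF that, of T] True km by simp
  then have D: "D > 0" unfolding D_def by (rule wedge_norm_pos)
  have Dk: "wedge_norm k T > 0" using True by (intro wedge_norm_pos)
  then obtain w x where w: "alt_form k w" and x: "\<And>j. j < k \<Longrightarrow> norm (x j) \<le> 1"
    and wx: "wedge_norm k T / 2 < \<bar>w (\<lambda>i. T (x i))\<bar>"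
    using wedge_norm_less[of "wedge_norm k T / 2" k T] by auto
  have "rho k T / (8 * real k ^ 2) \<le> entropy_gauge (1 / real k) T"
  proof (rule entropy_gauge_greatest)
    fix r :: real and K :: nat assume r: "0 < r" and K: "0 < K" and c: "ball_covered T K r"
    define t where "t = real K powr (1 / real k)"
    have t: "t \<ge> 1" using K unfolding t_def by (intro ge_one_powr_ge_zero) auto
    \<comment> \<open>The least number of grid values per coordinate with more than \<open>K\<close> grid points.\<close>
    define M where "M = Suc (nat \<lfloor>t\<rfloor>)"
    have M: "t < real M" "real M \<le> 2 * t" using t by (auto simp: M_def) linarith+
    have "real K = t ^ k" using K k by (simp add: t_def powr_realpow[symmetric] powr_powr)
    also have "\<dots> < real M ^ k" using M t k by (intro power_strict_mono) auto
    finally have KM: "K < M ^ k" by (metis of_nat_less_iff of_nat_power)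
    have M0: "M > 0" by (simp add: M_def)
    obtain C where C: "finite C" "card C \<le> K" "\<And>y. norm y \<le> 1 \<Longrightarrow> \<exists>c\<in>C. norm (T y - c) \<le> r"
      using c by (force simp: ball_covered_def dist_norm norm_minus_commute)
    define A where "A = {..<k} \<rightarrow>\<^sub>E {..<M}"
    define s where "s a = (\<Sum>i<k. real (a i) *\<^sub>R x i)" for a :: "nat \<Rightarrow> nat"
    define y where "y a = (1 / (real k * real M)) *\<^sub>R s a" for a
    have "norm (s a) \<le> real k * real M" if "a \<in> A" for a
    proof -
      have "norm (s a) \<le> (\<Sum>i<k. real M)" unfolding s_def
      proof (rule sum_norm_le)
        fix i assume "i \<in> {..<k}"
        then have "a i < M" "norm (x i) \<le> 1" using that x by (auto simp: A_def)
        then have "real (a i) * norm (x i) \<le> real M * 1" by (intro mult_mono) auto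
        then show "norm (real (a i) *\<^sub>R x i) \<le> real M" by simp
      qed
      then show ?thesis by simp
    qed
    then have "norm (y a) \<le> 1" if "a \<in> A" for a
      using that M0 k by (simp add: y_def divide_simps)
    then have "\<forall>a\<in>A. \<exists>c\<in>C. norm (T (y a) - c) \<le> r" using C(3) by blast
    then obtain h where h: "\<And>a. a \<in> A \<Longrightarrow> h a \<in> C" "\<And>a. a \<in> A \<Longrightarrow> norm (T (y a) - h a) \<le> r"
      by metis
    have "card A = M ^ k" by (simp add: A_def card_PiE)
    then have "card C < card A" using C(2) KM by simp
    moreover have "card (h ` A) \<le> card C" using h(1) C(1) by (intro card_mono) auto
    ultimately have "\<not> inj_on h A" using card_image[of h A] by auto
    then obtain a b where ab: "a \<in> A" "b \<in> A" "a \<noteq> b" "h a = h b" by (auto simp: inj_on_def)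
    then obtain j where j: "j < k" "a j \<noteq> b j" using PiE_ext[of a "{..<k}" "\<lambda>_. {..<M}" b] by (auto simp: A_def)
    have d: "norm (T (y a) - T (y b)) \<le> 2 * r"
      using norm_triangle_ineq4[of "T (y a) - h a" "T (y b) - h a"] h(2)[OF ab(1)] h(2)[OF ab(2)] ab(4)
      by simp
    define z where "z = (\<Sum>i<k. (real (a i) - real (b i)) *\<^sub>R x i)"
    have "z = s a - s b" by (simp add: z_def s_def scaleR_left_diff_distrib sum_subtractf)
    also have "\<dots> = (real k * real M) *\<^sub>R (y a - y b)" using M0 k by (simp add: y_def scaleR_right_diff_distrib)
    finally have "norm (T z) = real k * real M * norm (T (y a) - T (y b))"
      by (simp add: blinfun.scaleR_right blinfun.diff_right)
    also have "\<dots> \<le> real k * real M * (2 * r)" using d by (intro mult_left_mono) auto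
    finally have Tz: "norm (T z) \<le> real k * real M * (2 * r)" .
    have "1 * \<bar>w (\<lambda>i. T (x i))\<bar> \<le> \<bar>real (a j) - real (b j)\<bar> * \<bar>w (\<lambda>i. T (x i))\<bar>"
      using j(2) by (intro mult_right_mono) auto
    also have "\<dots> = \<bar>w ((\<lambda>i. T (x i))(j := T z))\<bar>"
      unfolding z_def alt_form_coordinate[OF w j(1)] by (simp add: abs_mult)
    also have "\<dots> \<le> D * norm (T z)"
      unfolding D_def using w x j km by (intro alt_form_replace) auto
    also have "\<dots> \<le> D * (real k * real M * (2 * r))" using Tz D by (intro mult_left_mono) auto
    finally have "wedge_norm k T \<le> 4 * D * real k * real M * r" using wx by simp
    moreover have "rho k T * D \<le> real k * wedge_norm k T"
      using rho_wedge_norm_le[of m T] km by (simp add: D_def)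
    ultimately have "rho k T * D \<le> real k * (4 * D * real k * real M * r)"
      by (meson mult_left_mono of_nat_0_le_iff order_trans)
    then have "rho k T * D \<le> (4 * real k ^ 2 * real M * r) * D" by (simp add: power2_eq_square mult_ac)
    then have "rho k T \<le> 4 * real k ^ 2 * real M * r" using D by simp
    also have "\<dots> \<le> 4 * real k ^ 2 * (2 * t) * r" using M r by (intro mult_right_mono mult_left_mono) auto
    finally show "rho k T / (8 * real k ^ 2) \<le> r * real K powr (1 / real k)"
      using k by (simp add: t_def divide_simps mult_ac)
  qed
  then show ?thesis using k by (simp add: divide_simps mult_ac)
qed

text \<open>
  Pigeonhole on the integer parts of \<open>\<phi> j y / \<delta>\<close>.
\<close>

lemma finite_approximate_values:
  fixes \<phi> :: "nat \<Rightarrow> 'a \<Rightarrow> real"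
  assumes bound: "\<And>j y. j < m \<Longrightarrow> y \<in> S \<Longrightarrow> \<bar>\<phi> j y\<bar> \<le> P" and \<delta>: "\<delta> > 0"
  shows "\<exists>R. finite R \<and> R \<subseteq> S \<and> (\<forall>y\<in>S. \<exists>r\<in>R. \<forall>j<m. \<bar>\<phi> j y - \<phi> j r\<bar> \<le> \<delta>)"
proof -
  define p where "p y = (\<lambda>j\<in>{..<m}. \<lfloor>\<phi> j y / \<delta>\<rfloor>)" for y
  define R where "R = inv_into S p ` p ` S"
  have "p ` S \<subseteq> {..<m} \<rightarrow>\<^sub>E {\<lfloor>- P / \<delta>\<rfloor>..\<lfloor>P / \<delta>\<rfloor>}"
  proof
    fix q assume "q \<in> p ` S"
    then obtain y where y: "y \<in> S" "q = p y" by blast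
    have "\<lfloor>- P / \<delta>\<rfloor> \<le> \<lfloor>\<phi> j y / \<delta>\<rfloor>" "\<lfloor>\<phi> j y / \<delta>\<rfloor> \<le> \<lfloor>P / \<delta>\<rfloor>" if "j < m" for j
      using bound[OF that y(1)] \<delta> by (intro floor_mono divide_right_mono; linarith)+
    then show "q \<in> {..<m} \<rightarrow>\<^sub>E {\<lfloor>- P / \<delta>\<rfloor>..\<lfloor>P / \<delta>\<rfloor>}" using y by (auto simp: p_def)
  qed
  then have "finite (p ` S)" by (rule finite_subset) (auto intro: finite_PiE)
  then have "finite R" by (simp add: R_def)
  moreover have "R \<subseteq> S" by (auto simp: R_def intro: inv_into_into)
  moreover have "\<exists>r\<in>R. \<forall>j<m. \<bar>\<phi> j y - \<phi> j r\<bar> \<le> \<delta>" if y: "y \<in> S" for y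
  proof (intro bexI allI impI)
    let ?r = "inv_into S p (p y)"
    show "?r \<in> R" using y by (auto simp: R_def)
    have eq: "p ?r = p y" using y by (intro f_inv_into_f) auto
    fix j assume "j < m"
    then have "\<lfloor>\<phi> j y / \<delta>\<rfloor> = \<lfloor>\<phi> j ?r / \<delta>\<rfloor>" using fun_cong[OF eq, of j] by (simp add: p_def)
    then have "\<bar>\<phi> j y / \<delta> - \<phi> j ?r / \<delta>\<bar> \<le> 1" by linarith
    then show "\<bar>\<phi> j y - \<phi> j ?r\<bar> \<le> \<delta>" using \<delta> by (simp add: divide_simps split: if_splits)
  qed
  ultimately show ?thesis by blast
qed

text \<open>
  If \<open>s\<close> is below the compactness seminorm, then no finite set of balls of radius \<open>s\<close> covers the image.
  Sort the unit ball into finitely many cells on which the \<open>m\<close> functionals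
  \<open>y \<mapsto> w (\<dots>, T y, \<dots>)\<close> are almost constant: some cell contains two points whose images are more than
  \<open>s\<close> apart. Half their difference is a unit ball vector that is expanded to at least \<open>s / 2\<close> and for
  which the error terms of \<open>wedge_norm_Suc_ge\<close> are tiny.
\<close>

lemma entropy_gauge_0_wedge_norm_le:
  fixes T :: "'a::real_normed_vector \<Rightarrow>\<^sub>L 'b::real_normed_vector"
  shows "entropy_gauge 0 T * wedge_norm m T \<le> 2 * real (Suc m) * wedge_norm (Suc m) T"
proof (cases "entropy_gauge 0 T > 0")
  case False
  then have "entropy_gauge 0 T = 0" using entropy_gauge_nonneg[of 0 T] by simp
  then show ?thesis by (simp add: wedge_norm_nonneg)
next
  case True
  define E where "E = real (Suc m) * wedge_norm (Suc m) T"
  have step: "\<bar>w (\<lambda>i. T (x i))\<bar> * (s / 2) \<le> E"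
    if s: "0 < s" "s < entropy_gauge 0 T" and w: "alt_form m w" and x: "\<And>j. j < m \<Longrightarrow> norm (x j) \<le> 1"
    for s w and x :: "nat \<Rightarrow> 'a"
  proof (rule field_le_epsilon)
    fix e :: real assume e: "e > 0"
    define \<delta> where "\<delta> = e / (real m * norm T + 1)"
    have pos: "real m * norm T + 1 > 0" by (simp add: add_nonneg_pos)
    have \<delta>: "\<delta> > 0" using e pos by (simp add: \<delta>_def)
    define \<phi> where "\<phi> j y = w ((\<lambda>i. T (x i))(j := T y))" for j y
    have lin: "linear (\<phi> j)" if "j < m" for j
      using linear_compose[OF bounded_linear.linear[OF blinfun.bounded_linear_right, of T]
          alt_form_linear[OF w that]] unfolding \<phi>_def o_def .
    have bnd: "\<bar>\<phi> j y\<bar> \<le> norm T ^ m" if "j < m" "y \<in> cball 0 1" for j y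
    proof -
      have "(\<lambda>i. T (x i))(j := T y) = (\<lambda>i. T ((x(j := y)) i))" by (simp add: fun_eq_iff)
      then show ?thesis
        using wedge_norm_elem_le[OF w, of "x(j := y)" T] x that by (simp add: \<phi>_def)
    qed
    have "\<exists>R. finite R \<and> R \<subseteq> cball 0 1 \<and> (\<forall>y\<in>cball 0 1. \<exists>r\<in>R. \<forall>j<m. \<bar>\<phi> j y - \<phi> j r\<bar> \<le> 2 * \<delta>)"
      using \<delta> by (intro finite_approximate_values[where P = "norm T ^ m"] bnd) auto
    then obtain R where R: "finite R" "R \<subseteq> cball 0 1"
        "\<And>y. y \<in> cball 0 1 \<Longrightarrow> \<exists>r\<in>R. \<forall>j<m. \<bar>\<phi> j y - \<phi> j r\<bar> \<le> 2 * \<delta>"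
      by blast
    have "\<exists>y r. norm y \<le> 1 \<and> norm r \<le> 1 \<and> (\<forall>j<m. \<bar>\<phi> j y - \<phi> j r\<bar> \<le> 2 * \<delta>) \<and> s < norm (T y - T r)"
    proof (rule ccontr)
      assume no: "\<not> ?thesis"
      have "T ` cball 0 1 \<subseteq> (\<Union>c\<in>T ` R. cball c s)"
      proof (rule image_subsetI)
        fix y :: 'a assume y: "y \<in> cball 0 1"
        obtain r where r: "r \<in> R" "\<forall>j<m. \<bar>\<phi> j y - \<phi> j r\<bar> \<le> 2 * \<delta>" using R(3)[OF y] by blast
        have "norm (T y - T r) \<le> s" using no r R(2) y by (force simp: not_less)
        then show "T y \<in> (\<Union>c\<in>T ` R. cball c s)"
          using r(1) by (auto simp: dist_norm norm_minus_commute)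
      qed
      moreover have "card (T ` R) \<le> Suc (card R)" using card_image_le[OF R(1), of T] by simp
      ultimately have "ball_covered T (Suc (card R)) s" unfolding ball_covered_def using R(1) by blast
      then have "entropy_gauge 0 T \<le> s" using entropy_gauge_lower[of s "Suc (card R)" T 0] s by simp
      then show False using s by simp
    qed
    then obtain y r where yr: "norm y \<le> 1" "norm r \<le> 1" "\<And>j. j < m \<Longrightarrow> \<bar>\<phi> j y - \<phi> j r\<bar> \<le> 2 * \<delta>"
      "s < norm (T y - T r)" by blast
    define z where "z = (1/2) *\<^sub>R (y - r)"
    have "norm (y - r) \<le> 2" using norm_triangle_ineq4[of y r] yr by simp
    then have z: "norm z \<le> 1" by (simp add: z_def)
    have "T z = (1/2) *\<^sub>R (T y - T r)" by (simp add: z_def blinfun.scaleR_right blinfun.diff_right)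
    then have Tz: "s / 2 \<le> norm (T z)" using yr(4) by simp
    have "\<bar>w (\<lambda>i. T (x i))\<bar> * norm (T z) \<le> E + real m * norm T * \<delta>"
      unfolding E_def
    proof (rule wedge_norm_Suc_ge[OF w x z])
      fix j assume j: "j < m"
      have "\<phi> j z = (\<phi> j y - \<phi> j r) / 2"
        unfolding z_def by (simp add: linear_scale[OF lin[OF j]] linear_diff[OF lin[OF j]])
      then have "\<bar>\<phi> j z\<bar> \<le> \<delta>" using yr(3)[OF j] by simp
      then show "\<bar>w ((\<lambda>i. T (x i))(j := T z))\<bar> \<le> \<delta>" by (simp add: \<phi>_def)
    qed (use \<delta> in auto)
    moreover have "real m * norm T * \<delta> \<le> e"
    proof -
      have "real m * norm T * \<delta> \<le> (real m * norm T + 1) * \<delta>" using \<delta> by (intro mult_right_mono) auto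
      also have "\<dots> = e" using pos by (simp add: \<delta>_def)
      finally show ?thesis .
    qed
    moreover have "\<bar>w (\<lambda>i. T (x i))\<bar> * (s / 2) \<le> \<bar>w (\<lambda>i. T (x i))\<bar> * norm (T z)"
      using Tz by (intro mult_left_mono) auto
    ultimately show "\<bar>w (\<lambda>i. T (x i))\<bar> * (s / 2) \<le> E + e" by linarith
  qed
  have sD: "s * wedge_norm m T \<le> 2 * E" if s: "0 < s" "s < entropy_gauge 0 T" for s
  proof -
    have "wedge_norm m T \<le> 2 * E / s"
      by (rule wedge_norm_least) (use step[OF s] s in \<open>simp add: field_simps\<close>)
    then show ?thesis using s by (simp add: field_simps)
  qed
  show ?thesis
  proof (cases "wedge_norm m T = 0")
    case False
    then have D: "wedge_norm m T > 0" using wedge_norm_nonneg[of m T] by simp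
    have "entropy_gauge 0 T \<le> 2 * E / wedge_norm m T"
      by (rule dense_le_bounded[OF True]) (use sD D in \<open>simp add: field_simps\<close>)
    then show ?thesis using D by (simp add: E_def field_simps)
  qed (simp add: wedge_norm_nonneg)
qed

text \<open>
  Positivity of the seminorm propagates to all exterior norms, so these can be cancelled.
\<close>

lemma entropy_gauge_0_le_rho:
  fixes T :: "'a::real_normed_vector \<Rightarrow>\<^sub>L 'a"
  assumes k: "k > 0"
  shows "entropy_gauge 0 T \<le> 2 * real k ^ 2 * rho k T"
proof (cases "entropy_gauge 0 T > 0")
  case False
  then show ?thesis using rho_nonneg[OF k, of T] by (smt (verit) mult_nonneg_nonneg zero_le_power2)
next
  case True
  have pos: "wedge_norm m T > 0" for m
  proof (induction m)
    case (Suc m)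
    then have "0 < 2 * real (Suc m) * wedge_norm (Suc m) T"
      using True entropy_gauge_0_wedge_norm_le[of T m] by (smt (verit) mult_pos_pos)
    then show ?case by (simp add: zero_less_mult_iff)
  qed (simp add: wedge_norm_0)
  obtain m where km: "k = Suc m" using k gr0_implies_Suc by blast
  have "entropy_gauge 0 T * wedge_norm m T \<le> 2 * real k * wedge_norm k T"
    using entropy_gauge_0_wedge_norm_le[of T m] km by simp
  also have "\<dots> \<le> 2 * real k * (real k * rho k T * wedge_norm m T)"
    using wedge_norm_Suc_le[of m T] km by (intro mult_left_mono) auto
  finally have "entropy_gauge 0 T * wedge_norm m T \<le> (2 * real k ^ 2 * rho k T) * wedge_norm m T"
    by (simp add: power2_eq_square mult_ac)
  then show ?thesis using pos[of m] by simp
qed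

section \<open>Measurability in the strong operator topology\<close>

text \<open>
  Open in the strong operator topology, the topology of pointwise convergence.
\<close>

definition sot_open :: "('a::real_normed_vector \<Rightarrow>\<^sub>L 'b::real_normed_vector) set \<Rightarrow> bool" where
  "sot_open S \<longleftrightarrow> (\<forall>T\<in>S. \<exists>F e. finite F \<and> 0 < e \<and>
     (\<forall>T'. (\<forall>x\<in>F. norm (blinfun_apply T' x - T x) < e) \<longrightarrow> T' \<in> S))"

lemma separable_countable_dense:
  assumes "separable_space (euclidean :: 'a::real_normed_vector topology)"
  obtains Q :: "'a::real_normed_vector set" where "countable Q" "closure Q = UNIV"
  using assms by (auto simp: separable_space_def)

lemma dense_approx:
  fixes Q :: "'a::real_normed_vector set"
  assumes "closure Q = UNIV" "e > 0"
  shows "\<exists>q\<in>Q. norm (x - q) < e"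
  using closure_approachable[of x Q] assms by (auto simp: dist_norm norm_minus_commute)

lemma norm_blinfun_le_dense:
  fixes T :: "'a::real_normed_vector \<Rightarrow>\<^sub>L 'b::real_normed_vector"
  assumes Q: "closure Q = UNIV" and c: "c \<ge> 0"
  shows "norm T \<le> c \<longleftrightarrow> (\<forall>q\<in>Q. norm (T q) \<le> c * norm q)"
proof
  assume "norm T \<le> c"
  then show "\<forall>q\<in>Q. norm (T q) \<le> c * norm q"
    by (meson mult_right_mono norm_blinfun norm_ge_zero order_trans)
next
  assume *: "\<forall>q\<in>Q. norm (T q) \<le> c * norm q"
  have "closed {x. norm (T x) \<le> c * norm x}"
    by (intro closed_Collect_le continuous_intros)
  then have "closure Q \<subseteq> {x. norm (T x) \<le> c * norm x}"
    using * by (intro closure_minimal) auto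
  then show "norm T \<le> c" using Q c by (intro norm_blinfun_bound) auto
qed

text \<open>
  On norm-bounded sets of operators the strong operator topology has a countable base, given by
  finitely many pairs from a countable dense set and a radius \<open>1 / Suc p\<close>. The norm balls themselves
  are measurable since the norm is determined on a dense set.
\<close>

lemma sot_open_measurable:
  fixes A :: "'w \<Rightarrow> 'a::real_normed_vector \<Rightarrow>\<^sub>L 'a"
  assumes A: "strongly_measurable M A" and sep: "separable_space (euclidean :: 'a topology)"
    and S: "sot_open S"
  shows "{\<omega> \<in> space M. A \<omega> \<in> S} \<in> sets M"
proof -
  obtain Q :: "'a set" where Q: "countable Q" "closure Q = UNIV"
    using separable_countable_dense[OF sep] by blast
  have meas: "(\<lambda>\<omega>. A \<omega> x) \<in> borel_measurable M" for x
    using A by (auto simp: strongly_measurable_def)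
  define U where "U l p = {T :: 'a \<Rightarrow>\<^sub>L 'a. \<forall>(q, z)\<in>set l. norm (T q - z) < 1 / real (Suc p)}"
    for l :: "('a \<times> 'a) list" and p :: nat
  define G where "G n = {(l, p). l \<in> lists (Q \<times> Q) \<and> U l p \<inter> {T. norm T \<le> real n} \<subseteq> S}" for n :: nat
  have cG: "countable (G n)" for n
    by (rule countable_subset[of _ "lists (Q \<times> Q) \<times> UNIV"])
       (auto simp: G_def intro!: countable_SIGMA countable_lists Q)
  have mU: "{\<omega> \<in> space M. A \<omega> \<in> U l p} \<in> sets M" for l p
  proof -
    have ball: "{\<omega> \<in> space M. norm (A \<omega> q - z) < e} \<in> sets M" for q z e
    proof -
      have "{\<omega> \<in> space M. norm (A \<omega> q - z) < e} = (\<lambda>\<omega>. A \<omega> q) -` ball z e \<inter> space M"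
        by (auto simp: dist_norm norm_minus_commute)
      then show ?thesis using measurable_sets[OF meas, of "ball z e" q] by simp
    qed
    have "{\<omega> \<in> space M. A \<omega> \<in> U l p} =
        {\<omega> \<in> space M. \<forall>a\<in>set l. norm (A \<omega> (fst a) - snd a) < 1 / real (Suc p)}"
      by (auto simp: U_def)
    also have "\<dots> \<in> sets M" by (intro sets.sets_Collect_finite_All ball) auto
    finally show ?thesis .
  qed
  have mN: "{\<omega> \<in> space M. norm (A \<omega>) \<le> real n} \<in> sets M" for n :: nat
  proof -
    have "norm (A \<omega>) \<le> real n \<longleftrightarrow> (\<forall>q\<in>Q. norm (A \<omega> q) \<le> real n * norm q)" for \<omega>
      by (rule norm_blinfun_le_dense[OF Q(2)]) simp
    then have "{\<omega> \<in> space M. norm (A \<omega>) \<le> real n} =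
        {\<omega> \<in> space M. \<forall>q\<in>Q. norm (A \<omega> q) \<le> real n * norm q}"
      by simp
    also have "\<dots> \<in> sets M"
    proof (rule sets.sets_Collect_countable_All'[OF _ Q(1)])
      fix q
      have "(\<lambda>\<omega>. norm (A \<omega> q)) \<in> borel_measurable M"
        using measurable_compose[OF meas borel_measurable_norm] .
      then show "{\<omega> \<in> space M. norm (A \<omega> q) \<le> real n * norm q} \<in> sets M" by measurable
    qed
    finally show ?thesis .
  qed
  have eq: "{\<omega> \<in> space M. A \<omega> \<in> S} =
      (\<Union>n. {\<omega> \<in> space M. norm (A \<omega>) \<le> real n} \<inter> (\<Union>a\<in>G n. {\<omega> \<in> space M. A \<omega> \<in> U (fst a) (snd a)}))"
    (is "?L = ?R")
  proof
    show "?R \<subseteq> ?L" by (auto simp: G_def)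
    show "?L \<subseteq> ?R"
    proof
      fix \<omega> assume "\<omega> \<in> ?L"
      then have \<omega>: "\<omega> \<in> space M" and "A \<omega> \<in> S" by auto
      define T where "T = A \<omega>"
      obtain F e where F: "finite F" "0 < e" "\<And>T'. (\<And>x. x \<in> F \<Longrightarrow> norm (blinfun_apply T' x - T x) < e) \<Longrightarrow> T' \<in> S"
        using S \<open>A \<omega> \<in> S\<close> unfolding sot_open_def T_def by metis
      obtain n :: nat where n: "norm T \<le> real n" using real_arch_simple by blast
      define d where "d = e / (4 * (real n + 1))"
      have d: "d > 0" "real n * d \<le> e / 4" using F(2) by (auto simp: d_def field_simps)
      obtain p :: nat where p: "1 / real (Suc p) < e / 4"
        using nat_approx_posE[of "e / 4"] F(2) by auto
      obtain q where q: "\<And>x. q x \<in> Q" "\<And>x. norm (x - q x) < d"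
        using dense_approx[OF Q(2) d(1)] by metis
      obtain z where z: "\<And>x. z x \<in> Q" "\<And>x. norm (x - z x) < 1 / real (Suc p)"
        using dense_approx[OF Q(2), of "1 / real (Suc p)"] by (metis of_nat_0_less_iff zero_less_Suc zero_less_divide_1_iff)
      obtain fs where fs: "set fs = F" using finite_list[OF F(1)] by blast
      define l where "l = map (\<lambda>x. (q x, z (T (q x)))) fs"
      have TU: "T \<in> U l p" using z(2) by (auto simp: U_def l_def)
      have "U l p \<inter> {T. norm T \<le> real n} \<subseteq> S"
      proof
        fix T' assume T': "T' \<in> U l p \<inter> {T. norm T \<le> real n}"
        show "T' \<in> S"
        proof (rule F(3))
          fix x assume x: "x \<in> F"
          have small: "norm (R x - R (q x)) \<le> e / 4" if R: "norm R \<le> real n" for R :: "'a \<Rightarrow>\<^sub>L 'a"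
          proof -
            have "norm (R (x - q x)) \<le> norm R * norm (x - q x)" by (rule norm_blinfun)
            also have "\<dots> \<le> real n * d" using R q(2)[of x] by (intro mult_mono) auto
            finally show ?thesis using d(2) by (simp add: blinfun.diff_right)
          qed
          have 1: "norm (T' (q x) - z (T (q x))) < e / 4"
            using T' x fs p by (force simp: U_def l_def)
          have 2: "norm (T (q x) - z (T (q x))) < e / 4" using z(2)[of "T (q x)"] p by simp
          have "T' x - T x = (T' x - T' (q x)) + (T' (q x) - z (T (q x))) - (T (q x) - z (T (q x))) - (T x - T (q x))"
            by simp
          also have "norm \<dots> \<le> norm (T' x - T' (q x)) + norm (T' (q x) - z (T (q x))) +
              norm (T (q x) - z (T (q x))) + norm (T x - T (q x))"
            by (meson add_mono norm_triangle_ineq norm_triangle_ineq4 order_refl order_trans)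
          also have "\<dots> < e" using small[of T'] small[of T] 1 2 T' n by auto
          finally show "norm (T' x - T x) < e" .
        qed
      qed
      then have "(l, p) \<in> G n" using q z by (auto simp: G_def l_def)
      moreover have "\<omega> \<in> {\<omega> \<in> space M. A \<omega> \<in> U (fst (l, p)) (snd (l, p))}" using \<omega> TU by (simp add: T_def)
      ultimately show "\<omega> \<in> ?R" using \<omega> n unfolding T_def by blast
    qed
  qed
  show ?thesis unfolding eq
    by (intro sets.countable_UN sets.Int mN sets.countable_UN' cG image_subsetI mU) auto
qed

text \<open>
  Approximate \<open>g\<close> by functions with values in a countable dense set; on each of the countably many
  pieces the value of \<open>A\<close> at a constant vector is measurable.
\<close>

lemma strongly_measurable_apply:
  fixes A :: "'w \<Rightarrow> 'a::real_normed_vector \<Rightarrow>\<^sub>L 'a"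
  assumes A: "strongly_measurable M A" and sep: "separable_space (euclidean :: 'a topology)"
    and g: "g \<in> borel_measurable M"
  shows "(\<lambda>\<omega>. A \<omega> (g \<omega>)) \<in> borel_measurable M"
proof -
  obtain Q :: "'a set" where Q: "countable Q" "closure Q = UNIV"
    using separable_countable_dense[OF sep] by blast
  then have "Q \<noteq> {}" by auto
  define e where "e = from_nat_into Q"
  have near: "\<exists>i. norm (x - e i) < 1 / real (Suc n)" for x n
  proof -
    obtain q where "q \<in> Q" "norm (x - q) < 1 / real (Suc n)" using dense_approx[OF Q(2)]
      by (metis of_nat_0_less_iff zero_less_Suc zero_less_divide_1_iff)
    then show ?thesis using from_nat_into_surj[OF Q(1)] by (metis e_def)
  qed
  define i where "i n \<omega> = (LEAST i. norm (g \<omega> - e i) < 1 / real (Suc n))" for n \<omega>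
  have i: "norm (g \<omega> - e (i n \<omega>)) < 1 / real (Suc n)" for n \<omega>
    unfolding i_def by (rule LeastI_ex[OF near])
  have im: "i n \<in> measurable M (count_space UNIV)" for n
    unfolding i_def
  proof (rule measurable_Least)
    fix j
    have "{\<omega> \<in> space M. norm (g \<omega> - e j) < 1 / real (Suc n)} = g -` ball (e j) (1 / real (Suc n)) \<inter> space M"
      by (auto simp: dist_norm norm_minus_commute)
    also have "\<dots> \<in> sets M" by (rule measurable_sets[OF g]) simp
    finally show "Measurable.pred M (\<lambda>\<omega>. norm (g \<omega> - e j) < 1 / real (Suc n))" by (simp add: pred_def)
  qed
  show ?thesis
  proof (rule borel_measurable_LIMSEQ_metric)
    fix n
    show "(\<lambda>\<omega>. A \<omega> (e (i n \<omega>))) \<in> borel_measurable M"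
      by (rule measurable_compose_countable[OF _ im]) (use A in \<open>simp add: strongly_measurable_def\<close>)
  next
    fix \<omega>
    have "(\<lambda>n. e (i n \<omega>)) \<longlonglongrightarrow> g \<omega>"
    proof (rule LIMSEQ_norm_0[THEN LIM_zero_cancel])
      fix n show "norm (e (i n \<omega>) - g \<omega>) < 1 / real (Suc n)" using i[of \<omega> n] by (simp add: norm_minus_commute)
    qed
    then show "(\<lambda>n. A \<omega> (e (i n \<omega>))) \<longlonglongrightarrow> A \<omega> (g \<omega>)" by (rule blinfun.tendsto[OF tendsto_const])
  qed
qed

lemma strongly_measurable_compose:
  fixes A B :: "'w \<Rightarrow> 'a::real_normed_vector \<Rightarrow>\<^sub>L 'a"
  assumes "strongly_measurable M A" "strongly_measurable M B"
    and "separable_space (euclidean :: 'a topology)"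
  shows "strongly_measurable M (\<lambda>\<omega>. A \<omega> o\<^sub>L B \<omega>)"
  unfolding strongly_measurable_def
proof
  fix x
  have "(\<lambda>\<omega>. B \<omega> x) \<in> borel_measurable M" using assms(2) by (simp add: strongly_measurable_def)
  from strongly_measurable_apply[OF assms(1,3) this]
  show "(\<lambda>\<omega>. (A \<omega> o\<^sub>L B \<omega>) x) \<in> borel_measurable M" by simp
qed

text \<open>
  Change the entries one at a time; by linearity each change costs a factor \<open>norm (Y i - X i)\<close>.
\<close>

lemma alt_form_continuous:
  assumes w: "alt_form k w" and \<eta>: "\<eta> > 0"
  obtains e where "e > 0" "\<And>Y. (\<And>j. j < k \<Longrightarrow> norm (Y j - X j) < e) \<Longrightarrow> \<bar>w Y - w X\<bar> < \<eta>"
proof -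
  define R where "R = 2 + (\<Sum>j<k. norm (X j))"
  have R1: "R \<ge> 1" unfolding R_def using sum_nonneg[of "{..<k}" "\<lambda>j. norm (X j)"] by simp
  have XR: "norm (X j) + 1 \<le> R" if "j < k" for j
    using member_le_sum[of j "{..<k}" "\<lambda>j. norm (X j)"] that by (simp add: R_def)
  define e where "e = min 1 (\<eta> / (2 * (real k * R ^ k + 1)))"
  have pos: "real k * R ^ k + 1 > 0" using R1 by (simp add: add_nonneg_pos)
  have e: "e > 0" "e \<le> 1" using \<eta> pos by (auto simp: e_def)
  have ek: "real k * R ^ k * e < \<eta>"
  proof -
    have "real k * R ^ k * e \<le> (real k * R ^ k + 1) * (\<eta> / (2 * (real k * R ^ k + 1)))"
      using e R1 by (intro mult_mono) (auto simp: e_def)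
    also have "\<dots> = \<eta> / 2" using pos by (simp add: field_simps)
    finally show ?thesis using \<eta> by simp
  qed
  show thesis
  proof (rule that[OF e(1)])
    fix Y assume Y: "\<And>j. j < k \<Longrightarrow> norm (Y j - X j) < e"
    have YR: "norm (Y j) \<le> R" if "j < k" for j
      using norm_triangle_ineq2[of "Y j" "X j"] Y[OF that] XR[OF that] e(2) by linarith
    \<comment> \<open>Hybrids between \<open>X\<close> and \<open>Y\<close>: consecutive ones differ in one entry.\<close>
    define Z where "Z i j = (if j < i then Y j else X j)" for i j
    have "\<bar>w (Z i) - w X\<bar> \<le> real i * (R ^ k * e)" if "i \<le> k" for i
      using that
    proof (induction i)
      case 0
      have "Z 0 = X" by (simp add: Z_def fun_eq_iff)
      then show ?case by simp
    next
      case (Suc i)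
      then have i: "i < k" by simp
      have 1: "Z (Suc i) = (Z i)(i := Y i)" "Z i = (Z i)(i := X i)" by (auto simp: Z_def fun_eq_iff)
      have "w (Z (Suc i)) - w (Z i) = w ((Z i)(i := Y i - X i))"
        using linear_diff[OF alt_form_linear[OF w i], of "Z i" "Y i" "X i"] 1 by metis
      also have "\<bar>\<dots>\<bar> \<le> (\<Prod>j<k. norm (((Z i)(i := Y i - X i)) j))" by (rule alt_form_bound[OF w])
      also have "\<dots> = norm (Y i - X i) * (\<Prod>j\<in>{..<k} - {i}. norm (Z i j))"
        using i by (subst prod.remove[of _ i]) (auto intro!: prod.cong)
      also have "\<dots> \<le> e * (\<Prod>j\<in>{..<k} - {i}. R)"
      proof (intro mult_mono prod_mono)
        fix j assume "j \<in> {..<k} - {i}"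
        then show "0 \<le> norm (Z i j) \<and> norm (Z i j) \<le> R" using YR[of j] XR[of j] by (auto simp: Z_def)
      qed (use Y[OF i] e in \<open>auto intro: prod_nonneg\<close>)
      also have "\<dots> \<le> e * R ^ k" using i e R1 by (intro mult_left_mono) (auto intro: power_increasing)
      finally have "\<bar>w (Z (Suc i)) - w (Z i)\<bar> \<le> R ^ k * e" by (simp add: mult.commute)
      moreover have "\<bar>w (Z i) - w X\<bar> \<le> real i * (R ^ k * e)" using Suc by simp
      ultimately have "\<bar>w (Z (Suc i)) - w X\<bar> \<le> real i * (R ^ k * e) + R ^ k * e" by linarith
      then show ?case by (simp add: algebra_simps)
    qed
    from this[of k] have "\<bar>w (Z k) - w X\<bar> < \<eta>" using ek by (simp add: mult.assoc)
    moreover have "w (Z k) = w Y" by (rule alt_form_local[OF w]) (simp add: Z_def)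
    ultimately show "\<bar>w Y - w X\<bar> < \<eta>" by simp
  qed
qed

lemma sot_open_wedge_norm: "sot_open {T. a < wedge_norm k T}"
  unfolding sot_open_def
proof
  fix T :: "'a \<Rightarrow>\<^sub>L 'b" assume "T \<in> {T. a < wedge_norm k T}"
  then obtain w and x :: "nat \<Rightarrow> 'a" where w: "alt_form k w" and x: "\<And>j. j < k \<Longrightarrow> norm (x j) \<le> 1"
    and a: "a < \<bar>w (\<lambda>i. T (x i))\<bar>"
    using wedge_norm_less[of a k T] by auto
  obtain e where e: "e > 0"
    "\<And>Y. (\<And>j. j < k \<Longrightarrow> norm (Y j - T (x j)) < e) \<Longrightarrow> \<bar>w Y - w (\<lambda>i. T (x i))\<bar> < \<bar>w (\<lambda>i. T (x i))\<bar> - a"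
    using alt_form_continuous[OF w, of "\<bar>w (\<lambda>i. T (x i))\<bar> - a" "\<lambda>i. T (x i)"] a by auto
  have "a < wedge_norm k T'" if T': "\<forall>y\<in>x ` {..<k}. norm (T' y - T y) < e" for T' :: "'a \<Rightarrow>\<^sub>L 'b"
  proof -
    have "\<bar>w (\<lambda>i. T' (x i)) - w (\<lambda>i. T (x i))\<bar> < \<bar>w (\<lambda>i. T (x i))\<bar> - a"
      by (rule e(2)) (use T' in auto)
    then have "a < \<bar>w (\<lambda>i. T' (x i))\<bar>" by linarith
    also have "\<dots> \<le> wedge_norm k T'" by (rule wedge_norm_upper[OF w x])
    finally show ?thesis .
  qed
  then show "\<exists>F e. finite F \<and> 0 < e \<and>
      (\<forall>T'. (\<forall>x\<in>F. norm (blinfun_apply T' x - T x) < e) \<longrightarrow> T' \<in> {T. a < wedge_norm k T})"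
    using e(1) by (intro exI[of _ "x ` {..<k}"] exI[of _ e]) auto
qed

lemma wedge_norm_measurable:
  fixes A :: "'w \<Rightarrow> 'a::real_normed_vector \<Rightarrow>\<^sub>L 'a"
  assumes "strongly_measurable M A" "separable_space (euclidean :: 'a topology)"
  shows "(\<lambda>\<omega>. wedge_norm k (A \<omega>)) \<in> borel_measurable M"
  unfolding borel_measurable_iff_greater
  using sot_open_measurable[OF assms sot_open_wedge_norm] by auto

lemma sot_open_not_covered:
  fixes D :: "'a::real_normed_vector set" and C :: "'b::real_normed_vector set"
  assumes C: "finite C"
  shows "sot_open {T. \<not> blinfun_apply T ` D \<subseteq> (\<Union>c\<in>C. cball c r)}"
  unfolding sot_open_def
proof
  fix T :: "'a \<Rightarrow>\<^sub>L 'b" assume "T \<in> {T. \<not> blinfun_apply T ` D \<subseteq> (\<Union>c\<in>C. cball c r)}"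
  then obtain x where x: "x \<in> D" "\<And>c. c \<in> C \<Longrightarrow> r < norm (T x - c)"
    by (auto simp: dist_norm norm_minus_commute not_le) (metis norm_minus_commute not_le)
  define e where "e = Min (insert 1 ((\<lambda>c. norm (T x - c) - r) ` C))"
  have e: "e > 0" using x C by (auto simp: e_def)
  have ec: "e \<le> norm (T x - c) - r" if "c \<in> C" for c unfolding e_def using C that by (intro Min_le) auto
  have "T' \<in> {T. \<not> blinfun_apply T ` D \<subseteq> (\<Union>c\<in>C. cball c r)}" if T': "norm (T' x - T x) < e" for T' :: "'a \<Rightarrow>\<^sub>L 'b"
  proof -
    have "r < norm (T' x - c)" if "c \<in> C" for c
      using ec[OF that] T' norm_triangle_ineq2[of "T x - c" "T x - T' x"]
      by (simp add: norm_minus_commute)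
    then have "T' x \<notin> (\<Union>c\<in>C. cball c r)" by (force simp: dist_norm norm_minus_commute not_le)
    then show ?thesis using x(1) by blast
  qed
  then show "\<exists>F e. finite F \<and> 0 < e \<and>
      (\<forall>T'. (\<forall>x\<in>F. norm (blinfun_apply T' x - T x) < e) \<longrightarrow> T' \<in> {T. \<not> blinfun_apply T ` D \<subseteq> (\<Union>c\<in>C. cball c r)})"
    using e by (intro exI[of _ "{x}"] exI[of _ e]) auto
qed

lemma entropy_gauge_less_iff_dense:
  fixes T :: "'a::real_normed_vector \<Rightarrow>\<^sub>L 'b::real_normed_vector"
  assumes Q: "closure Q = UNIV"
  shows "entropy_gauge s T < t \<longleftrightarrow> (\<exists>K\<in>{0<..}. \<exists>r\<in>{r\<in>\<rat>. 0 < r \<and> r * real K powr s < t}.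
    \<exists>C\<in>{C. finite C \<and> C \<subseteq> Q \<and> card C \<le> K}. T ` cball 0 1 \<subseteq> (\<Union>c\<in>C. cball c r))" (is "_ \<longleftrightarrow> ?R")
proof
  assume ?R
  then obtain K r C where "0 < K" "0 < r" "r * real K powr s < t" "finite C" "card C \<le> K"
      "T ` cball 0 1 \<subseteq> (\<Union>c\<in>C. cball c r)" by auto
  then show "entropy_gauge s T < t" unfolding entropy_gauge_less_iff ball_covered_def by blast
next
  assume "entropy_gauge s T < t"
  then obtain r K where r: "0 < r" "0 < K" "ball_covered T K r" "r * real K powr s < t"
    by (auto simp: entropy_gauge_less_iff)
  define P where "P = real K powr s"
  have P: "P > 0" using r(2) by (simp add: P_def)
  have "r < t / P" using r(4) P by (simp add: P_def field_simps)
  then obtain r' where r': "r' \<in> \<rat>" "r < r'" "r' < t / P" using Rats_dense_in_real by blast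
  have r't: "r' * real K powr s < t" using r'(3) P by (simp add: P_def field_simps)
  obtain C where C: "finite C" "card C \<le> K" "T ` cball 0 1 \<subseteq> (\<Union>c\<in>C. cball c r)"
    using r(3) unfolding ball_covered_def by blast
  have "\<exists>q\<in>Q. norm (c - q) < r' - r" for c using r'(2) by (intro dense_approx[OF Q]) simp
  then obtain q where q: "\<And>c. q c \<in> Q" "\<And>c. norm (c - q c) < r' - r" by metis
  have sub: "cball c r \<subseteq> cball (q c) r'" for c
  proof
    fix y assume "y \<in> cball c r"
    then show "y \<in> cball (q c) r'"
      using dist_triangle[of "q c" y c] q(2)[of c] by (simp add: dist_norm norm_minus_commute)
  qed
  have "(\<Union>c\<in>C. cball c r) \<subseteq> (\<Union>c\<in>q ` C. cball c r')"
    using UN_mono[OF order_refl[of C] sub] by simp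
  with C(3) have "T ` cball 0 1 \<subseteq> (\<Union>c\<in>q ` C. cball c r')" by (rule order_trans)
  moreover have "card (q ` C) \<le> K" using card_image_le[OF C(1), of q] C(2) by simp
  moreover have "q ` C \<subseteq> Q" "finite (q ` C)" using q(1) C(1) by auto
  moreover have "r' \<in> {r\<in>\<rat>. 0 < r \<and> r * real K powr s < t}" using r'(1,2) r(1) r't by auto
  ultimately show ?R using r(2) by (intro bexI[of _ K] bexI[of _ r'] bexI[of _ "q ` C"]) auto
qed

text \<open>
  By density only countably many coverings matter, and the operators that violate a given
  covering form an open set.
\<close>

lemma entropy_gauge_measurable:
  fixes A :: "'w \<Rightarrow> 'a::real_normed_vector \<Rightarrow>\<^sub>L 'a"
  assumes A: "strongly_measurable M A" and sep: "separable_space (euclidean :: 'a topology)"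
  shows "(\<lambda>\<omega>. entropy_gauge s (A \<omega>)) \<in> borel_measurable M"
  unfolding borel_measurable_iff_less
proof
  fix t
  obtain Q :: "'a set" where Q: "countable Q" "closure Q = UNIV"
    using separable_countable_dense[OF sep] by blast
  have 1: "{\<omega> \<in> space M. A \<omega> ` cball 0 1 \<subseteq> (\<Union>c\<in>C. cball c r)} \<in> sets M" if "finite C" for C r
  proof -
    have "{\<omega> \<in> space M. A \<omega> ` cball 0 1 \<subseteq> (\<Union>c\<in>C. cball c r)} =
        space M - {\<omega> \<in> space M. A \<omega> \<in> {T. \<not> blinfun_apply T ` cball 0 1 \<subseteq> (\<Union>c\<in>C. cball c r)}}" by auto
    then show ?thesis using sot_open_measurable[OF A sep sot_open_not_covered[OF that]] by simp
  qed
  have c: "countable {C. finite C \<and> C \<subseteq> Q \<and> card C \<le> K}" for K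
    by (rule countable_subset[OF _ countable_Collect_finite_subset[OF Q(1)]]) auto
  have c': "countable {r\<in>\<rat>. 0 < r \<and> r * real K powr s < t}" for K
    by (rule countable_subset[OF _ countable_rat]) auto
  show "{\<omega> \<in> space M. entropy_gauge s (A \<omega>) < t} \<in> sets M"
    unfolding entropy_gauge_less_iff_dense[OF Q(2)]
    by (intro sets.sets_Collect_countable_Ex' c c' 1) auto
qed

section \<open>Exponential rates\<close>

abbreviation rate :: "(nat \<Rightarrow> real) \<Rightarrow> nat \<Rightarrow> ereal" where
  "rate a \<equiv> \<lambda>n. ereal (1 / real n) * elog (a n)"

lemma rate_le_iff:
  assumes n: "n > 0"
  shows "rate a n \<le> ereal t \<longleftrightarrow> a n \<le> exp (real n * t)"
proof (cases "a n \<le> 0")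
  case True
  then show ?thesis using n order_trans[OF True, of "exp (real n * t)"] by (simp add: elog_def)
next
  case False
  then have "rate a n \<le> ereal t \<longleftrightarrow> ln (a n) \<le> real n * t"
    using n by (simp add: elog_def field_simps)
  also have "\<dots> \<longleftrightarrow> a n \<le> exp (real n * t)" using False
    by (metis exp_le_cancel_iff exp_ln not_le)
  finally show ?thesis .
qed

lemma ereal_dense_real:
  assumes "(x::ereal) < y"
  shows "\<exists>s t. x < ereal s \<and> s < t \<and> ereal t < y"
proof -
  obtain t where t: "x < ereal t" "ereal t < y" using ereal_dense2[OF assms] by blast
  obtain s where "x < ereal s" "ereal s < ereal t" using ereal_dense2[OF t(1)] by blast
  with t show ?thesis by auto
qed

text \<open>
  Comparison with exponentials avoids logarithms of \<open>0\<close> and arithmetic in \<open>ereal\<close>.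
\<close>

lemma rate_tendsto_iff:
  "rate a \<longlonglongrightarrow> c \<longleftrightarrow>
     (\<forall>t. c < ereal t \<longrightarrow> (\<forall>\<^sub>F n in sequentially. a n \<le> exp (real n * t))) \<and>
     (\<forall>t. ereal t < c \<longrightarrow> (\<forall>\<^sub>F n in sequentially. exp (real n * t) < a n))" (is "_ \<longleftrightarrow> ?U \<and> ?L")
proof
  assume lim: "rate a \<longlonglongrightarrow> c"
  show "?U \<and> ?L"
  proof (intro conjI allI impI)
    fix t assume "c < ereal t"
    then have "\<forall>\<^sub>F n in sequentially. rate a n < ereal t" using lim by (intro order_tendstoD(2))
    then show "\<forall>\<^sub>F n in sequentially. a n \<le> exp (real n * t)"
      using eventually_gt_at_top[of 0]
    proof eventually_elim
      case (elim n)
      then show ?case using rate_le_iff[of n a t] by (simp add: less_imp_le)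
    qed
  next
    fix t assume "ereal t < c"
    then have "\<forall>\<^sub>F n in sequentially. ereal t < rate a n" using lim by (intro order_tendstoD(1))
    then show "\<forall>\<^sub>F n in sequentially. exp (real n * t) < a n"
      using eventually_gt_at_top[of 0]
    proof eventually_elim
      case (elim n)
      then have "\<not> rate a n \<le> ereal t" by simp
      then show ?case using elim rate_le_iff[of n a t] by simp
    qed
  qed
next
  assume UL: "?U \<and> ?L"
  show "rate a \<longlonglongrightarrow> c"
  proof (rule order_tendstoI)
    fix y assume "y < c"
    then obtain t where t: "y < ereal t" "ereal t < c" using ereal_dense2 by blast
    then have "\<forall>\<^sub>F n in sequentially. exp (real n * t) < a n" using UL by blast
    then show "\<forall>\<^sub>F n in sequentially. y < rate a n"
      using eventually_gt_at_top[of 0]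
    proof eventually_elim
      case (elim n)
      then have "\<not> rate a n \<le> ereal t" using rate_le_iff[of n a t] by simp
      then show ?case using t by simp
    qed
  next
    fix y assume "c < y"
    then obtain t where t: "c < ereal t" "ereal t < y" using ereal_dense2 by blast
    then have "\<forall>\<^sub>F n in sequentially. a n \<le> exp (real n * t)" using UL by blast
    then show "\<forall>\<^sub>F n in sequentially. rate a n < y"
      using eventually_gt_at_top[of 0]
    proof eventually_elim
      case (elim n)
      then have "rate a n \<le> ereal t" using rate_le_iff[of n a t] by simp
      then show ?case using t(2) by (rule le_less_trans)
    qed
  qed
qed

lemma eventually_absorb:
  assumes "s < t"
  shows "\<forall>\<^sub>F n in sequentially. C * exp (real n * s) \<le> exp (real n * t)"
proof -
  have "\<forall>\<^sub>F n in sequentially. nat \<lceil>ln (max C 1) / (t - s)\<rceil> \<le> n" by (rule eventually_ge_at_top)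
  then show ?thesis
  proof eventually_elim
    case (elim n)
    then have "ln (max C 1) / (t - s) \<le> real n" by linarith
    then have "ln (max C 1) \<le> real n * (t - s)" using assms by (simp add: field_simps)
    then have "exp (ln (max C 1)) \<le> exp (real n * (t - s))" by (simp only: exp_le_cancel_iff)
    then have "C \<le> exp (real n * (t - s))" by simp
    then have "C * exp (real n * s) \<le> exp (real n * (t - s)) * exp (real n * s)"
      by (rule mult_right_mono) simp
    also have "\<dots> = exp (real n * t)" by (simp add: exp_add[symmetric] algebra_simps)
    finally show ?case .
  qed
qed

lemma eventually_const_mult_le:
  assumes "s < t" "C > 0" and ab: "\<And>n. a n \<le> C * b n"
    and b: "\<forall>\<^sub>F n in sequentially. b n \<le> exp (real n * s)"
  shows "\<forall>\<^sub>F n in sequentially. a n \<le> exp (real n * t)"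
  using b eventually_absorb[OF assms(1), of C]
proof eventually_elim
  case (elim n)
  have "a n \<le> C * b n" by (rule ab)
  also have "\<dots> \<le> C * exp (real n * s)" using elim assms(2) by simp
  finally show ?case using elim by simp
qed

lemma rate_limit_le:
  assumes a: "rate a \<longlonglongrightarrow> \<alpha>" and b: "\<And>t. \<beta> < ereal t \<Longrightarrow> \<forall>\<^sub>F n in sequentially. b n \<le> exp (real n * t)"
    and ab: "\<And>n. a n \<le> C * b n" and C: "C > 0"
  shows "\<alpha> \<le> \<beta>"
proof (rule ccontr)
  assume "\<not> \<alpha> \<le> \<beta>"
  then obtain s t where st: "\<beta> < ereal s" "s < t" "ereal t < \<alpha>" using ereal_dense_real[of \<beta> \<alpha>] by (auto simp: not_le)
  have "\<forall>\<^sub>F n in sequentially. a n \<le> exp (real n * t)"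
    using eventually_const_mult_le[OF st(2) C ab b[OF st(1)]] .
  moreover have "\<forall>\<^sub>F n in sequentially. exp (real n * t) < a n"
    using a st(3) by (simp add: rate_tendsto_iff)
  ultimately have "\<forall>\<^sub>F n in sequentially. False" by eventually_elim simp
  then show False by simp
qed

lemma rate_limit_mono:
  assumes "rate a \<longlonglongrightarrow> \<alpha>" "rate b \<longlonglongrightarrow> \<beta>" "\<And>n. a n \<le> C * b n" "C > 0"
  shows "\<alpha> \<le> \<beta>"
proof (rule rate_limit_le[OF assms(1) _ assms(3,4)])
  show "\<forall>\<^sub>F n in sequentially. b n \<le> exp (real n * t)" if "\<beta> < ereal t" for t
    using assms(2) that unfolding rate_tendsto_iff by blast
qed

lemma rate_quotient:
  assumes a: "rate a \<longlonglongrightarrow> \<alpha>" and b: "rate b \<longlonglongrightarrow> ereal \<beta>" and C: "C > 0"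
    and 1: "\<And>n. r n * b n \<le> C * a n" and 2: "\<And>n. a n \<le> C * (r n * b n)"
    and r0: "\<And>n. 0 \<le> r n" and b0: "\<And>n. 0 \<le> b n"
  shows "rate r \<longlonglongrightarrow> \<alpha> - ereal \<beta>"
  unfolding rate_tendsto_iff
proof (intro conjI allI impI)
  fix t assume "\<alpha> - ereal \<beta> < ereal t"
  then have "\<alpha> < ereal (t + \<beta>)" by (cases \<alpha>) auto
  from ereal_dense_real[OF this] obtain s s' where s: "\<alpha> < ereal s" "s < s'" "s' < t + \<beta>" by auto
  have "ereal (s' - t) < ereal \<beta>" using s by simp
  then have "\<forall>\<^sub>F n in sequentially. exp (real n * (s' - t)) < b n"
    using b unfolding rate_tendsto_iff by blast
  moreover have "\<forall>\<^sub>F n in sequentially. a n \<le> exp (real n * s)"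
    using a s(1) unfolding rate_tendsto_iff by blast
  moreover have "\<forall>\<^sub>F n in sequentially. C * exp (real n * s) \<le> exp (real n * s')"
    by (rule eventually_absorb[OF s(2)])
  ultimately show "\<forall>\<^sub>F n in sequentially. r n \<le> exp (real n * t)"
  proof eventually_elim
    case (elim n)
    have "r n * exp (real n * (s' - t)) \<le> r n * b n" using elim r0 by (intro mult_left_mono) auto
    also have "\<dots> \<le> C * a n" by (rule 1)
    also have "\<dots> \<le> C * exp (real n * s)" using elim C by simp
    also have "\<dots> \<le> exp (real n * s')" using elim by simp
    also have "\<dots> = exp (real n * t) * exp (real n * (s' - t))"
      by (simp add: exp_add[symmetric] algebra_simps)
    finally show ?case by simp
  qed
next
  fix t assume "ereal t < \<alpha> - ereal \<beta>"
  then have "ereal (t + \<beta>) < \<alpha>" by (cases \<alpha>) auto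
  from ereal_dense_real[OF this] obtain s' s where s: "t + \<beta> < s'" "s' < s" "ereal s < \<alpha>" by auto
  have "ereal \<beta> < ereal (s' - t)" using s by simp
  then have "\<forall>\<^sub>F n in sequentially. b n \<le> exp (real n * (s' - t))"
    using b unfolding rate_tendsto_iff by blast
  moreover have "\<forall>\<^sub>F n in sequentially. exp (real n * s) < a n"
    using a s(3) unfolding rate_tendsto_iff by blast
  moreover have "\<forall>\<^sub>F n in sequentially. C * exp (real n * s') \<le> exp (real n * s)"
    by (rule eventually_absorb[OF s(2)])
  ultimately show "\<forall>\<^sub>F n in sequentially. exp (real n * t) < r n"
  proof eventually_elim
    case (elim n)
    have "C * (exp (real n * t) * exp (real n * (s' - t))) = C * exp (real n * s')"
      by (simp add: exp_add[symmetric] algebra_simps)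
    also have "\<dots> \<le> exp (real n * s)" using elim by simp
    also have "\<dots> < a n" using elim by simp
    also have "\<dots> \<le> C * (r n * b n)" by (rule 2)
    also have "\<dots> \<le> C * (r n * exp (real n * (s' - t)))"
      using elim r0 C by (intro mult_left_mono) auto
    finally show ?case using C by simp
  qed
qed

section \<open>Ergodic sums\<close>

locale ergodic_system = prob_space M for M :: "'w measure" +
  fixes \<sigma> :: "'w \<Rightarrow> 'w"
  assumes measurable_map: "\<sigma> \<in> M \<rightarrow>\<^sub>M M" and preserving: "distr M M \<sigma> = M" and ergodic: "ergodic M \<sigma>"
begin

lemma iter_measurable [measurable]: "\<sigma> ^^ n \<in> M \<rightarrow>\<^sub>M M"
proof (induction n)
  case (Suc n)
  show ?case using measurable_comp[OF Suc measurable_map] unfolding funpow.simps .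
qed (simp add: id_def)

lemma iter_space: "\<omega> \<in> space M \<Longrightarrow> (\<sigma> ^^ n) \<omega> \<in> space M"
  using measurable_space[OF iter_measurable] .

lemma iter_preserving: "distr M M (\<sigma> ^^ n) = M"
proof (induction n)
  case (Suc n)
  have "distr M M (\<sigma> ^^ Suc n) = distr (distr M M (\<sigma> ^^ n)) M \<sigma>"
    using distr_distr[OF measurable_map iter_measurable, of n] unfolding funpow.simps by (rule sym)
  then show ?case by (simp only: Suc preserving)
qed (simp add: id_def distr_id)

lemma integrable_iter:
  fixes h :: "'w \<Rightarrow> real"
  assumes "integrable M h"
  shows "integrable M (\<lambda>\<omega>. h ((\<sigma> ^^ n) \<omega>))" "(\<integral>\<omega>. h ((\<sigma> ^^ n) \<omega>) \<partial>M) = (\<integral>\<omega>. h \<omega> \<partial>M)"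
proof -
  have "integrable (distr M M (\<sigma> ^^ n)) h" using assms by (simp add: iter_preserving)
  then show "integrable M (\<lambda>\<omega>. h ((\<sigma> ^^ n) \<omega>))"
    by (rule integrable_distr[OF iter_measurable])
  show "(\<integral>\<omega>. h ((\<sigma> ^^ n) \<omega>) \<partial>M) = (\<integral>\<omega>. h \<omega> \<partial>M)"
    using integral_distr[OF iter_measurable, of h n] assms by (simp add: iter_preserving borel_measurable_integrable)
qed

text \<open>
  The preimages of \<open>A\<close> increase and have the same measure, so \<open>A\<close> agrees up to a null set with
  their union, which is exactly invariant.
\<close>

lemma zero_one_forward:
  assumes A: "A \<in> sets M" and inv: "A \<subseteq> \<sigma> -` A"
  shows "prob A = 0 \<or> prob A = 1"
proof -
  define P where "P n = (\<sigma> ^^ n) -` A \<inter> space M" for n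
  define A' where "A' = (\<Union>n. P n)"
  have P: "P n \<in> sets M" for n unfolding P_def using A by measurable
  have probP: "prob (P n) = prob A" for n
    using measure_distr[OF iter_measurable A, of n] by (simp add: iter_preserving P_def)
  have "incseq P"
    by (rule incseq_SucI) (use inv in \<open>auto simp: P_def\<close>)
  then have "(\<lambda>n. prob (P n)) \<longlonglongrightarrow> prob A'"
    unfolding A'_def using P by (intro finite_Lim_measure_incseq) auto
  then have "prob A' = prob A" by (simp add: probP LIMSEQ_const_iff)
  moreover have "\<sigma> -` A' \<inter> space M = A'"
  proof -
    have "\<sigma> -` A' \<inter> space M = (\<Union>n. P (Suc n))"
      using measurable_space[OF measurable_map] by (auto simp: A'_def P_def funpow_swap1)
    also have "\<dots> = A'"
    proof
      show "(\<Union>n. P (Suc n)) \<subseteq> A'" by (auto simp: A'_def)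
      show "A' \<subseteq> (\<Union>n. P (Suc n))" using \<open>incseq P\<close> by (force simp: A'_def incseq_Suc_iff)
    qed
    finally show ?thesis .
  qed
  moreover have "A' \<in> sets M" unfolding A'_def using P by auto
  ultimately show ?thesis using ergodic unfolding ergodic_def by metis
qed

lemma zero_one_backward:
  assumes A: "A \<in> sets M" and inv: "\<sigma> -` A \<inter> space M \<subseteq> A"
  shows "prob A = 0 \<or> prob A = 1"
proof -
  have "prob (space M - A) = 0 \<or> prob (space M - A) = 1"
    using A inv measurable_space[OF measurable_map] by (intro zero_one_forward) auto
  then show ?thesis using prob_compl[OF A] by auto
qed

definition esum :: "('w \<Rightarrow> real) \<Rightarrow> nat \<Rightarrow> 'w \<Rightarrow> real" where
  "esum h n \<omega> = (\<Sum>i<n. h ((\<sigma> ^^ i) \<omega>))"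

lemma esum_add: "esum h (n + m) \<omega> = esum h n \<omega> + esum h m ((\<sigma> ^^ n) \<omega>)"
proof (induction m)
  case (Suc m)
  have "(\<sigma> ^^ m) ((\<sigma> ^^ n) \<omega>) = (\<sigma> ^^ (n + m)) \<omega>" by (metis add.commute comp_apply funpow_add)
  then show ?case using Suc by (simp add: esum_def)
qed (simp add: esum_def)

lemma esum_1 [simp]: "esum h (Suc 0) \<omega> = h \<omega>"
  by (simp add: esum_def)

lemma esum_plus: "esum (\<lambda>x. f x + g x) n \<omega> = esum f n \<omega> + esum g n \<omega>"
  by (simp add: esum_def sum.distrib)

lemma esum_nonneg: "(\<And>x. x \<in> space M \<Longrightarrow> 0 \<le> h x) \<Longrightarrow> \<omega> \<in> space M \<Longrightarrow> 0 \<le> esum h n \<omega>"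
  by (auto simp: esum_def iter_space intro: sum_nonneg)

lemma esum_mono_count:
  assumes "\<And>x. x \<in> space M \<Longrightarrow> 0 \<le> h x" "\<omega> \<in> space M" "n \<le> m"
  shows "esum h n \<omega> \<le> esum h m \<omega>"
proof -
  have "0 \<le> esum h (m - n) ((\<sigma> ^^ n) \<omega>)" using assms by (intro esum_nonneg iter_space)
  then show ?thesis using esum_add[of h n "m - n" \<omega>] assms(3) by simp
qed

lemma esum_measurable [measurable]:
  assumes [measurable]: "h \<in> borel_measurable M"
  shows "esum h n \<in> borel_measurable M"
  unfolding esum_def[abs_def] by measurable

lemma integrable_esum:
  assumes "integrable M h"
  shows "integrable M (esum h n)" "(\<integral>\<omega>. esum h n \<omega> \<partial>M) = real n * (\<integral>\<omega>. h \<omega> \<partial>M)"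
  unfolding esum_def[abs_def] using integrable_iter[OF assms] by auto

text \<open>
  Follow the orbit. At a point of \<open>E\<close> jump over a stretch of length at most \<open>N\<close> on which the average of
  \<open>h\<close> exceeds \<open>c\<close>; elsewhere make one step, which does not count on the left. The last stretch may
  overshoot by up to \<open>N\<close> steps.
\<close>

lemma maximal_pointwise:
  assumes h: "\<And>x. x \<in> space M \<Longrightarrow> 0 \<le> h x" and "c > 0"
    and E: "\<And>x. x \<in> E \<Longrightarrow> \<exists>n\<in>{1..N}. c * real n < esum h n x"
    and "\<omega> \<in> space M"
  shows "c * esum (indicator E) m \<omega> \<le> esum h (m + N) \<omega>"
  using \<open>\<omega> \<in> space M\<close>
proof (induction m arbitrary: \<omega> rule: less_induct)
  case (less m)
  have ind: "esum (indicator E) n x \<le> real n" for n x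
    unfolding esum_def using sum_mono[of "{..<n}" "\<lambda>i. indicator E ((\<sigma> ^^ i) x)" "\<lambda>_. 1::real"]
    by (simp add: indicator_def)
  show ?case
  proof (cases "m = 0")
    case True
    then show ?thesis using esum_nonneg[OF h less.prems] by (simp add: esum_def)
  next
    case False
    have "\<exists>n>0. n \<le> m \<and> c * esum (indicator E) n \<omega> \<le> esum h n \<omega> \<or> c * esum (indicator E) m \<omega> \<le> esum h (m + N) \<omega>"
    proof (cases "\<omega> \<in> E")
      case True
      obtain n where n: "n \<in> {1..N}" "c * real n < esum h n \<omega>" using E[OF True] by blast
      show ?thesis
      proof (cases "n \<le> m")
        case True
        have "c * esum (indicator E) n \<omega> \<le> c * real n" using ind \<open>c > 0\<close> by simp
        then show ?thesis using n True by (intro exI[of _ n]) auto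
      next
        case False
        have "c * esum (indicator E) m \<omega> \<le> c * real n"
          using ind[of m \<omega>] False \<open>c > 0\<close> by (intro mult_left_mono) auto
        also have "\<dots> \<le> esum h n \<omega>" using n by simp
        also have "\<dots> \<le> esum h (m + N) \<omega>" using n h less.prems by (intro esum_mono_count) auto
        finally show ?thesis by auto
      qed
    next
      case False
      then show ?thesis using h[OF less.prems] \<open>m \<noteq> 0\<close> by (intro exI[of _ 1]) auto
    qed
    then consider n where "n > 0" "n \<le> m" "c * esum (indicator E) n \<omega> \<le> esum h n \<omega>"
      | "c * esum (indicator E) m \<omega> \<le> esum h (m + N) \<omega>" by blast
    then show ?thesis
    proof cases
      case 1
      have "c * esum (indicator E) (m - n) ((\<sigma> ^^ n) \<omega>) \<le> esum h (m - n + N) ((\<sigma> ^^ n) \<omega>)"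
        using 1 less.prems by (intro less.IH iter_space) auto
      moreover have "esum (indicator E) m \<omega> = esum (indicator E) n \<omega> + esum (indicator E) (m - n) ((\<sigma> ^^ n) \<omega>)"
        using esum_add[of "indicator E" n "m - n" \<omega>] 1 by simp
      moreover have "esum h (m + N) \<omega> = esum h n \<omega> + esum h (m - n + N) ((\<sigma> ^^ n) \<omega>)"
        using esum_add[of h n "m - n + N" \<omega>] 1 by simp
      ultimately show ?thesis using 1(3) by (simp add: algebra_simps)
    qed
  qed
qed

text \<open>
  Integrate \<open>maximal_pointwise\<close>, divide by \<open>m\<close> and let \<open>m\<close>, then \<open>N\<close>, tend to infinity.
\<close>

lemma maximal_inequality:
  assumes h: "integrable M h" "\<And>x. x \<in> space M \<Longrightarrow> 0 \<le> h x" and l: "c > 0"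
  shows "c * prob {\<omega> \<in> space M. \<exists>n>0. c * real n < esum h n \<omega>} \<le> (\<integral>\<omega>. h \<omega> \<partial>M)"
proof -
  have hm [measurable]: "h \<in> borel_measurable M" using h(1) by simp
  define E where "E N = {\<omega> \<in> space M. \<exists>n\<in>{1..N}. c * real n < esum h n \<omega>}" for N :: nat
  define H where "H = (\<integral>\<omega>. h \<omega> \<partial>M)"
  have Em [measurable]: "E N \<in> sets M" for N unfolding E_def by measurable
  have H0: "H \<ge> 0" unfolding H_def using h by (intro Bochner_Integration.integral_nonneg) auto
  have fin: "c * prob (E N) \<le> H" for N
  proof (rule ccontr)
    assume neg: "\<not> c * prob (E N) \<le> H"
    obtain m :: nat where m: "real N * H / (c * prob (E N) - H) < real m" using reals_Archimedean2 by blast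
    have iE: "integrable M (indicator (E N) :: 'w \<Rightarrow> real)" by (simp add: emeasure_eq_measure)
    have "(\<integral>\<omega>. c * esum (indicator (E N)) m \<omega> \<partial>M) \<le> (\<integral>\<omega>. esum h (m + N) \<omega> \<partial>M)"
      using integrable_esum(1)[OF iE] integrable_esum(1)[OF h(1)]
      by (intro integral_mono maximal_pointwise h l) (auto simp: E_def)
    then have "c * (real m * prob (E N)) \<le> real (m + N) * H"
      using integrable_esum(2)[OF iE] integrable_esum(2)[OF h(1)] by (simp add: H_def)
    then have "real m * (c * prob (E N) - H) \<le> real N * H" by (simp add: algebra_simps)
    then show False using m neg by (simp add: field_simps)
  qed
  have "incseq E" by (rule incseq_SucI) (auto simp: E_def)
  then have "(\<lambda>N. prob (E N)) \<longlonglongrightarrow> prob (\<Union>N. E N)" by (intro finite_Lim_measure_incseq) auto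
  then have "(\<lambda>N. c * prob (E N)) \<longlonglongrightarrow> c * prob (\<Union>N. E N)" by (rule tendsto_mult_left)
  then have "c * prob (\<Union>N. E N) \<le> H" by (rule LIMSEQ_le_const2) (use fin in auto)
  moreover have "(\<Union>N. E N) = {\<omega> \<in> space M. \<exists>n>0. c * real n < esum h n \<omega>}"
  proof (intro set_eqI iffI)
    fix \<omega> assume "\<omega> \<in> {\<omega> \<in> space M. \<exists>n>0. c * real n < esum h n \<omega>}"
    then obtain n where "\<omega> \<in> space M" "n > 0" "c * real n < esum h n \<omega>" by blast
    then have "\<omega> \<in> E n" unfolding E_def by (intro CollectI conjI bexI[of _ n]) auto
    then show "\<omega> \<in> (\<Union>N. E N)" by blast
  next
    fix \<omega> assume "\<omega> \<in> (\<Union>N. E N)"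
    then obtain N n where "\<omega> \<in> space M" "n \<in> {1..N}" "c * real n < esum h n \<omega>"
      unfolding E_def by blast
    then show "\<omega> \<in> {\<omega> \<in> space M. \<exists>n>0. c * real n < esum h n \<omega>}"
      by (intro CollectI conjI exI[of _ n]) auto
  qed
  ultimately show ?thesis by (simp add: H_def)
qed

lemma AE_prob_zero: "A \<in> sets M \<Longrightarrow> prob A = 0 \<Longrightarrow> AE \<omega> in M. \<omega> \<notin> A"
  by (intro AE_not_in) (simp add: null_sets_def emeasure_eq_measure)

text \<open>
  The upper half of Birkhoff's theorem. For a number \<open>b\<close> between the integral and \<open>c\<close>, the set where the
  averages exceed some \<open>q > b\<close> infinitely often is forward invariant, and by the maximal inequality it
  does not have full measure.
\<close>

lemma ergodic_sum_upper:
  assumes h: "integrable M h" "\<And>x. x \<in> space M \<Longrightarrow> 0 \<le> h x" and l: "(\<integral>\<omega>. h \<omega> \<partial>M) < c"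
  shows "AE \<omega> in M. \<forall>\<^sub>F n in sequentially. esum h n \<omega> \<le> c * real n"
proof -
  have hm [measurable]: "h \<in> borel_measurable M" using h(1) by simp
  obtain b where l0: "(\<integral>\<omega>. h \<omega> \<partial>M) < b" "b < c" using dense[OF l] by blast
  have "0 \<le> (\<integral>\<omega>. h \<omega> \<partial>M)" using h by (intro Bochner_Integration.integral_nonneg) auto
  then have pos: "b > 0" using l0 by simp
  define A where "A = {\<omega> \<in> space M. \<exists>q\<in>\<rat> \<inter> {b<..}. \<forall>m. \<exists>n>m. q * real n < esum h n \<omega>}"
  have Am: "A \<in> sets M" unfolding A_def
    by (intro sets.sets_Collect_countable_Ex' countable_Int1 countable_rat) measurable
  have "A \<subseteq> \<sigma> -` A"
  proof
    fix \<omega> assume "\<omega> \<in> A"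
    then obtain q where q: "q \<in> \<rat>" "b < q" "\<And>m. \<exists>n>m. q * real n < esum h n \<omega>" and \<omega>: "\<omega> \<in> space M"
      by (auto simp: A_def)
    obtain q' where q': "q' \<in> \<rat>" "b < q'" "q' < q" using Rats_dense_in_real[OF q(2)] by blast
    have "\<exists>n>m. q' * real n < esum h n (\<sigma> \<omega>)" for m
    proof -
      obtain k :: nat where k: "(h \<omega> - q') / (q - q') < real k" using reals_Archimedean2 by blast
      obtain n where n: "n > max (Suc m) k" "q * real n < esum h n \<omega>" using q(3) by blast
      obtain n' where n': "n = Suc n'" using n(1) by (cases n) auto
      have "esum h n \<omega> = h \<omega> + esum h n' (\<sigma> \<omega>)" using esum_add[of h 1 n' \<omega>] n' by simp
      moreover have "h \<omega> - q' < (q - q') * real n"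
      proof -
        have "(h \<omega> - q') / (q - q') < real n" using k n(1) by simp
        then show ?thesis using q'(3) by (simp add: field_simps)
      qed
      ultimately have "q' * real n' < esum h n' (\<sigma> \<omega>)" using n(2) n' by (simp add: algebra_simps)
      then show ?thesis using n(1) n' by (intro exI[of _ n']) auto
    qed
    then show "\<omega> \<in> \<sigma> -` A" using q' \<omega> measurable_space[OF measurable_map] by (auto simp: A_def)
  qed
  then have "prob A = 0 \<or> prob A = 1" using Am by (rule zero_one_forward[rotated])
  moreover have "prob A < 1"
  proof -
    define E where "E = {\<omega> \<in> space M. \<exists>n>0. b * real n < esum h n \<omega>}"
    have Em: "E \<in> sets M" unfolding E_def by measurable
    have "A \<subseteq> E"
    proof
      fix \<omega> assume "\<omega> \<in> A"
      then obtain q where q: "b < q" "\<And>m. \<exists>n>m. q * real n < esum h n \<omega>" and \<omega>: "\<omega> \<in> space M"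
        unfolding A_def by blast
      obtain n where "n > 0" "q * real n < esum h n \<omega>" using q(2)[of 0] by blast
      moreover have "b * real n \<le> q * real n" using q(1) by (intro mult_right_mono) auto
      ultimately have "b * real n < esum h n \<omega>" by linarith
      with \<open>n > 0\<close> \<omega> show "\<omega> \<in> E" unfolding E_def by blast
    qed
    then have "prob A \<le> prob E" using Em by (rule finite_measure_mono)
    then have "b * prob A \<le> b * prob E" using pos by simp
    also have "\<dots> \<le> (\<integral>\<omega>. h \<omega> \<partial>M)" unfolding E_def by (rule maximal_inequality[OF h pos])
    finally have "b * prob A < b * 1" using l0 by simp
    then show ?thesis using pos by simp
  qed
  ultimately have "prob A = 0" by simp
  then have "AE \<omega> in M. \<omega> \<notin> A" by (rule AE_prob_zero[OF Am])
  then show ?thesis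
  proof (rule AE_mp, intro AE_I2 impI)
    fix \<omega> assume \<omega>: "\<omega> \<in> space M" "\<omega> \<notin> A"
    obtain q where q: "q \<in> \<rat>" "b < q" "q < c" using Rats_dense_in_real[OF l0(2)] by blast
    then have "\<not> (\<forall>m. \<exists>n>m. q * real n < esum h n \<omega>)" using \<omega> unfolding A_def by blast
    then obtain m where m: "\<And>n. n > m \<Longrightarrow> esum h n \<omega> \<le> q * real n" using not_less by blast
    show "\<forall>\<^sub>F n in sequentially. esum h n \<omega> \<le> c * real n"
      using eventually_gt_at_top[of m]
    proof eventually_elim
      case (elim n)
      have "esum h n \<omega> \<le> q * real n" using m elim .
      also have "\<dots> \<le> c * real n" using q by (intro mult_right_mono) auto
      finally show ?case .
    qed
  qed
qed

section \<open>Submultiplicative cocycles\<close>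

text \<open>
  Submultiplicative sequences over the system in multiplicative notation: \<open>a n\<close> may vanish, which
  stands for the value \<open>-\<infinity>\<close> of the corresponding subadditive sequence.
\<close>

definition subcocycle :: "(nat \<Rightarrow> 'w \<Rightarrow> real) \<Rightarrow> ('w \<Rightarrow> real) \<Rightarrow> bool" where
  "subcocycle a u \<longleftrightarrow>
     (\<forall>\<omega>\<in>space M. \<forall>n. 0 \<le> a n \<omega>) \<and> (\<forall>\<omega>\<in>space M. a 0 \<omega> \<le> 1) \<and>
     (\<forall>\<omega>\<in>space M. \<forall>n m. a (n + m) \<omega> \<le> a n \<omega> * a m ((\<sigma> ^^ n) \<omega>)) \<and>
     (\<forall>\<omega>\<in>space M. a 1 \<omega> \<le> exp (u \<omega>)) \<and>
     integrable M u \<and> (\<forall>\<omega>\<in>space M. 0 \<le> u \<omega>) \<and> (\<forall>n. a n \<in> borel_measurable M)"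

lemma subcocycle_le_esum:
  assumes a: "subcocycle a u" and "\<omega> \<in> space M"
  shows "a n \<omega> \<le> exp (esum u n \<omega>)"
  using \<open>\<omega> \<in> space M\<close>
proof (induction n arbitrary: \<omega>)
  case 0
  then show ?case using a by (simp add: subcocycle_def esum_def)
next
  case (Suc n)
  have "a (1 + n) \<omega> \<le> a 1 \<omega> * a n ((\<sigma> ^^ 1) \<omega>)"
    using a Suc.prems unfolding subcocycle_def by blast
  also have "\<dots> \<le> exp (u \<omega>) * exp (esum u n ((\<sigma> ^^ 1) \<omega>))"
    using a Suc.prems Suc.IH[OF iter_space, of \<omega> 1] iter_space[of \<omega> 1]
    by (intro mult_mono) (auto simp: subcocycle_def)
  also have "\<dots> = exp (esum u (1 + n) \<omega>)" unfolding esum_add[of u 1 n] by (simp add: exp_add)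
  finally show ?case by simp
qed

text \<open>
  Cut the orbit greedily. At a point outside \<open>B\<close> use a stretch of length at most \<open>N\<close> with growth at most
  \<open>b\<close> per step; at a point of \<open>B\<close> make one step, whose excess over \<open>b\<close> is at most \<open>w\<close>. The last
  \<open>N\<close> steps, where a stretch might not fit, are also estimated by \<open>w\<close>.
\<close>

lemma subcocycle_greedy:
  assumes a: "subcocycle a u" and good: "\<And>x. x \<in> space M \<Longrightarrow> x \<notin> B \<Longrightarrow> \<exists>n\<in>{1..N}. a n x \<le> exp (real n * b)"
    and w: "\<And>x. w x = u x + \<bar>b\<bar>" and "\<omega> \<in> space M"
  shows "a n \<omega> \<le> exp (real n * b + esum (\<lambda>x. indicator B x * w x) n \<omega> + (\<Sum>i\<in>{n - N..<n}. w ((\<sigma> ^^ i) \<omega>)))"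
  using \<open>\<omega> \<in> space M\<close>
proof (induction n arbitrary: \<omega> rule: less_induct)
  case (less n)
  let ?h = "\<lambda>x. indicator B x * w x"
  have u0: "u x \<ge> 0" if "x \<in> space M" for x using a that by (simp add: subcocycle_def)
  then have w0: "w x \<ge> 0" if "x \<in> space M" for x using that w[of x] by fastforce
  have h0: "?h x \<ge> 0" if "x \<in> space M" for x using w0[OF that] by (simp add: indicator_def)
  have hs: "0 \<le> esum ?h n x" if "x \<in> space M" for n x using h0 that by (rule esum_nonneg)
  show ?case
  proof (cases "n \<le> N")
    case True
    have "esum u n \<omega> \<le> (\<Sum>i<n. b + w ((\<sigma> ^^ i) \<omega>))"
      unfolding esum_def by (intro sum_mono) (simp add: w)
    also have "\<dots> = real n * b + (\<Sum>i\<in>{n - N..<n}. w ((\<sigma> ^^ i) \<omega>))"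
      using True by (simp add: sum.distrib atLeast0LessThan)
    also have "\<dots> \<le> real n * b + esum ?h n \<omega> + (\<Sum>i\<in>{n - N..<n}. w ((\<sigma> ^^ i) \<omega>))"
      using hs[OF less.prems, of n] by simp
    finally show ?thesis using subcocycle_le_esum[OF a less.prems, of n] by (meson exp_le_cancel_iff order_trans)
  next
    case False
    have step: "\<exists>m. 0 < m \<and> m \<le> max 1 N \<and> a m \<omega> \<le> exp (real m * b + esum ?h m \<omega>)"
    proof (cases "\<omega> \<in> B")
      case True
      have "a 1 \<omega> \<le> exp (u \<omega>)" using a less.prems by (simp add: subcocycle_def)
      also have "\<dots> \<le> exp (real 1 * b + esum ?h 1 \<omega>)" using True by (simp add: w)
      finally show ?thesis by (intro exI[of _ 1]) auto
    next
      case False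
      then obtain m where m: "m \<in> {1..N}" "a m \<omega> \<le> exp (real m * b)" using good less.prems by blast
      have "a m \<omega> \<le> exp (real m * b + esum ?h m \<omega>)"
        using m(2) hs[OF less.prems, of m] by (smt (verit) exp_le_cancel_iff)
      then show ?thesis using m(1) by (intro exI[of _ m]) auto
    qed
    then obtain m where m: "0 < m" "m \<le> max 1 N" "a m \<omega> \<le> exp (real m * b + esum ?h m \<omega>)" by blast
    have mn: "m \<le> n" using m False by auto
    let ?\<omega> = "(\<sigma> ^^ m) \<omega>"
    have sp: "?\<omega> \<in> space M" using less.prems by (rule iter_space)
    have "(\<Sum>i\<in>{n - m - N..<n - m}. w ((\<sigma> ^^ i) ?\<omega>)) = (\<Sum>i\<in>{n - m - N..<n - m}. w ((\<sigma> ^^ (i + m)) \<omega>))"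
      by (simp add: funpow_add)
    also have "\<dots> = (\<Sum>i\<in>{n - m - N + m..<n - m + m}. w ((\<sigma> ^^ i) \<omega>))"
      by (rule sum.shift_bounds_nat_ivl[symmetric])
    also have "\<dots> \<le> (\<Sum>i\<in>{n - N..<n}. w ((\<sigma> ^^ i) \<omega>))"
      using mn w0 iter_space[OF less.prems] by (intro sum_mono2) auto
    finally have tail: "(\<Sum>i\<in>{n - m - N..<n - m}. w ((\<sigma> ^^ i) ?\<omega>)) \<le> (\<Sum>i\<in>{n - N..<n}. w ((\<sigma> ^^ i) \<omega>))" .
    have "a (m + (n - m)) \<omega> \<le> a m \<omega> * a (n - m) ?\<omega>"
      using a less.prems unfolding subcocycle_def by blast
    also have "\<dots> \<le> exp (real m * b + esum ?h m \<omega>) *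
        exp (real (n - m) * b + esum ?h (n - m) ?\<omega> + (\<Sum>i\<in>{n - m - N..<n - m}. w ((\<sigma> ^^ i) ?\<omega>)))"
    proof (intro mult_mono m(3) less.IH sp)
      show "n - m < n" using m mn by auto
      show "0 \<le> a (n - m) ?\<omega>" using a sp by (simp add: subcocycle_def)
    qed simp
    also have "\<dots> = exp ((real m * b + esum ?h m \<omega>) +
        (real (n - m) * b + esum ?h (n - m) ?\<omega> + (\<Sum>i\<in>{n - m - N..<n - m}. w ((\<sigma> ^^ i) ?\<omega>))))"
      by (simp only: exp_add)
    also have "\<dots> \<le> exp (real n * b + esum ?h n \<omega> + (\<Sum>i\<in>{n - N..<n}. w ((\<sigma> ^^ i) \<omega>)))"
      using tail esum_add[of ?h m "n - m" \<omega>] mn by (simp add: of_nat_diff algebra_simps)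
    finally show ?thesis using mn by simp
  qed
qed

lemma tail_integral_small:
  fixes w :: "'w \<Rightarrow> real"
  assumes w: "integrable M w" and e: "e > 0"
  obtains K :: nat where "(\<integral>\<omega>. max 0 (w \<omega> - real K) \<partial>M) < e"
proof -
  have "(\<lambda>K. \<integral>\<omega>. max 0 (w \<omega> - real K) \<partial>M) \<longlonglongrightarrow> (\<integral>\<omega>. 0 \<partial>M)"
  proof (rule integral_dominated_convergence[where w = "\<lambda>\<omega>. \<bar>w \<omega>\<bar>"])
    show "AE \<omega> in M. (\<lambda>K. max 0 (w \<omega> - real K)) \<longlonglongrightarrow> 0"
    proof (intro AE_I2 tendsto_eventually)
      fix \<omega>
      obtain K :: nat where "w \<omega> \<le> real K" using real_arch_simple by blast
      then show "\<forall>\<^sub>F K in sequentially. max 0 (w \<omega> - real K) = 0"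
        by (intro eventually_sequentiallyI[of K]) auto
    qed
  qed (use w in auto)
  then have "\<forall>\<^sub>F K in sequentially. (\<integral>\<omega>. max 0 (w \<omega> - real K) \<partial>M) < e"
    using e by (intro order_tendstoD(2)) auto
  then obtain K where "(\<integral>\<omega>. max 0 (w \<omega> - real K) \<partial>M) < e" by (auto simp: eventually_sequentially)
  then show thesis by (rule that)
qed

text \<open>
  In \<open>subcocycle_greedy\<close> the excess over \<open>b\<close> is an ergodic sum plus a tail of \<open>N\<close> terms. Truncating \<open>w\<close>
  at a constant \<open>K\<close> bounds the tail by \<open>N * K\<close> plus an ergodic sum of small integral.
\<close>

lemma subcocycle_growth_upper:
  assumes a: "subcocycle a u"
    and good: "\<And>x. x \<in> space M \<Longrightarrow> x \<notin> B \<Longrightarrow> \<exists>n\<in>{1..N}. a n x \<le> exp (real n * b)"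
    and B: "B \<in> sets M" and small: "(\<integral>\<omega>. indicator B \<omega> * (u \<omega> + \<bar>b\<bar>) \<partial>M) < c"
  shows "AE \<omega> in M. \<forall>\<^sub>F n in sequentially. a n \<omega> \<le> exp (real n * (b + c))"
proof -
  define w where "w x = u x + \<bar>b\<bar>" for x
  define h where "h x = indicator B x * w x" for x
  have u: "integrable M u" "\<And>x. x \<in> space M \<Longrightarrow> u x \<ge> 0" using a by (auto simp: subcocycle_def)
  have wi: "integrable M w" unfolding w_def[abs_def] using u by simp
  have w0: "w x \<ge> 0" if "x \<in> space M" for x using u(2)[OF that] by (simp add: w_def)
  have hi: "integrable M h" unfolding h_def[abs_def]
    using integrable_real_mult_indicator[OF B wi] by (simp add: mult.commute)
  have h0: "h x \<ge> 0" if "x \<in> space M" for x using w0[OF that] by (simp add: h_def indicator_def)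
  have hc: "(\<integral>\<omega>. h \<omega> \<partial>M) < c" using small by (simp add: h_def w_def)
  obtain K :: nat where K: "(\<integral>\<omega>. max 0 (w \<omega> - real K) \<partial>M) < c - (\<integral>\<omega>. h \<omega> \<partial>M)"
    using tail_integral_small[OF wi, of "c - (\<integral>\<omega>. h \<omega> \<partial>M)"] hc by auto
  define g where "g x = h x + max 0 (w x - real K)" for x
  have ti: "integrable M (\<lambda>\<omega>. max 0 (w \<omega> - real K))" using wi by (intro integrable_max) auto
  have gi: "integrable M g" unfolding g_def[abs_def] using hi ti by simp
  have "(\<integral>\<omega>. g \<omega> \<partial>M) < c" unfolding g_def using hi ti K by simp
  then obtain c' where c': "(\<integral>\<omega>. g \<omega> \<partial>M) < c'" "c' < c" using dense by blast
  have "AE \<omega> in M. \<forall>\<^sub>F n in sequentially. esum g n \<omega> \<le> c' * real n"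
    using h0 by (intro ergodic_sum_upper gi c'(1)) (auto simp: g_def)
  then show ?thesis
  proof (rule AE_mp, intro AE_I2 impI)
    fix \<omega> assume \<omega>: "\<omega> \<in> space M" and ev: "\<forall>\<^sub>F n in sequentially. esum g n \<omega> \<le> c' * real n"
    have "\<forall>\<^sub>F n in sequentially. nat \<lceil>real N * real K / (c - c')\<rceil> \<le> n" by (rule eventually_ge_at_top)
    with ev show "\<forall>\<^sub>F n in sequentially. a n \<omega> \<le> exp (real n * (b + c))"
    proof eventually_elim
      case (elim n)
      have "(\<Sum>i\<in>{n - N..<n}. w ((\<sigma> ^^ i) \<omega>)) \<le> (\<Sum>i\<in>{n - N..<n}. real K + max 0 (w ((\<sigma> ^^ i) \<omega>) - real K))"
        by (intro sum_mono) simp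
      also have "\<dots> = real (card {n - N..<n}) * real K + (\<Sum>i\<in>{n - N..<n}. max 0 (w ((\<sigma> ^^ i) \<omega>) - real K))"
        by (simp add: sum.distrib)
      also have "\<dots> \<le> real N * real K + esum (\<lambda>x. max 0 (w x - real K)) n \<omega>"
        unfolding esum_def by (intro add_mono mult_right_mono sum_mono2) auto
      finally have "esum h n \<omega> + (\<Sum>i\<in>{n - N..<n}. w ((\<sigma> ^^ i) \<omega>)) \<le> real N * real K + esum g n \<omega>"
        using esum_plus[of h "\<lambda>x. max 0 (w x - real K)" n \<omega>] by (simp add: g_def[abs_def])
      also have "\<dots> \<le> (c - c') * real n + c' * real n"
      proof (intro add_mono)
        have "real N * real K / (c - c') \<le> real n" using elim(2) by linarith
        then show "real N * real K \<le> (c - c') * real n" using c'(2) by (simp add: field_simps)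
      qed (use elim in auto)
      finally have "esum h n \<omega> + (\<Sum>i\<in>{n - N..<n}. w ((\<sigma> ^^ i) \<omega>)) \<le> c * real n" by (simp add: algebra_simps)
      then have "real n * b + esum h n \<omega> + (\<Sum>i\<in>{n - N..<n}. w ((\<sigma> ^^ i) \<omega>)) \<le> real n * (b + c)"
        by (simp add: algebra_simps)
      moreover have "a n \<omega> \<le> exp (real n * b + esum h n \<omega> + (\<Sum>i\<in>{n - N..<n}. w ((\<sigma> ^^ i) \<omega>)))"
        unfolding h_def[abs_def] by (rule subcocycle_greedy[OF a good w_def \<omega>])
      ultimately show ?case by (meson exp_le_cancel_iff order_trans)
    qed
  qed
qed

text \<open>
  By dominated convergence the integrals over the bad sets tend to \<open>0\<close>. This works for sequences
  \<open>a N\<close> that change with \<open>N\<close>, since they share the dominating function \<open>u\<close>.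
\<close>

lemma subcocycle_shrinking_bad_set:
  assumes a: "\<And>N. subcocycle (a N) u" and u: "integrable M u"
    and B: "\<And>N. B N \<in> sets M" and null: "AE \<omega> in M. \<exists>N. \<forall>n\<ge>N. \<omega> \<notin> B n"
    and good: "\<And>N x. x \<in> space M \<Longrightarrow> x \<notin> B N \<Longrightarrow> \<exists>n\<in>{1..N}. a N n x \<le> exp (real n * b)"
    and bt: "b < t"
  shows "\<forall>\<^sub>F N in sequentially. AE \<omega> in M. \<forall>\<^sub>F n in sequentially. a N n \<omega> \<le> exp (real n * t)"
proof -
  have wi: "integrable M (\<lambda>\<omega>. u \<omega> + \<bar>b\<bar>)" using u by simp
  have "(\<lambda>N. \<integral>\<omega>. indicator (B N) \<omega> * (u \<omega> + \<bar>b\<bar>) \<partial>M) \<longlonglongrightarrow> (\<integral>\<omega>. 0 \<partial>M)"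
  proof (rule integral_dominated_convergence[where w = "\<lambda>\<omega>. \<bar>u \<omega> + \<bar>b\<bar>\<bar>"])
    show "AE \<omega> in M. (\<lambda>N. indicator (B N) \<omega> * (u \<omega> + \<bar>b\<bar>)) \<longlonglongrightarrow> 0"
      using null
    proof (rule AE_mp, intro AE_I2 impI tendsto_eventually)
      fix \<omega> assume "\<exists>N. \<forall>n\<ge>N. \<omega> \<notin> B n"
      then obtain N where "\<And>n. n \<ge> N \<Longrightarrow> \<omega> \<notin> B n" by blast
      then show "\<forall>\<^sub>F N in sequentially. indicator (B N) \<omega> * (u \<omega> + \<bar>b\<bar>) = 0"
        by (intro eventually_sequentiallyI[of N]) auto
    qed
    fix N
    show "(\<lambda>\<omega>. indicator (B N) \<omega> * (u \<omega> + \<bar>b\<bar>)) \<in> borel_measurable M"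
      using B u by measurable
    show "AE \<omega> in M. norm (indicator (B N) \<omega> * (u \<omega> + \<bar>b\<bar>)) \<le> \<bar>u \<omega> + \<bar>b\<bar>\<bar>"
      by (auto simp: indicator_def)
  qed (use wi in auto)
  then have "\<forall>\<^sub>F N in sequentially. (\<integral>\<omega>. indicator (B N) \<omega> * (u \<omega> + \<bar>b\<bar>) \<partial>M) < t - b"
    using bt by (intro order_tendstoD(2)) auto
  then show ?thesis
  proof eventually_elim
    case (elim N)
    from subcocycle_growth_upper[OF a[of N] good B elim] show ?case by simp
  qed
qed

text \<open>
  Kingman's theorem for an ergodic map. The set \<open>A b\<close> where the lower rate is below \<open>b\<close> contains its
  preimage, so it has measure \<open>0\<close> or \<open>1\<close>. If it has measure \<open>1\<close>, almost every point has a time \<open>n\<close> with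
  \<open>a n \<le> exp (n * b)\<close>, and the greedy estimate carries this over to the upper rate. The rate is the
  infimum of the \<open>b\<close> for which \<open>A b\<close> has measure \<open>1\<close>.
\<close>

theorem subcocycle_rate_converges:
  assumes a: "subcocycle a u"
  obtains c where "c < \<infinity>" "AE \<omega> in M. rate (\<lambda>n. a n \<omega>) \<longlonglongrightarrow> c"
proof -
  have am [measurable]: "a n \<in> borel_measurable M" for n using a by (simp add: subcocycle_def)
  have u: "integrable M u" "\<And>x. x \<in> space M \<Longrightarrow> u x \<ge> 0" using a by (auto simp: subcocycle_def)
  define A where "A b = {\<omega> \<in> space M. \<exists>q\<in>\<rat> \<inter> {..<b}. \<forall>m. \<exists>n>m. a n \<omega> \<le> exp (real n * q)}" for b :: real
  have Am: "A b \<in> sets M" for b unfolding A_def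
    by (intro sets.sets_Collect_countable_Ex' countable_Int1 countable_rat) measurable
  have zero_one: "prob (A b) = 0 \<or> prob (A b) = 1" for b
  proof (rule zero_one_backward[OF Am], rule subsetI)
    fix \<omega> assume "\<omega> \<in> \<sigma> -` A b \<inter> space M"
    then obtain q where \<omega>: "\<omega> \<in> space M" and q: "q \<in> \<rat>" "q < b" "\<And>m. \<exists>n>m. a n (\<sigma> \<omega>) \<le> exp (real n * q)"
      by (auto simp: A_def)
    obtain q' where q': "q' \<in> \<rat>" "q < q'" "q' < b" using Rats_dense_in_real[OF q(2)] by blast
    have "\<exists>n>m. a n \<omega> \<le> exp (real n * q')" for m
    proof -
      obtain k :: nat where k: "(u \<omega> - q') / (q' - q) < real k" using reals_Archimedean2 by blast
      obtain n where n: "n > max m k" "a n (\<sigma> \<omega>) \<le> exp (real n * q)" using q(3) by blast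
      have "a (1 + n) \<omega> \<le> a 1 \<omega> * a n ((\<sigma> ^^ 1) \<omega>)" using a \<omega> unfolding subcocycle_def by blast
      also have "\<dots> \<le> exp (u \<omega>) * exp (real n * q)"
        using a \<omega> n(2) measurable_space[OF measurable_map \<omega>] by (intro mult_mono) (auto simp: subcocycle_def)
      also have "\<dots> = exp (u \<omega> + real n * q)" by (simp add: exp_add)
      also have "\<dots> \<le> exp (real (1 + n) * q')"
      proof -
        have "(u \<omega> - q') / (q' - q) < real n" using k n(1) by simp
        then have "u \<omega> - q' < real n * (q' - q)" using q'(2) by (simp add: field_simps)
        then show ?thesis by (simp add: algebra_simps)
      qed
      finally show ?thesis using n(1) by (intro exI[of _ "1 + n"]) auto
    qed
    then show "\<omega> \<in> A b" using \<omega> q' by (auto simp: A_def)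
  qed
  have upper: "AE \<omega> in M. \<forall>\<^sub>F n in sequentially. a n \<omega> \<le> exp (real n * t)" if b: "prob (A b) = 1" "b < t" for b t
  proof -
    define B where "B N = {\<omega> \<in> space M. \<forall>n\<in>{1..N}. exp (real n * b) < a n \<omega>}" for N :: nat
    have Bm: "B N \<in> sets M" for N unfolding B_def by measurable
    have "AE \<omega> in M. \<omega> \<in> A b" using b(1) Am by (simp add: prob_eq_1)
    then have null: "AE \<omega> in M. \<exists>N. \<forall>n\<ge>N. \<omega> \<notin> B n"
    proof (rule AE_mp, intro AE_I2 impI)
      fix \<omega> assume "\<omega> \<in> A b"
      then obtain q where q: "q < b" "\<And>m. \<exists>n>m. a n \<omega> \<le> exp (real n * q)" unfolding A_def by blast
      obtain n where n: "n > 0" "a n \<omega> \<le> exp (real n * q)" using q(2) by blast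
      note n(2)
      also have "exp (real n * q) \<le> exp (real n * b)" using q(1) by (simp add: mult_left_mono)
      finally have "\<forall>N\<ge>n. \<omega> \<notin> B N" using n(1) by (auto simp: B_def not_less intro!: bexI[of _ n])
      then show "\<exists>N. \<forall>n\<ge>N. \<omega> \<notin> B n" by blast
    qed
    have "\<forall>\<^sub>F N in sequentially. AE \<omega> in M. \<forall>\<^sub>F n in sequentially. a n \<omega> \<le> exp (real n * t)"
      by (rule subcocycle_shrinking_bad_set[OF a u(1) Bm null _ b(2)]) (auto simp: B_def not_less)
    then show ?thesis by (simp add: eventually_const_iff)
  qed
  have lower: "AE \<omega> in M. \<forall>\<^sub>F n in sequentially. exp (real n * t) < a n \<omega>" if b: "prob (A b) = 0" "t < b" for b t
  proof -
    have "AE \<omega> in M. \<omega> \<notin> A b" by (rule AE_prob_zero[OF Am b(1)])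
    then show ?thesis
    proof (rule AE_mp, intro AE_I2 impI)
      fix \<omega> assume \<omega>: "\<omega> \<in> space M" "\<omega> \<notin> A b"
      obtain q where q: "q \<in> \<rat>" "t < q" "q < b" using Rats_dense_in_real[OF b(2)] by blast
      then have "\<not> (\<forall>m. \<exists>n>m. a n \<omega> \<le> exp (real n * q))" using \<omega> unfolding A_def by blast
      then obtain m where m: "\<And>n. n > m \<Longrightarrow> exp (real n * q) < a n \<omega>" using not_le by blast
      show "\<forall>\<^sub>F n in sequentially. exp (real n * t) < a n \<omega>"
        using eventually_gt_at_top[of m]
      proof eventually_elim
        case (elim n)
        have "exp (real n * t) \<le> exp (real n * q)" using q(2) by (simp add: mult_left_mono)
        then show ?case using m[OF elim] by (rule le_less_trans)
      qed
    qed
  qed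
  define c where "c = Inf {ereal b | b. prob (A b) = 1}"
  have cU: "AE \<omega> in M. \<forall>\<^sub>F n in sequentially. a n \<omega> \<le> exp (real n * t)" if "c < ereal t" for t
    using that upper unfolding c_def Inf_less_iff by auto
  have cL: "AE \<omega> in M. \<forall>\<^sub>F n in sequentially. exp (real n * t) < a n \<omega>" if t: "ereal t < c" for t
  proof -
    obtain b where b: "ereal t < ereal b" "ereal b < c" using ereal_dense2[OF t] by blast
    have "prob (A b) \<noteq> 1"
    proof
      assume "prob (A b) = 1"
      then have "c \<le> ereal b" unfolding c_def by (intro Inf_lower) auto
      with b(2) show False by simp
    qed
    then show ?thesis using zero_one[of b] b(1) by (intro lower) auto
  qed
  have bound: "AE \<omega> in M. \<forall>\<^sub>F n in sequentially. a n \<omega> \<le> exp (real n * t)" if t: "(\<integral>\<omega>. u \<omega> \<partial>M) < t" for t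
  proof -
    have "AE \<omega> in M. \<forall>\<^sub>F n in sequentially. esum u n \<omega> \<le> t * real n" by (rule ergodic_sum_upper[OF u t])
    then show ?thesis
    proof (rule AE_mp, intro AE_I2 impI)
      fix \<omega> assume \<omega>: "\<omega> \<in> space M" and "\<forall>\<^sub>F n in sequentially. esum u n \<omega> \<le> t * real n"
      from this(2) show "\<forall>\<^sub>F n in sequentially. a n \<omega> \<le> exp (real n * t)"
      proof eventually_elim
        case (elim n)
        have "a n \<omega> \<le> exp (esum u n \<omega>)" by (rule subcocycle_le_esum[OF a \<omega>])
        also have "\<dots> \<le> exp (real n * t)" using elim by (simp add: mult.commute)
        finally show ?case .
      qed
    qed
  qed
  have "c < \<infinity>"
  proof (rule ccontr)
    assume "\<not> c < \<infinity>"
    then have "c = \<infinity>" by simp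
    define t where "t = (\<integral>\<omega>. u \<omega> \<partial>M) + 1"
    have "AE \<omega> in M. \<forall>\<^sub>F n in sequentially. exp (real n * t) < a n \<omega>" using cL \<open>c = \<infinity>\<close> by simp
    moreover have "AE \<omega> in M. \<forall>\<^sub>F n in sequentially. a n \<omega> \<le> exp (real n * t)" by (rule bound) (simp add: t_def)
    ultimately have "AE \<omega> in M. False"
    proof eventually_elim
      case (elim \<omega>)
      then have "\<forall>\<^sub>F n in sequentially. False" by eventually_elim simp
      then show ?case by simp
    qed
    then show False using emeasure_space_1 by (simp add: AE_False)
  qed
  moreover have "AE \<omega> in M. rate (\<lambda>n. a n \<omega>) \<longlonglongrightarrow> c"
  proof -
    have "AE \<omega> in M. \<forall>t\<in>\<rat>. c < ereal t \<longrightarrow> (\<forall>\<^sub>F n in sequentially. a n \<omega> \<le> exp (real n * t))"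
      by (intro AE_ball_countable[THEN iffD2] countable_rat ballI) (use cU in auto)
    moreover have "AE \<omega> in M. \<forall>t\<in>\<rat>. ereal t < c \<longrightarrow> (\<forall>\<^sub>F n in sequentially. exp (real n * t) < a n \<omega>)"
      by (intro AE_ball_countable[THEN iffD2] countable_rat ballI) (use cL in auto)
    ultimately show ?thesis
    proof eventually_elim
      case (elim \<omega>)
      show ?case unfolding rate_tendsto_iff
      proof (intro conjI allI impI)
        fix t assume "c < ereal t"
        then obtain s where s: "c < ereal s" "s < t" using ereal_dense2 by fastforce
        obtain q where q: "q \<in> \<rat>" "s < q" "q < t" using Rats_dense_in_real[OF s(2)] by blast
        have "c < ereal q" using s(1) q(2) by (meson ereal_less_eq(3) less_imp_le less_le_trans)
        then have "\<forall>\<^sub>F n in sequentially. a n \<omega> \<le> exp (real n * q)" using elim q(1) by blast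
        then show "\<forall>\<^sub>F n in sequentially. a n \<omega> \<le> exp (real n * t)"
        proof eventually_elim
          case (elim n)
          have "exp (real n * q) \<le> exp (real n * t)" using q(3) by (simp add: mult_left_mono)
          with elim show ?case by (rule order_trans)
        qed
      next
        fix t assume "ereal t < c"
        then obtain s where s: "t < s" "ereal s < c" using ereal_dense2 by fastforce
        obtain q where q: "q \<in> \<rat>" "t < q" "q < s" using Rats_dense_in_real[OF s(1)] by blast
        have "ereal q < c" using s(2) q(3) by (meson ereal_less_eq(3) less_imp_le le_less_trans)
        then have "\<forall>\<^sub>F n in sequentially. exp (real n * q) < a n \<omega>" using elim q(1) by blast
        then show "\<forall>\<^sub>F n in sequentially. exp (real n * t) < a n \<omega>"
        proof eventually_elim
          case (elim n)
          have "exp (real n * t) \<le> exp (real n * q)" using q(2) by (simp add: mult_left_mono)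
          then show ?case using elim by (rule le_less_trans)
        qed
      qed
    qed
  qed
  ultimately show thesis by (rule that)
qed

end

section \<open>Exponents of the operator cocycle\<close>

lemma cocycle_add:
  "cocycle \<sigma> L (n + m) \<omega> = cocycle \<sigma> L m ((\<sigma> ^^ n) \<omega>) o\<^sub>L cocycle \<sigma> L n \<omega>"
proof (induction m)
  case (Suc m)
  have "(\<sigma> ^^ m) ((\<sigma> ^^ n) \<omega>) = (\<sigma> ^^ (n + m)) \<omega>" by (metis add.commute comp_apply funpow_add)
  then show ?case using Suc by (intro blinfun_eqI) simp
qed (simp add: blinfun_eqI)

lemma (in ergodic_system) cocycle_strongly_measurable:
  fixes L :: "'w \<Rightarrow> 'a::real_normed_vector \<Rightarrow>\<^sub>L 'a"
  assumes L: "strongly_measurable M L" and sep: "separable_space (euclidean :: 'a topology)"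
  shows "strongly_measurable M (cocycle \<sigma> L n)"
proof (induction n)
  case 0
  then show ?case by (simp add: strongly_measurable_def)
next
  case (Suc n)
  have "strongly_measurable M (\<lambda>\<omega>. L ((\<sigma> ^^ n) \<omega>))"
    using L measurable_compose[OF iter_measurable] unfolding strongly_measurable_def by blast
  from strongly_measurable_compose[OF this Suc sep] show ?case by simp
qed

text \<open>
  Both families of gauges enter the ergodic theorem through this lemma.
\<close>

lemma (in ergodic_system) gauge_subcocycle:
  fixes L :: "'w \<Rightarrow> 'a::real_normed_vector \<Rightarrow>\<^sub>L 'a" and q :: "('a \<Rightarrow>\<^sub>L 'a) \<Rightarrow> real"
  assumes mult: "\<And>S T. q (S o\<^sub>L T) \<le> q S * q T" and nonneg: "\<And>T. 0 \<le> q T" and le: "\<And>T. q T \<le> norm T ^ k"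
    and meas: "\<And>A. strongly_measurable M A \<Longrightarrow> (\<lambda>\<omega>. q (A \<omega>)) \<in> borel_measurable M"
    and L: "strongly_measurable M L" and sep: "separable_space (euclidean :: 'a topology)"
    and int: "forward_integrable M L"
  shows "subcocycle (\<lambda>n \<omega>. q (cocycle \<sigma> L n \<omega>)) (\<lambda>\<omega>. real k * max 0 (ln (norm (L \<omega>))))"
  unfolding subcocycle_def
proof (intro conjI ballI allI)
  show "q (cocycle \<sigma> L 0 \<omega>) \<le> 1" for \<omega>
  proof -
    have "norm (id_blinfun :: 'a \<Rightarrow>\<^sub>L 'a) ^ k \<le> 1" by (rule power_le_one[OF norm_ge_zero norm_blinfun_id_le])
    then show ?thesis using le[of id_blinfun] by simp
  qed
  show "q (cocycle \<sigma> L (n + m) \<omega>) \<le> q (cocycle \<sigma> L n \<omega>) * q (cocycle \<sigma> L m ((\<sigma> ^^ n) \<omega>))" for n m \<omega>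
    unfolding cocycle_add by (subst mult.commute) (rule mult)
  show "q (cocycle \<sigma> L 1 \<omega>) \<le> exp (real k * max 0 (ln (norm (L \<omega>))))" for \<omega>
  proof -
    have "cocycle \<sigma> L 1 \<omega> = L \<omega>" by (simp add: blinfun_eqI)
    then have "q (cocycle \<sigma> L 1 \<omega>) \<le> norm (L \<omega>) ^ k" using le by simp
    also have "norm (L \<omega>) \<le> exp (max 0 (ln (norm (L \<omega>))))"
    proof (cases "L \<omega> = 0")
      case False
      then have "norm (L \<omega>) = exp (ln (norm (L \<omega>)))" by simp
      also have "\<dots> \<le> exp (max 0 (ln (norm (L \<omega>))))" by (simp only: exp_le_cancel_iff max.cobounded2)
      finally show ?thesis .
    qed simp
    then have "norm (L \<omega>) ^ k \<le> exp (max 0 (ln (norm (L \<omega>)))) ^ k" by (intro power_mono) auto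
    also have "\<dots> = exp (real k * max 0 (ln (norm (L \<omega>))))" by (simp add: exp_of_nat_mult)
    finally show ?thesis .
  qed
  show "(\<lambda>\<omega>. q (cocycle \<sigma> L n \<omega>)) \<in> borel_measurable M" for n
    by (rule meas[OF cocycle_strongly_measurable[OF L sep]])
qed (use nonneg int in \<open>auto simp: forward_integrable_def\<close>)

lemma (in prob_space) AE_witness:
  assumes "AE \<omega> in M. P \<omega>"
  shows "\<exists>\<omega>\<in>space M. P \<omega>"
proof (rule ccontr)
  assume "\<not> ?thesis"
  then have "AE \<omega> in M. False" using assms by (auto elim!: AE_mp)
  then show False by simp
qed

lemma (in prob_space) ae_lim_eq:
  assumes "AE \<omega> in M. (\<lambda>n. f n \<omega>) \<longlonglongrightarrow> c"
  shows "ae_lim M f = c"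
  unfolding ae_lim_def
proof (rule the_equality)
  show "AE \<omega> in M. (\<lambda>n. f n \<omega>) \<longlonglongrightarrow> c" by (rule assms)
next
  fix c' assume "AE \<omega> in M. (\<lambda>n. f n \<omega>) \<longlonglongrightarrow> c'"
  with assms have "AE \<omega> in M. c' = c" by eventually_elim (rule LIMSEQ_unique)
  then show "c' = c" using AE_witness by blast
qed

text \<open>
  As long as the rate of \<open>wedge_norm k\<close> is finite, the rate of \<open>rho (Suc k)\<close> is a difference. Once an
  exterior rate is \<open>-\<infinity>\<close>, the first such index already gives \<open>rho\<close> the rate \<open>-\<infinity>\<close>, and monotonicity of
  \<open>rho\<close> in \<open>k\<close> takes care of all later indices. The second conjunct in the induction keeps track of this.
\<close>

lemma (in ergodic_system) rho_rate_converges: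
  fixes L :: "'w \<Rightarrow> 'a::real_normed_vector \<Rightarrow>\<^sub>L 'a"
  assumes L: "strongly_measurable M L" and sep: "separable_space (euclidean :: 'a topology)"
    and int: "forward_integrable M L" and k: "k > 0"
  shows "\<exists>c. AE \<omega> in M. rate (\<lambda>n. rho k (cocycle \<sigma> L n \<omega>)) \<longlonglongrightarrow> c"
proof -
  have "\<exists>c<\<infinity>. AE \<omega> in M. rate (\<lambda>n. wedge_norm k (cocycle \<sigma> L n \<omega>)) \<longlonglongrightarrow> c" for k
  proof -
    have "subcocycle (\<lambda>n \<omega>. wedge_norm k (cocycle \<sigma> L n \<omega>)) (\<lambda>\<omega>. real k * max 0 (ln (norm (L \<omega>))))"
      by (intro gauge_subcocycle wedge_norm_compose wedge_norm_nonneg wedge_norm_le_power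
          wedge_norm_measurable L sep int)
    from subcocycle_rate_converges[OF this] show ?thesis by blast
  qed
  then have "\<exists>\<Delta>. \<forall>k. \<Delta> k < \<infinity> \<and> (AE \<omega> in M. rate (\<lambda>n. wedge_norm k (cocycle \<sigma> L n \<omega>)) \<longlonglongrightarrow> \<Delta> k)"
    by (intro choice allI)
  then obtain \<Delta> where fin: "\<And>k. \<Delta> k < \<infinity>"
    and \<Delta>: "\<And>k. AE \<omega> in M. rate (\<lambda>n. wedge_norm k (cocycle \<sigma> L n \<omega>)) \<longlonglongrightarrow> \<Delta> k" by blast
  have "\<Delta> 0 = 0"
  proof -
    obtain \<omega> where "rate (\<lambda>n. wedge_norm 0 (cocycle \<sigma> L n \<omega>)) \<longlonglongrightarrow> \<Delta> 0" 
      using AE_witness[OF \<Delta>[of 0]] by (rule bexE)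
    then have "(\<lambda>n::nat. 0 :: ereal) \<longlonglongrightarrow> \<Delta> 0" by (simp add: wedge_norm_0 elog_def flip: zero_ereal_def)
    then show ?thesis by (simp add: LIMSEQ_const_iff)
  qed
  have finite_step: "\<exists>c. (AE \<omega> in M. rate (\<lambda>n. rho (Suc k) (cocycle \<sigma> L n \<omega>)) \<longlonglongrightarrow> c) \<and> (\<Delta> (Suc k) = -\<infinity> \<longrightarrow> c = -\<infinity>)"
    if d: "\<Delta> k = ereal d" for k d
  proof (intro exI conjI impI)
    show "AE \<omega> in M. rate (\<lambda>n. rho (Suc k) (cocycle \<sigma> L n \<omega>)) \<longlonglongrightarrow> \<Delta> (Suc k) - ereal d"
      using \<Delta>[of "Suc k"] \<Delta>[of k]
    proof eventually_elim
      case (elim \<omega>)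
      show ?case
      proof (rule rate_quotient[OF elim(1) elim(2)[unfolded d], where C = "real (Suc k)"])
        fix n
        show "rho (Suc k) (cocycle \<sigma> L n \<omega>) * wedge_norm k (cocycle \<sigma> L n \<omega>)
            \<le> real (Suc k) * wedge_norm (Suc k) (cocycle \<sigma> L n \<omega>)" by (rule rho_wedge_norm_le)
        show "wedge_norm (Suc k) (cocycle \<sigma> L n \<omega>)
            \<le> real (Suc k) * (rho (Suc k) (cocycle \<sigma> L n \<omega>) * wedge_norm k (cocycle \<sigma> L n \<omega>))"
          using wedge_norm_Suc_le[of k "cocycle \<sigma> L n \<omega>"] by (simp only: mult.assoc)
      qed (auto simp: rho_nonneg wedge_norm_nonneg)
    qed
    show "\<Delta> (Suc k) - ereal d = -\<infinity>" if "\<Delta> (Suc k) = -\<infinity>" using that by simp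
  qed
  have "\<exists>c. (AE \<omega> in M. rate (\<lambda>n. rho (Suc k) (cocycle \<sigma> L n \<omega>)) \<longlonglongrightarrow> c) \<and> (\<Delta> (Suc k) = -\<infinity> \<longrightarrow> c = -\<infinity>)" for k
  proof (induction k)
    case 0
    show ?case by (rule finite_step[of 0 0]) (simp add: \<open>\<Delta> 0 = 0\<close> zero_ereal_def)
  next
    case (Suc k)
    show ?case
    proof (cases "\<Delta> (Suc k) = -\<infinity>")
      case True
      then have lim: "AE \<omega> in M. rate (\<lambda>n. rho (Suc k) (cocycle \<sigma> L n \<omega>)) \<longlonglongrightarrow> -\<infinity>" using Suc by auto
      have "AE \<omega> in M. rate (\<lambda>n. rho (Suc (Suc k)) (cocycle \<sigma> L n \<omega>)) \<longlonglongrightarrow> -\<infinity>"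
        using lim
      proof eventually_elim
        case (elim \<omega>)
        show ?case unfolding rate_tendsto_iff
        proof (intro conjI allI impI)
          fix t
          have "\<forall>\<^sub>F n in sequentially. rho (Suc k) (cocycle \<sigma> L n \<omega>) \<le> exp (real n * t)"
            using elim unfolding rate_tendsto_iff by simp
          then show "\<forall>\<^sub>F n in sequentially. rho (Suc (Suc k)) (cocycle \<sigma> L n \<omega>) \<le> exp (real n * t)"
            by eventually_elim (rule order_trans[OF rho_Suc_le], simp_all)
        qed simp
      qed
      then show ?thesis by blast
    next
      case False
      then obtain d where "\<Delta> (Suc k) = ereal d" using fin[of "Suc k"] by (cases "\<Delta> (Suc k)") auto
      then show ?thesis by (rule finite_step)
    qed
  qed
  moreover obtain m where "k = Suc m" using k gr0_implies_Suc by blast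
  ultimately show ?thesis by blast
qed

theorem lemma32:
  fixes M :: "'w measure"
    and \<sigma> :: "'w \<Rightarrow> 'w"
    and L :: "'w \<Rightarrow> 'a::banach \<Rightarrow>\<^sub>L 'a"
  assumes "lebesgue_probability_space M"
    and "invertible_measure_preserving M \<sigma>"
    and "ergodic M \<sigma>"
    and "separable_space (euclidean :: 'a topology)"
    and "strongly_measurable M L"
    and "forward_integrable M L"
  shows "AE \<omega> in M.
    mu M \<sigma> L \<longlonglongrightarrow> nu M \<sigma> L \<and>
    nu M \<sigma> L = kappa M \<sigma> L \<and>
    (\<lambda>n. ereal (1 / real n) * elog (compactness_seminorm (cocycle \<sigma> L n \<omega>)))
      \<longlonglongrightarrow> kappa M \<sigma> L"
proof -
  interpret prob_space M using assms(1) by (simp add: lebesgue_probability_space_def)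
  interpret ergodic_system M \<sigma>
    using assms(2,3) by unfold_locales (auto simp: invertible_measure_preserving_def)
  note sep = assms(4) and L = assms(5) and int = assms(6)
  define T where "T n \<omega> = cocycle \<sigma> L n \<omega>" for n \<omega>
  have sub: "subcocycle (\<lambda>n \<omega>. entropy_gauge s (T n \<omega>)) (\<lambda>\<omega>. real 1 * max 0 (ln (norm (L \<omega>))))" for s
    unfolding T_def
    by (intro gauge_subcocycle entropy_gauge_compose entropy_gauge_nonneg entropy_gauge_measurable L sep int)
       (simp add: entropy_gauge_le_norm)
  obtain \<kappa> where \<kappa>: "AE \<omega> in M. rate (\<lambda>n. entropy_gauge 0 (T n \<omega>)) \<longlonglongrightarrow> \<kappa>"
    using subcocycle_rate_converges[OF sub] by blast
  have kappa: "kappa M \<sigma> L = \<kappa>"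
    unfolding kappa_def by (rule ae_lim_eq) (use \<kappa> in \<open>simp add: compactness_seminorm_eq_entropy_gauge T_def\<close>)
  have mu: "AE \<omega> in M. rate (\<lambda>n. rho k (T n \<omega>)) \<longlonglongrightarrow> mu M \<sigma> L k" if k: "k > 0" for k
  proof -
    obtain c where c: "AE \<omega> in M. rate (\<lambda>n. rho k (T n \<omega>)) \<longlonglongrightarrow> c"
      using rho_rate_converges[OF L sep int k] unfolding T_def by blast
    moreover have "mu M \<sigma> L k = c"
      unfolding mu_def by (rule ae_lim_eq) (use c in \<open>simp add: T_def\<close>)
    ultimately show ?thesis by simp
  qed
  have dec: "mu M \<sigma> L (Suc k) \<le> mu M \<sigma> L k" if k: "k > 0" for k
  proof -
    have "AE \<omega> in M. mu M \<sigma> L (Suc k) \<le> mu M \<sigma> L k"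
      using mu[of "Suc k", simplified] mu[OF k]
      by eventually_elim (rule rate_limit_mono[where C = 1], auto intro: rho_Suc_le k)
    then show ?thesis using AE_witness by blast
  qed
  have "decseq (\<lambda>k. mu M \<sigma> L (Suc k))" by (rule decseq_SucI) (simp add: dec)
  from LIMSEQ_INF[OF this] have lim: "mu M \<sigma> L \<longlonglongrightarrow> (INF k. mu M \<sigma> L (Suc k))"
    by (rule LIMSEQ_imp_Suc)
  then have nu: "nu M \<sigma> L = (INF k. mu M \<sigma> L (Suc k))" unfolding nu_def by (rule limI)
  have lower: "\<kappa> \<le> mu M \<sigma> L k" if k: "k > 0" for k
  proof -
    have "AE \<omega> in M. \<kappa> \<le> mu M \<sigma> L k"
      using \<kappa> mu[OF k]
      by eventually_elim
         (rule rate_limit_mono[where C = "2 * real k ^ 2"], auto intro: entropy_gauge_0_le_rho simp: k)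
    then show ?thesis using AE_witness by blast
  qed
  have upper: "nu M \<sigma> L \<le> ereal t" if t: "\<kappa> < ereal t" for t
  proof -
    obtain b' b where b: "\<kappa> < ereal b'" "b' < b" "b < t" using ereal_dense_real[OF t] by auto
    \<comment> \<open>The same \<open>N\<close> bounds the waiting time and selects the gauge; both make \<open>B N\<close> shrink.\<close>
    define B where "B N = {\<omega> \<in> space M. \<forall>n\<in>{1..N}. exp (real n * b) < entropy_gauge (1 / real N) (T n \<omega>)}" for N
    have [measurable]: "(\<lambda>\<omega>. entropy_gauge s (T n \<omega>)) \<in> borel_measurable M" for s n
      using sub[of s] by (simp add: subcocycle_def)
    have Bm: "B N \<in> sets M" for N unfolding B_def by measurable
    have null: "AE \<omega> in M. \<exists>N. \<forall>n\<ge>N. \<omega> \<notin> B n"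
      using \<kappa>
    proof eventually_elim
      case (elim \<omega>)
      then have "\<forall>\<^sub>F n in sequentially. entropy_gauge 0 (T n \<omega>) \<le> exp (real n * b')"
        using b(1) unfolding rate_tendsto_iff by blast
      from eventually_conj[OF this eventually_gt_at_top[of 0]]
      obtain n where n: "n > 0" "entropy_gauge 0 (T n \<omega>) \<le> exp (real n * b')"
        using eventually_happens'[OF sequentially_bot] by blast
      have "exp (real n * b') < exp (real n * b)" using n(1) b(2) by simp
      with n(2) have "entropy_gauge 0 (T n \<omega>) < exp (real n * b)" by (rule le_less_trans)
      then obtain N0 where N0: "\<And>k. k \<ge> N0 \<Longrightarrow> entropy_gauge (1 / real k) (T n \<omega>) < exp (real n * b)"
        using entropy_gauge_inverse_nat_less by blast
      have "\<omega> \<notin> B k" if k: "k \<ge> max n N0" for k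
      proof
        assume "\<omega> \<in> B k"
        moreover have "n \<in> {1..k}" using k n(1) by simp
        ultimately have "exp (real n * b) < entropy_gauge (1 / real k) (T n \<omega>)"
          unfolding B_def by blast
        then show False using N0[of k] k by simp
      qed
      then show ?case by blast
    qed
    have "\<forall>\<^sub>F N in sequentially. AE \<omega> in M. \<forall>\<^sub>F n in sequentially. entropy_gauge (1 / real N) (T n \<omega>) \<le> exp (real n * t)"
      by (rule subcocycle_shrinking_bad_set[OF sub _ Bm null _ b(3)])
         (use int in \<open>auto simp: forward_integrable_def B_def not_less\<close>)
    then have "\<forall>\<^sub>F N in sequentially. 0 < N \<and>
        (AE \<omega> in M. \<forall>\<^sub>F n in sequentially. entropy_gauge (1 / real N) (T n \<omega>) \<le> exp (real n * t))"
      using eventually_gt_at_top[of 0] by eventually_elim simp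
    then obtain N where N: "N > 0"
      and ev: "AE \<omega> in M. \<forall>\<^sub>F n in sequentially. entropy_gauge (1 / real N) (T n \<omega>) \<le> exp (real n * t)"
      using eventually_happens' sequentially_bot by blast
    have "AE \<omega> in M. mu M \<sigma> L N \<le> ereal t"
      using ev mu[OF N]
    proof eventually_elim
      case (elim \<omega>)
      show ?case
      proof (rule rate_limit_le[OF elim(2) _ rho_le_entropy_gauge[OF N]])
        fix s assume "ereal t < ereal s"
        then have ts: "t < s" by simp
        from elim(1) show "\<forall>\<^sub>F n in sequentially. entropy_gauge (1 / real N) (T n \<omega>) \<le> exp (real n * s)"
        proof eventually_elim
          case (elim n)
          also have "exp (real n * t) \<le> exp (real n * s)" using ts by (simp add: mult_left_mono)
          finally show ?case .
        qed
      qed (use N in simp)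
    qed
    then have "mu M \<sigma> L N \<le> ereal t" using AE_witness by blast
    moreover have "nu M \<sigma> L \<le> mu M \<sigma> L N" unfolding nu using N by (metis INF_lower UNIV_I gr0_implies_Suc)
    ultimately show ?thesis by (rule order_trans[rotated])
  qed
  have "nu M \<sigma> L = \<kappa>"
  proof (rule antisym)
    show "nu M \<sigma> L \<le> \<kappa>"
    proof (rule ccontr)
      assume "\<not> nu M \<sigma> L \<le> \<kappa>"
      then obtain t where "\<kappa> < ereal t" "ereal t < nu M \<sigma> L" using ereal_dense2[of \<kappa> "nu M \<sigma> L"] by (auto simp: not_le)
      then show False using upper by (meson not_le)
    qed
    show "\<kappa> \<le> nu M \<sigma> L" unfolding nu by (intro INF_greatest lower) simp
  qed
  then show ?thesis
    using \<kappa> lim nu kappa by (simp add: compactness_seminorm_eq_entropy_gauge T_def)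
qed

end
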